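(* For all $g\ge0$ and $\ell\ge1$, $$\begin{aligned}\vec{\mathbf H}_g(x_1,x_2,\dots,x_\ell)={}&\delta_{g,0}\delta_{\ell,1}+x_1\vec{\mathbf H}_{g-1}(x_1,x_1,x_2,\dots,x_\ell)\\&+\sum_{j=2}^{\ell}\frac{\partial}{\partial x_j}\left(\frac{x_1\vec{\mathbf H}_g(x_1,\dots,\widehat{x_j},\dots,x_\ell)-x_j\vec{\mathbf H}_g(x_2,\dots,x_\ell)}{x_1-x_j}\right)\\&+\sum_{g'=0}^{g}\ \sum_{S\subseteq\{2,\dots,\ell\}}x_1\vec{\mathbf H}_{g'}(x_1,x_S)\,\vec{\mathbf H}_{g-g'}(x_1,x_{\overline S}),\end{aligned}$$ where $x_1,\dots,\widehat{x_j},\dots,x_\ell$ is the list of all variables $x_1,\dots,x_\ell$ except $x_j$, $x_S$ is the list of all variables $x_j$ with $j\in S$, and $x_{\overline S}$ is the list of all variables $x_j$ with $j\in\{2,\dots,\ell\}\setminus S$.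
   Context: For a composition $\alpha=(\alpha_1,\dots,\alpha_\ell)$ of $d\ge1$ with $\ell$ positive parts (order of parts irrelevant below) and $g\ge0$, $\vec H_g(\alpha)$ is the number of $(r+1)$-tuples $(\sigma,\tau_1,\dots,\tau_r)$ of permutations in the symmetric group on $\{1,\dots,d\}$, with $r=2g-2+\ell+d$, such that: $\sigma$ has cycle lengths given by $\alpha$ and the $\tau_i$ are transpositions; $\sigma\tau_1\cdots\tau_r$ is the identity; the group $\langle\sigma,\tau_1,\dots,\tau_r\rangle$ acts transitively on $\{1,\dots,d\}$; and, writing $\tau_i=(s_i\ t_i)$ with $s_i<t_i$, one has $t_1\le\dots\le t_r$. $|C_\alpha|$ is the number of permutations of $\{1,\dots,d\}$ with cycle lengths $\alpha$. For $g\ge0$, $\ell\ge1$ define the formal power series $$\vec{\mathbf H}_g(x_1,\dots,x_\ell)=\sum_{\alpha_1,\dots,\alpha_\ell\ge1}\frac{\vec H_g(\alpha)}{|C_\alpha|}x_1^{\alpha_1-1}x_2^{\alpha_2-1}\cdots x_\ell^{\alpha_\ell-1},$$ and $\vec{\mathbf H}_{-1}=0$. $\delta$ is the Kronecker delta. *)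

theory Defs
  imports
    Complex_Main
    "HOL-Library.Poly_Mapping"
    "HOL-Library.Multiset"
    "HOL-Combinatorics.Orbits"
    "HOL-Algebra.Sym_Groups"
begin

section \<open>Formal power series in the variables \<open>x\<^sub>0, x\<^sub>1, x\<^sub>2, \<dots>\<close>\<close>

text \<open>A monomial is its exponent vector, of type \<^typ>\<open>nat \<Rightarrow>\<^sub>0 nat\<close>; a series is an arbitrary
  family of coefficients.\<close>

typedef 'a mfps = "UNIV :: ((nat \<Rightarrow>\<^sub>0 nat) \<Rightarrow> 'a) set"
  morphisms mfps_coeff Abs_mfps ..

setup_lifting type_definition_mfps

lemma mfps_eqI: "(\<And>m. mfps_coeff f m = mfps_coeff g m) \<Longrightarrow> f = g"
  by transfer auto

definition splits :: "(nat \<Rightarrow>\<^sub>0 nat) \<Rightarrow> ((nat \<Rightarrow>\<^sub>0 nat) \<times> (nat \<Rightarrow>\<^sub>0 nat)) set" where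
  "splits m = {(a, b). a + b = m}"

lemma finite_dominated_monomials:
  "finite {a :: nat \<Rightarrow>\<^sub>0 nat. \<forall>i. Poly_Mapping.lookup a i \<le> Poly_Mapping.lookup m i}"
proof -
  let ?B = "{..Max (insert 0 (Poly_Mapping.lookup m ` Poly_Mapping.keys m))}"
  let ?F = "{f. \<forall>i. (i \<in> Poly_Mapping.keys m \<longrightarrow> f i \<in> ?B) \<and> (i \<notin> Poly_Mapping.keys m \<longrightarrow> f i = (0::nat))}"
  let ?A = "{a :: nat \<Rightarrow>\<^sub>0 nat. \<forall>i. Poly_Mapping.lookup a i \<le> Poly_Mapping.lookup m i}"
  have "finite ?F"
    by (rule finite_set_of_finite_funs) simp_all
  moreover have "Poly_Mapping.lookup ` ?A \<subseteq> ?F"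
  proof (clarify, intro conjI impI)
    fix a :: "nat \<Rightarrow>\<^sub>0 nat" and i
    assume le: "\<forall>i. Poly_Mapping.lookup a i \<le> Poly_Mapping.lookup m i"
    { assume "i \<in> Poly_Mapping.keys m"
      then have "Poly_Mapping.lookup m i \<le> Max (insert 0 (Poly_Mapping.lookup m ` Poly_Mapping.keys m))"
        by (intro Max_ge) auto
      then show "Poly_Mapping.lookup a i \<in> ?B" using le by (auto intro: le_trans) }
    { assume "i \<notin> Poly_Mapping.keys m"
      then show "Poly_Mapping.lookup a i = 0"
        using le by (metis in_keys_iff le_zero_eq) }
  qed
  moreover have "inj_on Poly_Mapping.lookup ?A"
    by (auto intro: inj_onI poly_mapping_eqI)
  ultimately show ?thesis
    by (meson finite_imageD finite_subset)
qed

lemma finite_splits [simp]: "finite (splits m)"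
proof (rule finite_subset)
  let ?A = "{a :: nat \<Rightarrow>\<^sub>0 nat. \<forall>i. Poly_Mapping.lookup a i \<le> Poly_Mapping.lookup m i}"
  show "splits m \<subseteq> ?A \<times> ?A"
    by (auto simp: splits_def lookup_add)
  show "finite (?A \<times> ?A)"
    using finite_dominated_monomials by blast
qed

instantiation mfps :: (comm_ring_1) comm_ring_1
begin

lift_definition zero_mfps :: "'a mfps" is "\<lambda>m. 0" .
lift_definition one_mfps :: "'a mfps" is "\<lambda>m. if m = 0 then 1 else 0" .
lift_definition plus_mfps :: "'a mfps \<Rightarrow> 'a mfps \<Rightarrow> 'a mfps" is "\<lambda>f g m. f m + g m" .
lift_definition minus_mfps :: "'a mfps \<Rightarrow> 'a mfps \<Rightarrow> 'a mfps" is "\<lambda>f g m. f m - g m" .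
lift_definition uminus_mfps :: "'a mfps \<Rightarrow> 'a mfps" is "\<lambda>f m. - f m" .
lift_definition times_mfps :: "'a mfps \<Rightarrow> 'a mfps \<Rightarrow> 'a mfps"
  is "\<lambda>f g m. \<Sum>(a, b)\<in>splits m. f a * g b" .

instance
proof
  fix f g h :: "'a mfps"
  show "f * g * h = f * (g * h)"
  proof (transfer, rule ext)
    fix f g h :: "(nat \<Rightarrow>\<^sub>0 nat) \<Rightarrow> 'a" and m
    have "(\<Sum>(u, c)\<in>splits m. (\<Sum>(a, b)\<in>splits u. f a * g b) * h c)
        = (\<Sum>x\<in>splits m. \<Sum>y\<in>splits (fst x). f (fst y) * g (snd y) * h (snd x))"
      by (simp add: sum_distrib_right case_prod_unfold)
    also have "\<dots> = (\<Sum>(x, y)\<in>(SIGMA x:splits m. splits (fst x)). f (fst y) * g (snd y) * h (snd x))"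
      by (rule sum.Sigma) auto
    also have "\<dots> = (\<Sum>(x, y)\<in>(SIGMA x:splits m. splits (snd x)). f (fst x) * (g (fst y) * h (snd y)))"
      by (rule sum.reindex_bij_witness
            [where i = "\<lambda>((a, v), (b, c)). ((a + b, c), (a, b))"
               and j = "\<lambda>((u, c), (a, b)). ((a, b + c), (b, c))"])
         (auto simp: splits_def algebra_simps)
    also have "\<dots> = (\<Sum>x\<in>splits m. \<Sum>y\<in>splits (snd x). f (fst x) * (g (fst y) * h (snd y)))"
      by (rule sum.Sigma [symmetric]) auto
    also have "\<dots> = (\<Sum>(a, v)\<in>splits m. f a * (\<Sum>(b, c)\<in>splits v. g b * h c))"
      by (simp add: sum_distrib_left case_prod_unfold)
    finally show "(\<Sum>(u, c)\<in>splits m. (\<Sum>(a, b)\<in>splits u. f a * g b) * h c)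
        = (\<Sum>(a, v)\<in>splits m. f a * (\<Sum>(b, c)\<in>splits v. g b * h c))" .
  qed
  show "f * g = g * f"
    by (transfer, rule ext,
        rule sum.reindex_bij_witness[where i = prod.swap and j = prod.swap])
       (auto simp: splits_def algebra_simps)
  show "1 * f = f"
  proof (transfer, rule ext)
    fix f :: "(nat \<Rightarrow>\<^sub>0 nat) \<Rightarrow> 'a" and m
    have "(\<Sum>(a, b)\<in>splits m. (if a = 0 then 1 else 0) * f b)
        = (\<Sum>(a, b)\<in>{(0 :: nat \<Rightarrow>\<^sub>0 nat, m)}. (if a = 0 then 1 else 0) * f b)"
      by (rule sum.mono_neutral_right [OF finite_splits])
         (auto simp: splits_def split: if_splits)
    then show "(\<Sum>(a, b)\<in>splits m. (if a = 0 then 1 else 0) * f b) = f m"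
      by simp
  qed
  show "(f + g) * h = f * h + g * h"
    by transfer (simp add: case_prod_unfold distrib_right sum.distrib)
  show "(0 :: 'a mfps) \<noteq> 1"
    by transfer (metis zero_neq_one)
qed (transfer, simp add: algebra_simps)+

end

lift_definition mfps_var :: "nat \<Rightarrow> 'a :: comm_ring_1 mfps"
  is "\<lambda>i m. if m = Poly_Mapping.single i 1 then 1 else 0" .

lift_definition mfps_deriv :: "nat \<Rightarrow> 'a :: comm_ring_1 mfps \<Rightarrow> 'a mfps"
  is "\<lambda>i f m. of_nat (Poly_Mapping.lookup m i + 1) * f (m + Poly_Mapping.single i 1)" .

text \<open>The quotient of \<open>f\<close> by \<open>g\<close>, meant for the case that \<open>g\<close> divides \<open>f\<close> and is not a zero
  divisor. Lemma \<open>mfps_quotient_eqI\<close> below is the case of a divisor \<open>x\<^sub>i - x\<^sub>j\<close>.\<close>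

definition mfps_quotient :: "'a :: comm_ring_1 mfps \<Rightarrow> 'a mfps \<Rightarrow> 'a mfps" where
  "mfps_quotient f g = (THE h. h * g = f)"

lemma mfps_coeff_mult_var:
  "mfps_coeff (f * mfps_var i) m =
     (if Poly_Mapping.lookup m i = 0 then 0 else mfps_coeff f (m - Poly_Mapping.single i 1))"
proof -
  let ?e = "Poly_Mapping.single i (1::nat) :: nat \<Rightarrow>\<^sub>0 nat"
  let ?t = "\<lambda>(a, b :: nat \<Rightarrow>\<^sub>0 nat). mfps_coeff f a * (if b = ?e then 1 else 0)"
  have "sum ?t (splits m) = (if Poly_Mapping.lookup m i = 0 then 0 else mfps_coeff f (m - ?e))"
  proof (cases "Poly_Mapping.lookup m i = 0")
    case True
    then have "\<forall>(a, b)\<in>splits m. b \<noteq> ?e"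
      by (auto simp: splits_def lookup_add)
    then have "sum ?t (splits m) = 0"
      by (intro sum.neutral) auto
    then show ?thesis using True by simp
  next
    case False
    have *: "m - ?e + ?e = m"
      using False by (intro poly_mapping_eqI)
        (auto simp: lookup_add lookup_minus lookup_single when_def)
    have "sum ?t (splits m) = sum ?t {(m - ?e, ?e)}"
      by (rule sum.mono_neutral_right [OF finite_splits])
         (use * in \<open>auto simp: splits_def split: if_splits\<close>)
    then show ?thesis using False by simp
  qed
  then show ?thesis
    by (simp add: times_mfps.rep_eq mfps_var.rep_eq)
qed

lemma mfps_var_diff_regular:
  assumes "i \<noteq> j" and "h * (mfps_var i - mfps_var j) = 0"
  shows "h = 0"
proof (rule mfps_eqI)
  fix m
  have eq: "mfps_coeff (h * mfps_var i) n = mfps_coeff (h * mfps_var j) n" for n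
    using assms(2) by (simp add: right_diff_distrib)
  have "mfps_coeff h m = 0"
  proof (induction "Poly_Mapping.lookup m j" arbitrary: m)
    case 0
    with eq[of "m + Poly_Mapping.single i 1"] assms(1) show ?case
      by (simp add: mfps_coeff_mult_var lookup_add lookup_single when_def)
  next
    case (Suc k)
    let ?m = "m + Poly_Mapping.single i 1 - Poly_Mapping.single j 1"
    have "k = Poly_Mapping.lookup ?m j"
      using Suc.hyps(2) assms(1) by (simp add: lookup_add lookup_minus lookup_single when_def)
    then have "mfps_coeff h ?m = 0" by (rule Suc.hyps(1))
    with eq[of "m + Poly_Mapping.single i 1"] Suc.hyps(2) show ?case
      by (simp add: mfps_coeff_mult_var lookup_add lookup_single when_def split: if_splits)
  qed
  then show "mfps_coeff h m = mfps_coeff 0 m"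
    by (simp add: zero_mfps.rep_eq)
qed

lemma mfps_quotient_eqI:
  assumes "i \<noteq> j" and "h * (mfps_var i - mfps_var j) = f"
  shows "mfps_quotient f (mfps_var i - mfps_var j) = h"
  unfolding mfps_quotient_def
proof (rule the_equality)
  fix h' assume "h' * (mfps_var i - mfps_var j) = f"
  with assms(2) have "(h' - h) * (mfps_var i - mfps_var j) = 0"
    by (simp add: left_diff_distrib)
  with assms(1) mfps_var_diff_regular show "h' = h" by fastforce
qed fact


section \<open>Monotone Hurwitz numbers\<close>

text \<open>Fixed points of \<open>\<sigma>\<close> in \<open>A\<close> contribute cycles of length 1.\<close>

definition cycle_lengths :: "nat set \<Rightarrow> (nat \<Rightarrow> nat) \<Rightarrow> nat multiset" where
  "cycle_lengths A \<sigma> = image_mset card (mset_set ((\<lambda>x. orbit \<sigma> x) ` A))"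

definition perms_of_type :: "nat list \<Rightarrow> (nat \<Rightarrow> nat) set" where
  "perms_of_type \<alpha> =
     {\<sigma>. \<sigma> permutes {1..sum_list \<alpha>} \<and> cycle_lengths {1..sum_list \<alpha>} \<sigma> = mset \<alpha>}"

text \<open>A composition \<open>\<alpha>\<close> of \<open>d\<close> is the list of its parts, so \<open>d = sum_list \<alpha>\<close>; the tuple
  \<open>(\<sigma>, \<tau>\<^sub>1, \<dots>, \<tau>\<^sub>r)\<close> is the pair of \<open>\<sigma>\<close> and the list of the \<open>\<tau>\<^sub>i\<close>. The truncated subtraction in
  \<open>r = 2g - 2 + \<ell> + d\<close> is exact, as \<open>\<ell> \<ge> 1\<close> and \<open>d \<ge> 1\<close>. The list \<open>st\<close> consists of the pairs
  \<open>(s\<^sub>i, t\<^sub>i)\<close>; it is determined by \<open>\<tau>s\<close>. Products of permutations are composed right to left;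
  the other convention gives the same count, by \<open>\<sigma> \<mapsto> \<sigma>\<inverse>\<close>.\<close>

definition monotone_factorizations ::
    "nat \<Rightarrow> nat list \<Rightarrow> ((nat \<Rightarrow> nat) \<times> (nat \<Rightarrow> nat) list) set" where
  "monotone_factorizations g \<alpha> =
     (let d = sum_list \<alpha> in
      {(\<sigma>, \<tau>s). \<sigma> \<in> perms_of_type \<alpha>
        \<and> length \<tau>s = 2 * g + length \<alpha> + d - 2
        \<and> (\<exists>st. (\<forall>(s, t)\<in>set st. 1 \<le> s \<and> s < t \<and> t \<le> d)
              \<and> \<tau>s = map (\<lambda>(s, t). transpose s t) st
              \<and> sorted (map snd st))
        \<and> foldr (\<circ>) (\<sigma> # \<tau>s) id = id
        \<and> (\<forall>x\<in>{1..d}. \<forall>y\<in>{1..d}.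
              \<exists>\<pi>\<in>generate (sym_group d) (insert \<sigma> (set \<tau>s)). \<pi> x = y)})"

definition monotone_hurwitz :: "nat \<Rightarrow> nat list \<Rightarrow> nat" where
  "monotone_hurwitz g \<alpha> = card (monotone_factorizations g \<alpha>)"

lemma finite_monotone_factorizations: "finite (monotone_factorizations g \<alpha>)"
proof (rule finite_subset)
  let ?P = "{\<sigma>. \<sigma> permutes {1..sum_list \<alpha>}}"
  let ?L = "{\<tau>s. set \<tau>s \<subseteq> ?P \<and> length \<tau>s = 2 * g + length \<alpha> + sum_list \<alpha> - 2}"
  show "monotone_factorizations g \<alpha> \<subseteq> ?P \<times> ?L"
  proof (rule subrelI)
    fix \<sigma> \<tau>s assume *: "(\<sigma>, \<tau>s) \<in> monotone_factorizations g \<alpha>"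
    then obtain st where st: "\<forall>(s, t)\<in>set st. 1 \<le> s \<and> s < t \<and> t \<le> sum_list \<alpha>"
        "\<tau>s = map (\<lambda>(s, t). transpose s t) st"
      unfolding monotone_factorizations_def by (auto simp: Let_def)
    have "set \<tau>s \<subseteq> ?P"
    proof
      fix \<tau> assume "\<tau> \<in> set \<tau>s"
      then obtain s t where "(s, t) \<in> set st" "\<tau> = transpose s t"
        using st(2) by auto
      moreover from this st(1) have "s \<in> {1..sum_list \<alpha>}" "t \<in> {1..sum_list \<alpha>}"
        by fastforce+
      ultimately show "\<tau> \<in> ?P" by (simp add: permutes_swap_id)
    qed
    then show "(\<sigma>, \<tau>s) \<in> ?P \<times> ?L"
      using * unfolding monotone_factorizations_def perms_of_type_def by (auto simp: Let_def)
  qed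
  show "finite (?P \<times> ?L)"
    by (intro finite_cartesian_product finite_lists_length_eq finite_permutations) auto
qed

definition exponents :: "nat list \<Rightarrow> nat list \<Rightarrow> (nat \<Rightarrow>\<^sub>0 nat)" where
  "exponents vs \<alpha> = (\<Sum>i<length vs. Poly_Mapping.single (vs ! i) (\<alpha> ! i - 1))"

definition contributing :: "nat list \<Rightarrow> (nat \<Rightarrow>\<^sub>0 nat) \<Rightarrow> nat list set" where
  "contributing vs m =
     {\<alpha>. length \<alpha> = length vs \<and> (\<forall>a\<in>set \<alpha>. a \<ge> 1) \<and> exponents vs \<alpha> = m}"

lemma finite_contributing: "finite (contributing vs m)"
proof (rule finite_subset)
  let ?B = "{..Suc (\<Sum>v\<in>set vs. Poly_Mapping.lookup m v)}"
  show "contributing vs m \<subseteq> {\<alpha>. set \<alpha> \<subseteq> ?B \<and> length \<alpha> = length vs}"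
  proof clarify
    fix \<alpha> assume "\<alpha> \<in> contributing vs m"
    then have len: "length \<alpha> = length vs" and m: "exponents vs \<alpha> = m"
      by (auto simp: contributing_def)
    have "\<alpha> ! k \<in> ?B" if k: "k < length vs" for k
    proof -
      have "\<alpha> ! k - 1 \<le> Poly_Mapping.lookup m (vs ! k)"
      proof -
        have "Poly_Mapping.lookup (Poly_Mapping.single (vs ! k) (\<alpha> ! k - 1)) (vs ! k)
            \<le> (\<Sum>i<length vs. Poly_Mapping.lookup (Poly_Mapping.single (vs ! i) (\<alpha> ! i - 1)) (vs ! k))"
          by (rule member_le_sum[where f = "\<lambda>i. Poly_Mapping.lookup
                (Poly_Mapping.single (vs ! i) (\<alpha> ! i - 1)) (vs ! k)"]) (use k in auto)
        then show ?thesis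
          unfolding m[symmetric] exponents_def by (simp add: lookup_sum)
      qed
      also have "\<dots> \<le> (\<Sum>v\<in>set vs. Poly_Mapping.lookup m v)"
        by (rule member_le_sum) (use k in auto)
      finally show ?thesis by simp
    qed
    then show "set \<alpha> \<subseteq> ?B \<and> length \<alpha> = length vs"
      using len by (metis in_set_conv_nth subsetI)
  qed
  show "finite {\<alpha>. set \<alpha> \<subseteq> ?B \<and> length \<alpha> = length vs}"
    by (rule finite_lists_length_eq) simp
qed

text \<open>For a list \<open>vs\<close> of variable indices \<open>v\<^sub>1, \<dots>, v\<^sub>\<ell>\<close>, the series \<open>monotone_series g vs\<close>
  is the generating function of genus \<open>g\<close> and \<open>\<ell>\<close> parts with \<open>x\<close> of index \<open>v\<^sub>k\<close> substituted for
  its \<open>k\<close>-th argument. Indices may be repeated; then several \<open>\<alpha>\<close> contribute to the same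
  monomial, but only finitely many (\<open>finite_contributing\<close>).\<close>

definition monotone_series :: "int \<Rightarrow> nat list \<Rightarrow> rat mfps" where
  "monotone_series g vs =
     (if g < 0 then 0
      else Abs_mfps (\<lambda>m. \<Sum>\<alpha>\<in>contributing vs m.
             of_nat (monotone_hurwitz (nat g) \<alpha>) / of_nat (card (perms_of_type \<alpha>))))"

end

theory Submission
  imports Defs
begin

text \<open>Fix a permutation \<open>\<sigma>\<close> of a finite set \<open>A\<close> and count the connected monotone words whose product is
  the inverse of \<open>\<sigma>\<close>. Monotone words are the monomials of the complete symmetric polynomials in the Jucys-Murphy
  elements; as these polynomials are symmetric, the linear order on \<open>A\<close> is
  irrelevant, and any element \<open>d\<close> may play the role of the maximum. Connectedness forces the last
  transposition to be \<open>(s d)\<close> for some \<open>s\<close>; multiplying it into \<open>\<sigma>\<close> either joins the cycle of \<open>d\<close> with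
  another cycle, or cuts it into two. In the second case the remaining word is either still connected or a unique
  shuffle of two connected words, on the components of \<open>d\<close> and of \<open>s\<close>. This recursion shows that the count
  depends only on the cycle type, and it is the claimed identity read off coefficient by coefficient.\<close>

section \<open>Independence of the order\<close>

text \<open>The symmetry in the Jucys-Murphy elements is usually stated in the group algebra, where
  connectedness is invisible. The elements therefore act on states that also carry the surviving
  closed sets; the two relations behind the symmetry, commuting of disjoint transpositions and
  \<open>(a d)(a n) = (d n)(a d)\<close>, persist for such states. Order independence matters
  because two permutations of equal type have to be expanded along cycles of equal length, wherever
  the largest label lies. The induction runs over the number \<open>r\<close> of letters, not over
  the genus: expanding length \<open>Suc r\<close> consumes class invariance for all lengths up to
  \<open>r\<close>, on arbitrary finite label sets, since components live on subsets. The genus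
  enters only afterwards. In the identity x_1 marks the cycle of \<open>d\<close>. Joins give the
  differentiated quotients, where the derivative supplies the number of choices of \<open>s\<close>
  in the other cycle; cuts that stay connected give the term of genus g - 1; cuts that disconnect
  give the products.\<close>

text \<open>A state is a permutation together with the family of vertex sets that no edge chosen so far leaves; this
  family determines the connected components.\<close>

definition swap_step :: "nat \<Rightarrow> nat \<Rightarrow> (nat \<Rightarrow> nat) \<times> nat set set \<Rightarrow> (nat \<Rightarrow> nat) \<times> nat set set" where
  "swap_step s t x = (transpose s t \<circ> fst x, {B \<in> snd x. s \<in> B \<longleftrightarrow> t \<in> B})"

lemma swap_step_sym: "swap_step s t x = swap_step t s x"
  by (auto simp: swap_step_def transpose_commute)

lemma swap_step_disjoint:
  assumes "a \<noteq> b" "a \<noteq> n" "d \<noteq> b" "d \<noteq> n"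
  shows "swap_step a d (swap_step b n x) = swap_step b n (swap_step a d x)"
  using assms by (auto simp: swap_step_def fun_eq_iff transpose_def)

lemma swap_step_triangle:
  assumes "a \<noteq> n" "a \<noteq> d" "d \<noteq> n"
  shows "swap_step a d (swap_step a n x) = swap_step d n (swap_step a d x)"
  using assms by (auto simp: swap_step_def fun_eq_iff transpose_def)

text \<open>This is the recursion h_r(x_1, ..., x_n) = h_r(x_1, ..., x_{n-1}) + x_n h_{r-1}(x_1,
  ..., x_n) of complete symmetric polynomials, with Jucys-Murphy elements for the variables. The
  list head plays the maximum, and the last letter of a word acts first.\<close>

fun word_sum :: "((nat \<Rightarrow> nat) \<times> nat set set \<Rightarrow> nat) \<Rightarrow> nat list \<Rightarrow> nat \<Rightarrow> (nat \<Rightarrow> nat) \<times> nat set set \<Rightarrow> nat" where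
  "word_sum u xs 0 x = u x"
| "word_sum u [] (Suc r) x = 0"
| "word_sum u (d # ds) (Suc r) x =
     word_sum u ds (Suc r) x + (\<Sum>s\<in>set ds. word_sum u (d # ds) r (swap_step s d x))"

lemma swap_step_pair_sum:
  assumes "finite D" "d \<notin> D" "n \<notin> D" "d \<noteq> n"
  shows "(\<Sum>a\<in>D. \<Sum>b\<in>insert n D. f (swap_step b d (swap_step a n x)) :: nat) =
         (\<Sum>a\<in>D. \<Sum>b\<in>insert d D. f (swap_step b n (swap_step a d x)))"
proof -
  have split: "(\<Sum>b\<in>insert p D. h b) = h p + (h a + (\<Sum>b\<in>D - {a}. h b))"
    if "a \<in> D" "p \<notin> D" for a p and h :: "nat \<Rightarrow> nat"
    using that assms(1) by (simp add: sum.remove)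
  have swap: "(\<Sum>a\<in>D. \<Sum>b\<in>D - {a}. f (swap_step b d (swap_step a n x))) =
      (\<Sum>a\<in>D. \<Sum>b\<in>D - {a}. f (swap_step b n (swap_step a d x)))"
  proof -
    have "(\<Sum>a\<in>D. \<Sum>b\<in>D - {a}. f (swap_step b d (swap_step a n x))) =
        (\<Sum>a\<in>D. \<Sum>b\<in>{b \<in> D. a \<noteq> b}. f (swap_step b d (swap_step a n x)))"
      by (intro sum.cong) auto
    also have "\<dots> = (\<Sum>b\<in>D. \<Sum>a\<in>{a \<in> D. a \<noteq> b}. f (swap_step b d (swap_step a n x)))"
      by (rule sum.swap_restrict) (use assms in auto)
    also have "\<dots> = (\<Sum>b\<in>D. \<Sum>a\<in>D - {b}. f (swap_step a n (swap_step b d x)))"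
      using assms by (intro sum.cong refl arg_cong[of _ _ f]) (auto intro!: swap_step_disjoint)
    finally show ?thesis .
  qed
  \<comment> \<open>The exceptional terms match crosswise: b = n on the left is b = a on the right
    (\<open>t1\<close>), and b = a on the left is b = d on the right (\<open>t2\<close>).\<close>
  have t1: "swap_step n d (swap_step a n x) = swap_step a n (swap_step a d x)" if "a \<in> D" for a
    using that assms swap_step_triangle[of a n d] swap_step_triangle[of n a d] swap_step_triangle[of a d n x]
      swap_step_sym[of n d "swap_step a n x"] by metis
  have t2: "swap_step a d (swap_step a n x) = swap_step d n (swap_step a d x)" if "a \<in> D" for a
    using that assms by (intro swap_step_triangle) auto
  have "(\<Sum>a\<in>D. \<Sum>b\<in>insert n D. f (swap_step b d (swap_step a n x))) =
      (\<Sum>a\<in>D. f (swap_step a n (swap_step a d x)) + (f (swap_step d n (swap_step a d x))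
        + (\<Sum>b\<in>D - {a}. f (swap_step b d (swap_step a n x)))))"
    by (intro sum.cong refl, subst split) (use assms t1 t2 in auto)
  moreover have "(\<Sum>a\<in>D. \<Sum>b\<in>insert d D. f (swap_step b n (swap_step a d x))) =
      (\<Sum>a\<in>D. f (swap_step d n (swap_step a d x)) + (f (swap_step a n (swap_step a d x))
        + (\<Sum>b\<in>D - {a}. f (swap_step b n (swap_step a d x)))))"
    by (intro sum.cong refl split) (use assms in auto)
  ultimately show ?thesis
    by (simp add: sum.distrib swap)
qed

text \<open>The operators \<open>Y f x = (\<Sum>s. f (swap_step s d x))\<close> and \<open>X f x = (\<Sum>s. f (swap_step s n x))\<close> play
  the role of two consecutive Jucys-Murphy elements; the sum \<open>X + Y\<close> and the product \<open>X Y\<close>, which are all that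
  enters here, are symmetric in \<open>d\<close> and \<open>n\<close>.\<close>

lemma word_sum_two_step:
  assumes "distinct (d # n # ds)"
  shows "word_sum u (d # n # ds) (Suc (Suc r)) x
      + (\<Sum>a\<in>set ds. \<Sum>b\<in>insert n (set ds). word_sum u (d # n # ds) r (swap_step b d (swap_step a n x)))
    = word_sum u ds (Suc (Suc r)) x
      + (\<Sum>s\<in>set ds. word_sum u (d # n # ds) (Suc r) (swap_step s n x))
      + (\<Sum>s\<in>insert n (set ds). word_sum u (d # n # ds) (Suc r) (swap_step s d x))"
  by (simp add: sum.distrib)

text \<open>For the generating series H of all lengths, \<open>word_sum_two_step\<close> is the
  subtraction-free form of (1 - X z)(1 - Y z) H = H', where H' belongs to \<open>ds\<close>. It
  expresses length r + 2 through lengths r and r + 1, so the induction needs both r = 0 and r = 1 as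
  base cases.\<close>

lemma word_sum_swap:
  assumes "distinct (d # n # ds)"
  shows "word_sum u (d # n # ds) r x = word_sum u (n # d # ds) r x"
proof (induction r arbitrary: x rule: less_induct)
  case (less r)
  consider "r = 0" | "r = 1" | r' where "r = Suc (Suc r')"
    by (metis One_nat_def not0_implies_Suc)
  then show ?case
  proof cases
    case 2
    then show ?thesis using assms by (simp add: swap_step_sym[of n d])
  next
    case (3 r')
    have d': "distinct (n # d # ds)" using assms by auto
    \<comment> \<open>Symmetry of X + Y: the transposition of d and n occurs once on either side, in
      the sum of whichever of the two plays the maximum.\<close>
    have sd: "(\<Sum>s\<in>insert n (set ds). h (swap_step s d x)) + (\<Sum>s\<in>set ds. h (swap_step s n x)) =
      (\<Sum>s\<in>insert d (set ds). h (swap_step s n x)) + (\<Sum>s\<in>set ds. h (swap_step s d x))" for h :: "_ \<Rightarrow> nat"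
      using assms by (simp add: swap_step_sym[of n d])
    have "(\<Sum>a\<in>set ds. \<Sum>b\<in>insert n (set ds). word_sum u (n # d # ds) r' (swap_step b d (swap_step a n x)))
      = (\<Sum>a\<in>set ds. \<Sum>b\<in>insert d (set ds). word_sum u (n # d # ds) r' (swap_step b n (swap_step a d x)))"
      using assms by (intro swap_step_pair_sum) auto
    moreover have "\<And>y. word_sum u (d # n # ds) r' y = word_sum u (n # d # ds) r' y"
      "\<And>y. word_sum u (d # n # ds) (Suc r') y = word_sum u (n # d # ds) (Suc r') y"
      using less 3 by (simp_all del: word_sum.simps)
    ultimately show ?thesis
      using word_sum_two_step[OF assms, of u r' x] word_sum_two_step[OF d', of u r' x]
        sd[of "word_sum u (n # d # ds) (Suc r')"] unfolding 3 by (simp only:)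
  qed auto
qed

lemma word_sum_Cons_cong:
  assumes "\<And>r x. word_sum u ds r x = word_sum u es r x" "set ds = set es"
  shows "word_sum u (d # ds) r x = word_sum u (d # es) r x"
  using assms by (induction r arbitrary: x) auto

lemma word_sum_to_front:
  assumes "distinct (ys @ d # zs)"
  shows "word_sum u (ys @ d # zs) r x = word_sum u (d # ys @ zs) r x"
  using assms
proof (induction ys arbitrary: r x)
  case (Cons y ys)
  have "word_sum u (y # (ys @ d # zs)) r x = word_sum u (y # d # ys @ zs) r x"
    using Cons by (intro word_sum_Cons_cong) auto
  also have "\<dots> = word_sum u (d # y # ys @ zs) r x"
    using Cons.prems by (intro word_sum_swap) auto
  finally show ?case by simp
qed simp

lemma word_sum_order_irrelevant:
  assumes "distinct xs" "distinct ys" "set xs = set ys"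
  shows "word_sum u xs r x = word_sum u ys r x"
  using assms
proof (induction xs arbitrary: ys r x)
  case (Cons d ds)
  then obtain as bs where ys: "ys = as @ d # bs"
    by (metis list.set_intros(1) split_list)
  have "word_sum u (d # ds) r x = word_sum u (d # as @ bs) r x"
  proof (rule word_sum_Cons_cong)
    have "set ds = set (as @ bs)" "distinct (as @ bs)" using Cons.prems ys by auto
    then show "set ds = set (as @ bs)" "\<And>r x. word_sum u ds r x = word_sum u (as @ bs) r x"
      using Cons by auto
  qed
  then show ?case using Cons.prems ys word_sum_to_front by simp
qed simp

section \<open>Monotone words\<close>

definition mono_words :: "nat set \<Rightarrow> nat \<Rightarrow> (nat \<times> nat) list set" where
  "mono_words A r = {st. length st = r \<and> (\<forall>(s, t)\<in>set st. s \<in> A \<and> t \<in> A \<and> s < t) \<and> sorted (map snd st)}"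

definition word_prod :: "(nat \<times> nat) list \<Rightarrow> nat \<Rightarrow> nat" where
  "word_prod st = foldr (\<circ>) (map (\<lambda>(s, t). transpose s t) st) id"

text \<open>For a word on \<open>A\<close>, the closed subsets of \<open>A\<close> are the unions of
  connected components of the graph with edge list \<open>st\<close>.\<close>

definition closed_under :: "nat set \<Rightarrow> (nat \<times> nat) list \<Rightarrow> bool" where
  "closed_under B st \<longleftrightarrow> (\<forall>(s, t)\<in>set st. s \<in> B \<longleftrightarrow> t \<in> B)"

text \<open>For \<open>F = UNIV\<close> the last condition says that the graph with edge list \<open>st\<close> is connected on \<open>A\<close>.\<close>

definition factorizations :: "nat set \<Rightarrow> nat set set \<Rightarrow> nat \<Rightarrow> (nat \<Rightarrow> nat) \<Rightarrow> (nat \<times> nat) list set" where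
  "factorizations A F r \<pi> = {st \<in> mono_words A r. word_prod st \<circ> \<pi> = id
     \<and> (\<forall>B\<in>F. B \<subseteq> A \<longrightarrow> closed_under B st \<longrightarrow> B = {} \<or> B = A)}"

lemma word_prod_simps [simp]:
  "word_prod [] = id"
  "word_prod (p # st) = transpose (fst p) (snd p) \<circ> word_prod st"
  by (simp_all add: word_prod_def case_prod_unfold)

lemma closed_under_simps [simp]:
  "closed_under B []"
  "closed_under B (p # st) \<longleftrightarrow> (fst p \<in> B \<longleftrightarrow> snd p \<in> B) \<and> closed_under B st"
  by (auto simp: closed_under_def)

lemma foldr_swap_step:
  "foldr (\<lambda>(s, t). swap_step s t) st x = (word_prod st \<circ> fst x, {B \<in> snd x. closed_under B st})"
  by (induction st) (auto simp: swap_step_def fun_eq_iff)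

lemma mono_words_0 [simp]: "mono_words A 0 = {[]}"
  by (auto simp: mono_words_def)

lemma mono_words_empty_Suc [simp]: "mono_words {} (Suc r) = {}"
proof (rule equals0I)
  fix st :: "(nat \<times> nat) list"
  assume st: "st \<in> mono_words {} (Suc r)"
  then have "hd st \<in> set st" by (auto simp: mono_words_def intro: hd_in_set)
  with st show False by (cases "hd st") (auto simp: mono_words_def)
qed

lemma finite_mono_words [simp]:
  assumes "finite A"
  shows "finite (mono_words A r)"
proof (rule finite_subset)
  show "mono_words A r \<subseteq> {st. set st \<subseteq> A \<times> A \<and> length st = r}"
    by (auto simp: mono_words_def)
  show "finite {st. set st \<subseteq> A \<times> A \<and> length st = r}"
    using assms by (intro finite_lists_length_eq) auto
qed

lemma finite_factorizations [simp]: "finite A \<Longrightarrow> finite (factorizations A F r \<pi>)"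
  by (simp add: factorizations_def)

text \<open>Sortedness moves every letter that involves the maximum \<open>d\<close> to the end of
  the word.\<close>

lemma mono_words_Suc:
  assumes d: "d \<in> A" "\<And>a. a \<in> A \<Longrightarrow> a \<le> d"
  shows "mono_words A (Suc r) = mono_words (A - {d}) (Suc r)
     \<union> (\<lambda>(s, st). st @ [(s, d)]) ` ((A - {d}) \<times> mono_words A r)"
proof (intro equalityI subsetI)
  fix w assume w: "w \<in> mono_words A (Suc r)"
  then obtain st s t where wst: "w = st @ [(s, t)]" "length st = r"
    by (cases w rule: rev_cases) (auto simp: mono_words_def)
  show "w \<in> mono_words (A - {d}) (Suc r)
     \<union> (\<lambda>(s, st). st @ [(s, d)]) ` ((A - {d}) \<times> mono_words A r)"
  proof (cases "t = d")
    case True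
    then show ?thesis using w wst by (auto simp: mono_words_def sorted_append image_iff)
  next
    case False
    have "t' \<le> t \<and> t < d" if "(s', t') \<in> set w" for s' t'
      using that False w wst d(2)[of t] by (fastforce simp: mono_words_def sorted_append)
    then have "w \<in> mono_words (A - {d}) (Suc r)"
      using w by (fastforce simp: mono_words_def)
    then show ?thesis ..
  qed
next
  fix w assume "w \<in> mono_words (A - {d}) (Suc r)
     \<union> (\<lambda>(s, st). st @ [(s, d)]) ` ((A - {d}) \<times> mono_words A r)"
  then show "w \<in> mono_words A (Suc r)"
  proof
    assume "w \<in> (\<lambda>(s, st). st @ [(s, d)]) ` ((A - {d}) \<times> mono_words A r)"
    then obtain s st where "w = st @ [(s, d)]" "s \<in> A" "s \<noteq> d" "st \<in> mono_words A r" by auto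
    then show ?thesis using d d(2)[of s]
      by (fastforce simp: mono_words_def sorted_append)
  qed (auto simp: mono_words_def)
qed

lemma word_sum_eq_sum_mono_words:
  assumes "sorted_wrt (>) xs"
  shows "word_sum u xs r x = (\<Sum>st\<in>mono_words (set xs) r. u (foldr (\<lambda>(s, t). swap_step s t) st x))"
  using assms
proof (induction xs arbitrary: r x)
  case Nil
  then show ?case by (cases r) auto
next
  case (Cons d ds)
  let ?g = "foldr (\<lambda>(s, t). swap_step s t)"
  show ?case
  proof (induction r arbitrary: x)
    case (Suc r)
    let ?A = "set (d # ds)"
    have d: "d \<in> ?A" "\<And>a. a \<in> ?A \<Longrightarrow> a \<le> d" "d \<notin> set ds" "?A - {d} = set ds"
      using Cons.prems by auto
    have A: "mono_words ?A (Suc r) = mono_words (set ds) (Suc r)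
        \<union> (\<lambda>(s, st). st @ [(s, d)]) ` (set ds \<times> mono_words ?A r)"
      using mono_words_Suc[OF d(1,2), of r] unfolding d(4) by blast
    have disj: "mono_words (set ds) (Suc r) \<inter> (\<lambda>(s, st). st @ [(s, d)]) ` (set ds \<times> mono_words ?A r) = {}"
      using d(3) by (auto simp: mono_words_def)
    have "(\<Sum>st\<in>mono_words ?A (Suc r). u (?g st x)) = (\<Sum>st\<in>mono_words (set ds) (Suc r). u (?g st x))
        + (\<Sum>st\<in>(\<lambda>(s, st). st @ [(s, d)]) ` (set ds \<times> mono_words ?A r). u (?g st x))"
      unfolding A
      by (rule sum.union_disjoint) (use disj in auto)
    also have "(\<Sum>st\<in>(\<lambda>(s, st). st @ [(s, d)]) ` (set ds \<times> mono_words ?A r). u (?g st x))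
        = (\<Sum>(s, st)\<in>set ds \<times> mono_words ?A r. u (?g st (swap_step s d x)))"
      by (subst sum.reindex) (auto simp: inj_on_def case_prod_unfold)
    also have "\<dots> = (\<Sum>s\<in>set ds. \<Sum>st\<in>mono_words ?A r. u (?g st (swap_step s d x)))"
      by (simp add: sum.cartesian_product)
    also have "\<dots> = (\<Sum>s\<in>set ds. word_sum u (d # ds) r (swap_step s d x))"
      by (simp only: Suc)
    finally show ?case using Cons by simp
  qed simp
qed

text \<open>Order independence pays off here: \<open>mono_words\<close> refers to the order of the
  natural numbers, but \<open>xs\<close> may list the labels in any order.\<close>

lemma card_factorizations_eq_word_sum:
  assumes "distinct xs"
  shows "card (factorizations (set xs) F r \<pi>) =
    word_sum (\<lambda>x. of_bool (fst x = id \<and> (\<forall>B\<in>snd x. B \<subseteq> set xs \<longrightarrow> B = {} \<or> B = set xs))) xs r (\<pi>, F)"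
    (is "_ = word_sum ?u xs r _")
proof -
  define ys where "ys = rev (sorted_list_of_set (set xs))"
  have ys: "set ys = set xs" "distinct ys" "sorted_wrt (>) ys"
    using sorted_list_of_set.strict_sorted_key_list_of_set[of "set xs"]
    by (simp_all add: ys_def sorted_wrt_rev)
  have "word_sum ?u xs r (\<pi>, F) = word_sum ?u ys r (\<pi>, F)"
    using assms ys by (intro word_sum_order_irrelevant) auto
  also have "\<dots> = (\<Sum>st\<in>mono_words (set xs) r. of_bool (st \<in> factorizations (set xs) F r \<pi>))"
    unfolding word_sum_eq_sum_mono_words[OF ys(3)] foldr_swap_step ys(1)
    by (rule sum.cong) (auto simp: factorizations_def)
  also have "\<dots> = card (factorizations (set xs) F r \<pi>)"
    by (simp add: factorizations_def Int_def conj_commute)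
  finally show ?thesis by simp
qed

text \<open>A word that never moves \<open>d\<close> leaves \<open>{d}\<close> as a component of its
  own.\<close>

lemma word_sum_avoiding_eq_0:
  assumes "distinct (d # ds)" "ds \<noteq> []"
  shows "word_sum (\<lambda>x. of_bool (fst x = id \<and> (\<forall>B\<in>snd x. B \<subseteq> set (d # ds) \<longrightarrow> B = {} \<or> B = set (d # ds)))) ds r (\<pi>, UNIV) = 0"
    (is "word_sum ?u ds r _ = 0")
proof -
  define ys where "ys = rev (sorted_list_of_set (set ds))"
  have ys: "set ys = set ds" "distinct ys" "sorted_wrt (>) ys"
    using sorted_list_of_set.strict_sorted_key_list_of_set[of "set ds"]
    by (simp_all add: ys_def sorted_wrt_rev)
  have "word_sum ?u ds r (\<pi>, UNIV) = word_sum ?u ys r (\<pi>, UNIV)"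
    using assms ys by (intro word_sum_order_irrelevant) auto
  also have "\<dots> = (\<Sum>st\<in>mono_words (set ds) r. 0)"
    unfolding word_sum_eq_sum_mono_words[OF ys(3)] foldr_swap_step ys(1)
  proof (rule sum.cong)
    fix st assume "st \<in> mono_words (set ds) r"
    then have "closed_under {d} st"
      using assms by (auto simp: mono_words_def closed_under_def)
    moreover have "{d} \<noteq> set (d # ds)" using assms by (cases ds) auto
    ultimately show "?u (word_prod st \<circ> fst (\<pi>, UNIV), {B \<in> snd (\<pi>, UNIV). closed_under B st}) = 0"
      using assms by (auto intro!: exI[of _ "{d}"])
  qed simp
  finally show ?thesis by simp
qed

text \<open>\<open>d\<close> need not be the maximum of \<open>A\<close>: the labels are listed with
  \<open>d\<close> at the head. Removing the last letter leaves words that are connected once the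
  edge between \<open>s\<close> and \<open>d\<close> is added, which is what the restricted family
  of sets expresses.\<close>

lemma card_factorizations_Suc:
  assumes "finite A" "d \<in> A"
  shows "card (factorizations A UNIV (Suc r) \<pi>) =
    (\<Sum>s\<in>A - {d}. card (factorizations A {B. s \<in> B \<longleftrightarrow> d \<in> B} r (transpose s d \<circ> \<pi>)))"
proof -
  obtain ds where ds: "set ds = A - {d}" "distinct ds"
    using assms finite_distinct_list by (metis finite_Diff)
  have A: "A = set (d # ds)" and dist: "distinct (d # ds)"
    using ds assms by auto
  let ?u = "\<lambda>x. of_bool (fst x = id \<and> (\<forall>B\<in>snd x. B \<subseteq> set (d # ds) \<longrightarrow> B = {} \<or> B = set (d # ds))) :: nat"
  have "word_sum ?u ds (Suc r) (\<pi>, UNIV) = 0"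
  \<comment> \<open>With a single label \<open>{d}\<close> is all of \<open>A\<close> and separates
    nothing; the sum is then 0 because there are no transpositions.\<close>
  proof (cases "ds = []")
    case False
    then show ?thesis using word_sum_avoiding_eq_0[OF dist] by blast
  qed simp
  then have "card (factorizations (set (d # ds)) UNIV (Suc r) \<pi>) =
      (\<Sum>s\<in>set ds. word_sum ?u (d # ds) r (swap_step s d (\<pi>, UNIV)))"
    unfolding card_factorizations_eq_word_sum[OF dist] word_sum.simps by simp
  also have "\<dots> = (\<Sum>s\<in>set ds. card (factorizations (set (d # ds)) {B. s \<in> B \<longleftrightarrow> d \<in> B} r (transpose s d \<circ> \<pi>)))"
    unfolding card_factorizations_eq_word_sum[OF dist] by (simp add: swap_step_def)
  finally show ?thesis unfolding A using dist by simp
qed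

section \<open>Words with two components\<close>

lemma closed_under_Compl: "closed_under (- B) st \<longleftrightarrow> closed_under B st"
  by (auto simp: closed_under_def)

lemma word_prod_in_closed_iff:
  assumes "closed_under B st"
  shows "word_prod st x \<in> B \<longleftrightarrow> x \<in> B"
proof -
  have *: "transpose s t y \<in> B \<longleftrightarrow> y \<in> B" if "s \<in> B \<longleftrightarrow> t \<in> B" for s t y
    using that by (cases "y = s"; cases "y = t") auto
  show ?thesis
    using assms by (induction st) (simp_all add: *)
qed

text \<open>Letters of a closed word that start outside \<open>B\<close> have both entries outside
  \<open>B\<close>, and a point of \<open>B\<close> never leaves \<open>B\<close>.\<close>

lemma word_prod_filter_closed:
  assumes "closed_under B st" "x \<in> B"
  shows "word_prod (filter (\<lambda>p. fst p \<in> B) st) x = word_prod st x"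
  using assms
proof (induction st)
  case (Cons p st)
  have "word_prod st x \<in> B" using Cons.prems word_prod_in_closed_iff[of B st x] by simp
  then have "transpose (fst p) (snd p) (word_prod st x) = word_prod st x" if "fst p \<notin> B"
    using that Cons.prems by (intro transpose_apply_other) auto
  then show ?case using Cons by simp
qed simp

lemma word_prod_mono_words_outside:
  assumes "st \<in> mono_words A r" "x \<notin> A"
  shows "word_prod st x = x"
proof -
  have "\<forall>p\<in>set st. fst p \<noteq> x \<and> snd p \<noteq> x" using assms by (auto simp: mono_words_def)
  then show ?thesis by (induction st) simp_all
qed

definition split_word :: "nat set \<Rightarrow> (nat \<times> nat) list \<Rightarrow> (nat \<times> nat) list \<times> (nat \<times> nat) list" where
  "split_word B st = (filter (\<lambda>p. fst p \<in> B) st, filter (\<lambda>p. fst p \<notin> B) st)"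

text \<open>A monotone word is recovered from its restrictions to \<open>B\<close> and \<open>A - B\<close> by stable sorting, because pairs
  with the same second component lie on the same side.\<close>

lemma bij_betw_split_word:
  assumes "B \<subseteq> A"
  shows "bij_betw (split_word B) {st \<in> mono_words A r. closed_under B st}
    (\<Union>i\<le>r. mono_words B i \<times> mono_words (A - B) (r - i))"
proof (rule bij_betw_byWitness[where f' = "\<lambda>(u, v). sort_key snd (u @ v)"])
  show "\<forall>st\<in>{st \<in> mono_words A r. closed_under B st}. (case split_word B st of (u, v) \<Rightarrow> sort_key snd (u @ v)) = st"
  proof
    fix st assume st: "st \<in> {st \<in> mono_words A r. closed_under B st}"
    have "sort_key snd (filter (\<lambda>p. fst p \<in> B) st @ filter (\<lambda>p. fst p \<notin> B) st) = st"
    proof (rule properties_for_sort_key)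
      show "mset st = mset (filter (\<lambda>p. fst p \<in> B) st @ filter (\<lambda>p. fst p \<notin> B) st)"
        by (metis mset_append mset_filter multiset_partition)
      show "sorted (map snd st)" using st by (auto simp: mono_words_def)
      show "filter (\<lambda>x. snd k = snd x) st = filter (\<lambda>x. snd k = snd x) (filter (\<lambda>p. fst p \<in> B) st @ filter (\<lambda>p. fst p \<notin> B) st)" for k
      proof (cases "snd k \<in> B")
        case True
        then have "filter (\<lambda>x. snd k = snd x) (filter (\<lambda>p. fst p \<notin> B) st) = []"
          using st by (auto simp: closed_under_def filter_empty_conv)
        moreover have "filter (\<lambda>x. snd k = snd x) (filter (\<lambda>p. fst p \<in> B) st) = filter (\<lambda>x. snd k = snd x) st"
          using st True unfolding filter_filter by (intro filter_cong) (auto simp: closed_under_def)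
        ultimately show ?thesis by simp
      next
        case False
        then have "filter (\<lambda>x. snd k = snd x) (filter (\<lambda>p. fst p \<in> B) st) = []"
          using st by (auto simp: closed_under_def filter_empty_conv)
        moreover have "filter (\<lambda>x. snd k = snd x) (filter (\<lambda>p. fst p \<notin> B) st) = filter (\<lambda>x. snd k = snd x) st"
          using st False unfolding filter_filter by (intro filter_cong) (auto simp: closed_under_def)
        ultimately show ?thesis by simp
      qed
    qed
    then show "(case split_word B st of (u, v) \<Rightarrow> sort_key snd (u @ v)) = st"
      by (simp add: split_word_def)
  qed
  show "\<forall>uv\<in>\<Union>i\<le>r. mono_words B i \<times> mono_words (A - B) (r - i).
      split_word B (case uv of (u, v) \<Rightarrow> sort_key snd (u @ v)) = uv"
  proof
    fix uv assume "uv \<in> (\<Union>i\<le>r. mono_words B i \<times> mono_words (A - B) (r - i))"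
    then obtain u v i where uv: "uv = (u, v)" "u \<in> mono_words B i" "v \<in> mono_words (A - B) (r - i)" by auto
    have "filter (\<lambda>p. fst p \<in> B) u = u" "filter (\<lambda>p. fst p \<in> B) v = []"
      "filter (\<lambda>p. fst p \<notin> B) u = []" "filter (\<lambda>p. fst p \<notin> B) v = v"
      using uv by (auto simp: mono_words_def filter_id_conv filter_empty_conv)
    moreover have "sort_key snd u = u" "sort_key snd v = v"
      using uv by (auto simp: mono_words_def intro: sort_key_id_if_sorted)
    ultimately show "split_word B (case uv of (u, v) \<Rightarrow> sort_key snd (u @ v)) = uv"
      by (simp add: split_word_def filter_sort uv)
  qed
  show "split_word B ` {st \<in> mono_words A r. closed_under B st} \<subseteq> (\<Union>i\<le>r. mono_words B i \<times> mono_words (A - B) (r - i))"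
  proof
    fix uv assume "uv \<in> split_word B ` {st \<in> mono_words A r. closed_under B st}"
    then obtain st where st: "st \<in> mono_words A r" "closed_under B st" "uv = split_word B st" by auto
    have l: "length (filter (\<lambda>p. fst p \<notin> B) st) = r - length (filter (\<lambda>p. fst p \<in> B) st)"
      using st(1) sum_length_filter_compl[of "\<lambda>p. fst p \<in> B" st] by (auto simp: mono_words_def)
    have "filter (\<lambda>p. fst p \<in> B) st \<in> mono_words B (length (filter (\<lambda>p. fst p \<in> B) st))"
      "filter (\<lambda>p. fst p \<notin> B) st \<in> mono_words (A - B) (length (filter (\<lambda>p. fst p \<notin> B) st))"
      using st(1,2) by (auto simp: mono_words_def closed_under_def intro: sorted_filter)
    moreover have "length (filter (\<lambda>p. fst p \<in> B) st) \<le> r"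
      using st(1) by (auto simp: mono_words_def)
    ultimately show "uv \<in> (\<Union>i\<le>r. mono_words B i \<times> mono_words (A - B) (r - i))"
      unfolding l st(3) split_word_def by blast
  qed
  show "(\<lambda>(u, v). sort_key snd (u @ v)) ` (\<Union>i\<le>r. mono_words B i \<times> mono_words (A - B) (r - i))
      \<subseteq> {st \<in> mono_words A r. closed_under B st}"
  proof clarify
    fix i u v assume uv: "u \<in> mono_words B i" "v \<in> mono_words (A - B) (r - i)" and i: "i \<le> r"
    have "\<forall>p\<in>set (u @ v). fst p \<in> A \<and> snd p \<in> A \<and> fst p < snd p \<and> (fst p \<in> B \<longleftrightarrow> snd p \<in> B)"
      using assms uv by (auto simp: mono_words_def)
    moreover have "length (u @ v) = r" using uv i by (auto simp: mono_words_def)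
    ultimately show "sort_key snd (u @ v) \<in> mono_words A r \<and> closed_under B (sort_key snd (u @ v))"
      by (simp add: mono_words_def closed_under_def case_prod_unfold)
  qed
qed

lemma bij_betw_Collect:
  assumes "bij_betw f X Y" "\<And>x. x \<in> X \<Longrightarrow> P x \<longleftrightarrow> Q (f x)"
  shows "bij_betw f {x \<in> X. P x} {y \<in> Y. Q y}"
  using assms by (auto simp: bij_betw_def inj_on_def)

text \<open>Pointwise: on \<open>B\<close> the full product agrees with the first restricted one
  while the second is trivial, on \<open>A - B\<close> the roles are exchanged, and outside
  \<open>A\<close> all three are trivial.\<close>

lemma word_prod_split_iff:
  assumes \<pi>: "\<pi> permutes A" "\<pi> ` B = B" and "B \<subseteq> A"
    and st: "st \<in> mono_words A r" "closed_under B st"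
  shows "word_prod st \<circ> \<pi> = id \<longleftrightarrow>
    word_prod (fst (split_word B st)) \<circ> perm_restrict \<pi> B = id \<and>
    word_prod (snd (split_word B st)) \<circ> perm_restrict \<pi> (A - B) = id"
proof -
  obtain i where "split_word B st \<in> mono_words B i \<times> mono_words (A - B) (r - i)"
    using bij_betw_apply[OF bij_betw_split_word[OF \<open>B \<subseteq> A\<close>], of st r] st by auto
  then have uv: "fst (split_word B st) \<in> mono_words B i" "snd (split_word B st) \<in> mono_words (A - B) (r - i)"
    by auto
  have in_B: "\<pi> x \<in> B \<longleftrightarrow> x \<in> B" for x
    using \<pi> by (metis image_eqI image_iff permutes_inj inj_def)
  have in_A: "\<pi> x \<in> A \<longleftrightarrow> x \<in> A" for x
    using \<pi>(1) by (rule permutes_in_image)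
  have eq1: "(word_prod st \<circ> \<pi>) x = (word_prod (fst (split_word B st)) \<circ> perm_restrict \<pi> B) x"
    if "x \<in> B" for x
    using that word_prod_filter_closed[OF st(2), of "\<pi> x"] in_B by (auto simp: perm_restrict_def split_word_def)
  have id1: "(word_prod (snd (split_word B st)) \<circ> perm_restrict \<pi> (A - B)) x = x" if "x \<in> B" for x
    using that word_prod_mono_words_outside[OF uv(2)] by (auto simp: perm_restrict_def)
  have eq2: "(word_prod st \<circ> \<pi>) x = (word_prod (snd (split_word B st)) \<circ> perm_restrict \<pi> (A - B)) x"
    if "x \<in> A - B" for x
    using that word_prod_filter_closed[of "-B" st "\<pi> x"] in_B st(2)
    by (auto simp: perm_restrict_def split_word_def closed_under_Compl)
  have id2: "(word_prod (fst (split_word B st)) \<circ> perm_restrict \<pi> B) x = x" if "x \<notin> B" for x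
    using that in_B word_prod_mono_words_outside[OF uv(1)] by (auto simp: perm_restrict_def)
  have id3: "(word_prod st \<circ> \<pi>) x = x" "(word_prod (snd (split_word B st)) \<circ> perm_restrict \<pi> (A - B)) x = x"
    if "x \<notin> A" for x
    using that in_A word_prod_mono_words_outside[OF st(1)] word_prod_mono_words_outside[OF uv(2)] permutes_not_in[OF \<pi>(1)]
    by (auto simp: perm_restrict_def)
  have "(word_prod st \<circ> \<pi>) x = x \<longleftrightarrow> (word_prod (fst (split_word B st)) \<circ> perm_restrict \<pi> B) x = x
      \<and> (word_prod (snd (split_word B st)) \<circ> perm_restrict \<pi> (A - B)) x = x" for x
  proof -
    consider "x \<in> B" | "x \<in> A - B" | "x \<notin> A" by blast
    then show ?thesis
    proof cases
      case 1
      show ?thesis unfolding eq1[OF 1] id1[OF 1] by simp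
    next
      case 2
      then have "x \<notin> B" by simp
      show ?thesis unfolding eq2[OF 2] id2[OF \<open>x \<notin> B\<close>] by simp
    next
      case 3
      then have "x \<notin> B" using \<open>B \<subseteq> A\<close> by blast
      show ?thesis unfolding id3[OF 3] id2[OF \<open>x \<notin> B\<close>] by simp
    qed
  qed
  then show ?thesis unfolding fun_eq_iff id_apply by blast
qed

lemma closed_under_filter_iff:
  assumes "closed_under B st" "C \<subseteq> B"
  shows "closed_under C (filter (\<lambda>p. fst p \<in> B) st) \<longleftrightarrow> closed_under C st"
  using assms by (fastforce simp: closed_under_def)

text \<open>For varying \<open>B\<close> with \<open>d \<in> B\<close> and \<open>s \<notin> B\<close>, these are the words that are disconnected on \<open>A\<close> but
  become connected by adding the edge between \<open>s\<close> and \<open>d\<close>.\<close>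

definition two_component_words :: "nat set \<Rightarrow> nat set \<Rightarrow> nat \<Rightarrow> (nat \<Rightarrow> nat) \<Rightarrow> (nat \<times> nat) list set" where
  "two_component_words A B r \<pi> = {st \<in> mono_words A r. closed_under B st \<and> word_prod st \<circ> \<pi> = id
     \<and> (\<forall>C\<subseteq>B. closed_under C st \<longrightarrow> C = {} \<or> C = B)
     \<and> (\<forall>C\<subseteq>A - B. closed_under C st \<longrightarrow> C = {} \<or> C = A - B)}"

text \<open>Interleaving is unique by \<open>bij_betw_split_word\<close>, so the count is a plain
  convolution over the length \<open>i\<close> of the part on \<open>B\<close>, without binomial
  coefficients. Different \<open>i\<close> give disjoint products, as the word lengths
  differ.\<close>

lemma card_two_component_words:
  assumes "finite A" and \<pi>: "\<pi> permutes A" "\<pi> ` B = B" and "B \<subseteq> A"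
  shows "card (two_component_words A B r \<pi>) =
    (\<Sum>i\<le>r. card (factorizations B UNIV i (perm_restrict \<pi> B)) *
      card (factorizations (A - B) UNIV (r - i) (perm_restrict \<pi> (A - B))))"
proof -
  define conn where "conn A st \<longleftrightarrow> (\<forall>C\<subseteq>A. closed_under C st \<longrightarrow> C = {} \<or> C = A)" for A st
  define Q where "Q = (\<lambda>(u, v). word_prod u \<circ> perm_restrict \<pi> B = id \<and> word_prod v \<circ> perm_restrict \<pi> (A - B) = id
      \<and> conn B u \<and> conn (A - B) v)"
  have iff: "(word_prod st \<circ> \<pi> = id \<and> conn B st \<and> conn (A - B) st) \<longleftrightarrow> Q (split_word B st)"
    if st: "st \<in> {st \<in> mono_words A r. closed_under B st}" for st
  proof -
    have cl: "closed_under B st" "closed_under (-B) st" using st by (auto simp: closed_under_Compl)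
    have "conn B (fst (split_word B st)) \<longleftrightarrow> conn B st"
      using closed_under_filter_iff[OF cl(1)] by (auto simp: conn_def split_word_def)
    moreover have "conn (A - B) (snd (split_word B st)) \<longleftrightarrow> conn (A - B) st"
    proof -
      have "closed_under C (snd (split_word B st)) \<longleftrightarrow> closed_under C st" if "C \<subseteq> A - B" for C
        using that closed_under_filter_iff[OF cl(2), of C] by (auto simp: split_word_def)
      then show ?thesis by (auto simp: conn_def)
    qed
    ultimately show ?thesis
      using word_prod_split_iff[OF \<pi> \<open>B \<subseteq> A\<close>, of st r] st by (auto simp: Q_def case_prod_unfold)
  qed
  have eq: "two_component_words A B r \<pi> =
      {st \<in> {st \<in> mono_words A r. closed_under B st}. word_prod st \<circ> \<pi> = id \<and> conn B st \<and> conn (A - B) st}"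
    by (auto simp: two_component_words_def conn_def)
  have "bij_betw (split_word B) (two_component_words A B r \<pi>)
      {uv \<in> (\<Union>i\<le>r. mono_words B i \<times> mono_words (A - B) (r - i)). Q uv}"
    unfolding eq using bij_betw_split_word[OF \<open>B \<subseteq> A\<close>] by (rule bij_betw_Collect) (rule iff)
  also have "{uv \<in> (\<Union>i\<le>r. mono_words B i \<times> mono_words (A - B) (r - i)). Q uv} =
      (\<Union>i\<le>r. factorizations B UNIV i (perm_restrict \<pi> B) \<times> factorizations (A - B) UNIV (r - i) (perm_restrict \<pi> (A - B)))"
    by (auto simp: factorizations_def Q_def conn_def)
  finally have "card (two_component_words A B r \<pi>) = card \<dots>"
    by (rule bij_betw_same_card)
  also have "\<dots> = (\<Sum>i\<le>r. card (factorizations B UNIV i (perm_restrict \<pi> B) \<times>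
      factorizations (A - B) UNIV (r - i) (perm_restrict \<pi> (A - B))))"
  proof (rule card_UN_disjoint)
    show "\<forall>i\<in>{..r}. \<forall>j\<in>{..r}. i \<noteq> j \<longrightarrow>
        factorizations B UNIV i (perm_restrict \<pi> B) \<times> factorizations (A - B) UNIV (r - i) (perm_restrict \<pi> (A - B)) \<inter>
        factorizations B UNIV j (perm_restrict \<pi> B) \<times> factorizations (A - B) UNIV (r - j) (perm_restrict \<pi> (A - B)) = {}"
      by (auto simp: factorizations_def mono_words_def)
  qed (use assms finite_subset[OF \<open>B \<subseteq> A\<close>] in auto)
  finally show ?thesis by (simp add: card_cartesian_product)
qed

lemma closed_under_Int: "closed_under B st \<Longrightarrow> closed_under C st \<Longrightarrow> closed_under (B \<inter> C) st"
  and closed_under_Diff: "closed_under B st \<Longrightarrow> closed_under C st \<Longrightarrow> closed_under (B - C) st"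
  by (auto simp: closed_under_def)

lemma closed_under_mono_words: "st \<in> mono_words A r \<Longrightarrow> closed_under A st"
  by (auto simp: closed_under_def mono_words_def)

text \<open>One additional edge can merge at most two components. If the word alone is disconnected,
  \<open>B\<close> has to be the component of \<open>d\<close>, and \<open>A - B\<close> that of
  \<open>s\<close>.\<close>

lemma factorizations_one_edge:
  assumes "s \<in> A" "d \<in> A" "s \<noteq> d"
  shows "factorizations A {B. s \<in> B \<longleftrightarrow> d \<in> B} r \<pi> = factorizations A UNIV r \<pi>
    \<union> (\<Union>B\<in>{B. B \<subseteq> A \<and> d \<in> B \<and> s \<notin> B}. two_component_words A B r \<pi>)"
proof (intro equalityI subsetI)
  fix st assume st: "st \<in> factorizations A {B. s \<in> B \<longleftrightarrow> d \<in> B} r \<pi>"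
  then have mw: "st \<in> mono_words A r" "word_prod st \<circ> \<pi> = id"
    unfolding factorizations_def by blast+
  then have A: "closed_under A st" by (simp only: closed_under_mono_words)
  have triv: "C = {} \<or> C = A" if "closed_under C st" "C \<subseteq> A" "s \<in> C \<longleftrightarrow> d \<in> C" for C
    using st that unfolding factorizations_def by blast
  show "st \<in> factorizations A UNIV r \<pi>
    \<union> (\<Union>B\<in>{B. B \<subseteq> A \<and> d \<in> B \<and> s \<notin> B}. two_component_words A B r \<pi>)"
  proof (cases "st \<in> factorizations A UNIV r \<pi>")
    case False
    then obtain C where C: "C \<subseteq> A" "closed_under C st" "C \<noteq> {}" "C \<noteq> A"
      using mw by (auto simp: factorizations_def)
    \<comment> \<open>By \<open>triv\<close> the set \<open>C\<close> separates \<open>s\<close>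
      from \<open>d\<close>; its side containing \<open>d\<close> is taken.\<close>
    define B where "B = (if d \<in> C then C else A - C)"
    have B: "B \<subseteq> A" "closed_under B st" "d \<in> B" "s \<notin> B"
    proof -
      have "\<not> (s \<in> C \<longleftrightarrow> d \<in> C)" using triv[OF C(2,1)] C(3,4) by blast
      then show "B \<subseteq> A" "d \<in> B" "s \<notin> B"
        using C(1) assms(2) by (auto simp: B_def)
      show "closed_under B st"
        using C(2) closed_under_Diff[OF A C(2)] by (simp add: B_def)
    qed
    \<comment> \<open>One of \<open>C\<close> and \<open>B - C\<close> contains neither
      \<open>s\<close> nor \<open>d\<close>, so \<open>triv\<close> applies to it. The same is done
      for \<open>A - B\<close> below, with \<open>s\<close> in place of \<open>d\<close>.\<close>
    have "C = {} \<or> C = B" if C: "C \<subseteq> B" "closed_under C st" for C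
    proof (cases "d \<in> C")
      case True
      have "B - C = {} \<or> B - C = A"
        by (rule triv[OF closed_under_Diff[OF B(2) C(2)]]) (use B C True in blast)+
      then show ?thesis using B C True by blast
    next
      case False
      have "C = {} \<or> C = A" by (rule triv[OF C(2)]) (use B C False in blast)+
      then show ?thesis using False assms(2) by blast
    qed
    moreover have "C = {} \<or> C = A - B" if C: "C \<subseteq> A - B" "closed_under C st" for C
    proof (cases "s \<in> C")
      case True
      have "A - B - C = {} \<or> A - B - C = A"
        by (rule triv[OF closed_under_Diff[OF closed_under_Diff[OF A B(2)] C(2)]]) (use B C True in blast)+
      then show ?thesis using B C True by blast
    next
      case False
      have "C = {} \<or> C = A" by (rule triv[OF C(2)]) (use B C False in blast)+
      then show ?thesis using False assms(1) by blast
    qed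
    ultimately have "st \<in> two_component_words A B r \<pi>"
      using B mw by (auto simp: two_component_words_def)
    then show ?thesis using B by blast
  qed simp
next
  fix st assume "st \<in> factorizations A UNIV r \<pi>
    \<union> (\<Union>B\<in>{B. B \<subseteq> A \<and> d \<in> B \<and> s \<notin> B}. two_component_words A B r \<pi>)"
  then show "st \<in> factorizations A {B. s \<in> B \<longleftrightarrow> d \<in> B} r \<pi>"
  proof
    assume "st \<in> (\<Union>B\<in>{B. B \<subseteq> A \<and> d \<in> B \<and> s \<notin> B}. two_component_words A B r \<pi>)"
    then obtain B where B: "B \<subseteq> A" "d \<in> B" "s \<notin> B" "closed_under B st" "st \<in> mono_words A r" "word_prod st \<circ> \<pi> = id"
      and c: "\<And>C. C \<subseteq> B \<Longrightarrow> closed_under C st \<Longrightarrow> C = {} \<or> C = B"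
        "\<And>C. C \<subseteq> A - B \<Longrightarrow> closed_under C st \<Longrightarrow> C = {} \<or> C = A - B"
      by (auto simp: two_component_words_def)
    have "C = {} \<or> C = A" if C: "C \<subseteq> A" "closed_under C st" "s \<in> C \<longleftrightarrow> d \<in> C" for C
    proof -
      have "B \<inter> C = {} \<or> B \<inter> C = B" using closed_under_Int[OF B(4) C(2)] by (intro c) auto
      moreover have "C - B = {} \<or> C - B = A - B" using closed_under_Diff[OF C(2) B(4)] C by (intro c) auto
      ultimately show ?thesis using C B assms by blast
    qed
    then show ?thesis using B by (auto simp: factorizations_def)
  qed (auto simp: factorizations_def)
qed

lemma card_factorizations_one_edge:
  assumes "finite A" "s \<in> A" "d \<in> A" "s \<noteq> d" and \<pi>: "\<pi> permutes A"
  shows "card (factorizations A {B. s \<in> B \<longleftrightarrow> d \<in> B} r \<pi>) = card (factorizations A UNIV r \<pi>)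
    + (\<Sum>B | B \<subseteq> A \<and> d \<in> B \<and> s \<notin> B \<and> \<pi> ` B = B. \<Sum>i\<le>r.
        card (factorizations B UNIV i (perm_restrict \<pi> B)) *
        card (factorizations (A - B) UNIV (r - i) (perm_restrict \<pi> (A - B))))"
proof -
  let ?W = "\<lambda>B. two_component_words A B r \<pi>"
  let ?Bs = "{B. B \<subseteq> A \<and> d \<in> B \<and> s \<notin> B \<and> \<pi> ` B = B}"
  have finW: "finite (?W B)" for B using assms(1) by (simp add: two_component_words_def)
  have finB: "finite ?Bs" using assms(1) by (auto intro: finite_subset[of _ "Pow A"])
  \<comment> \<open>The product of a word closed under \<open>B\<close> preserves \<open>B\<close>,
    and hence so does its inverse \<open>\<pi>\<close>.\<close>
  have "?W B = {}" if "B \<subseteq> A" "\<pi> ` B \<noteq> B" for B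
  proof (rule equals0I)
    fix st assume "st \<in> ?W B"
    then have cl: "closed_under B st" and id: "word_prod st \<circ> \<pi> = id"
      unfolding two_component_words_def by blast+
    have iff: "\<pi> x \<in> B \<longleftrightarrow> x \<in> B" for x
      using word_prod_in_closed_iff[OF cl, of "\<pi> x"] fun_cong[OF id, of x] by simp
    have "y \<in> \<pi> ` B" if "y \<in> B" for y
    proof -
      obtain x where "y = \<pi> x" using permutes_surj[OF \<pi>] by (rule surjE)
      with iff[of x] that show ?thesis by blast
    qed
    with iff have "\<pi> ` B = B" by blast
    then show False using that by simp
  qed
  then have "(\<Union>B\<in>{B. B \<subseteq> A \<and> d \<in> B \<and> s \<notin> B}. ?W B) = (\<Union>B\<in>?Bs. ?W B)"
    by blast
  then have "factorizations A {B. s \<in> B \<longleftrightarrow> d \<in> B} r \<pi> = factorizations A UNIV r \<pi> \<union> (\<Union>B\<in>?Bs. ?W B)"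
    using factorizations_one_edge[OF assms(2-4)] by (simp only:)
  also have "card \<dots> = card (factorizations A UNIV r \<pi>) + card (\<Union>B\<in>?Bs. ?W B)"
  proof (rule card_Un_disjoint)
    show "factorizations A UNIV r \<pi> \<inter> (\<Union>B\<in>?Bs. ?W B) = {}"
    proof (intro equals0I, elim IntE UN_E)
      fix st B assume st: "st \<in> factorizations A UNIV r \<pi>" and B: "B \<in> ?Bs" and W: "st \<in> ?W B"
      from W have "closed_under B st" by (simp add: two_component_words_def)
      with st B have "B = {} \<or> B = A" by (simp add: factorizations_def)
      with B assms(2) show False by blast
    qed
  qed (use assms(1) finW finB in auto)
  also have "card (\<Union>B\<in>?Bs. ?W B) = (\<Sum>B\<in>?Bs. card (?W B))"
  proof (rule card_UN_disjoint[OF finB])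
    show "\<forall>B\<in>?Bs. \<forall>B'\<in>?Bs. B \<noteq> B' \<longrightarrow> ?W B \<inter> ?W B' = {}"
    proof (intro ballI impI equals0I)
      fix B B' st assume B: "B \<in> ?Bs" "B' \<in> ?Bs" "B \<noteq> B'" "st \<in> ?W B \<inter> ?W B'"
      then have cl: "closed_under B st" "closed_under B' st"
        and c: "\<And>C. C \<subseteq> B \<Longrightarrow> closed_under C st \<Longrightarrow> C = {} \<or> C = B"
          "\<And>C. C \<subseteq> A - B \<Longrightarrow> closed_under C st \<Longrightarrow> C = {} \<or> C = A - B"
        using B(4) by (simp_all add: two_component_words_def)
      \<comment> \<open>\<open>B \<inter> B'\<close> contains \<open>d\<close>, so it equals
        \<open>B\<close>; \<open>B' - B\<close> misses \<open>s\<close>, so it is empty. Thus the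
        word determines \<open>B\<close>.\<close>
      have "B \<inter> B' = {} \<or> B \<inter> B' = B"
        by (rule c(1)[OF _ closed_under_Int[OF cl]]) simp
      moreover have "B' - B = {} \<or> B' - B = A - B"
        by (rule c(2)[OF _ closed_under_Diff[OF cl(2,1)]]) (use B(2) in blast)
      ultimately show False using B assms by blast
    qed
  qed (use finW in auto)
  also have "(\<Sum>B\<in>?Bs. card (?W B)) = (\<Sum>B\<in>?Bs. \<Sum>i\<le>r.
        card (factorizations B UNIV i (perm_restrict \<pi> B)) *
        card (factorizations (A - B) UNIV (r - i) (perm_restrict \<pi> (A - B))))"
    using assms(1) \<pi> by (intro sum.cong refl card_two_component_words) auto
  finally show ?thesis .
qed

section \<open>Orbits under multiplication by a transposition\<close>

text \<open>An explicit cyclic enumeration determines the orbit. It serves for both pieces of a cut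
  cycle and for two concatenated cycles.\<close>

lemma orbit_of_cycle:
  assumes "0 < n" and succ: "\<And>i. Suc i < n \<Longrightarrow> f (x i) = x (Suc i)" and last: "f (x (n - 1)) = x 0" and "i < n"
  shows "orbit f (x i) = x ` {..<n}"
proof -
  have step: "f (x j) = x (Suc j mod n)" if "j < n" for j
    using that succ[of j] last by (cases "Suc j = n") auto
  have iter: "(f ^^ m) (x i) = x ((i + m) mod n)" for m
    using assms(1,4) by (induction m) (auto simp: step mod_Suc_eq)
  show ?thesis
  proof (intro equalityI subsetI)
    fix y assume "y \<in> orbit f (x i)"
    then show "y \<in> x ` {..<n}" using assms(1) by (auto simp: orbit_altdef iter)
  next
    fix y assume "y \<in> x ` {..<n}"
    then obtain j where j: "y = x j" "j < n" by auto
    \<comment> \<open>Orbits consist of positive powers; the summand \<open>n\<close> keeps the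
      exponent positive even for j \<le> i.\<close>
    then have "y = (f ^^ (j + n - i)) (x i)" "0 < j + n - i"
      using \<open>i < n\<close> by (simp_all add: iter)
    then show "y \<in> orbit f (x i)" unfolding orbit_altdef by blast
  qed
qed

lemma orbit_powers:
  assumes "permutation \<pi>"
  shows "bij_betw (\<lambda>i. (\<pi> ^^ i) d) {..<card (orbit \<pi> d)} (orbit \<pi> d)"
    and "(\<pi> ^^ card (orbit \<pi> d)) d = d"
    and "0 < card (orbit \<pi> d)"
proof -
  let ?n = "funpow_dist1 \<pi> d d"
  have d: "d \<in> orbit \<pi> d" using assms by (rule permutation_self_in_orbit)
  have O: "orbit \<pi> d = (\<lambda>i. (\<pi> ^^ i) d) ` {..<?n}"
    using orbit_conv_funpow_dist1[OF d] by (simp add: lessThan_atLeast0)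
  have inj: "inj_on (\<lambda>i. (\<pi> ^^ i) d) {..<?n}"
    using inj_on_funpow_dist1[OF d] by (simp add: lessThan_atLeast0)
  have n: "card (orbit \<pi> d) = ?n" unfolding O card_image[OF inj] by simp
  show "bij_betw (\<lambda>i. (\<pi> ^^ i) d) {..<card (orbit \<pi> d)} (orbit \<pi> d)"
    unfolding n using O inj by (simp add: bij_betw_def)
  show "(\<pi> ^^ card (orbit \<pi> d)) d = d" "0 < card (orbit \<pi> d)"
    unfolding n using funpow_dist1_prop[OF d] by simp_all
qed

lemma orbit_eq_iff_mem:
  assumes "permutation \<pi>"
  shows "orbit \<pi> y = orbit \<pi> x \<longleftrightarrow> y \<in> orbit \<pi> x"
  using assms cyclic_on_orbit'[OF assms, of x] orbit_cyclic_eq3 permutation_self_in_orbit by metis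

lemma orbit_disjoint:
  assumes "permutation \<pi>" "orbit \<pi> y \<noteq> orbit \<pi> x"
  shows "orbit \<pi> y \<inter> orbit \<pi> x = {}"
  using assms orbit_eq_iff_mem[OF assms(1)] by blast

lemma permutes_imp_permutation: "\<pi> permutes A \<Longrightarrow> finite A \<Longrightarrow> permutation \<pi>"
  by (auto simp: permutation_permutes)

lemma funpow_eq_iff_lt:
  assumes "permutation \<pi>" "i < card (orbit \<pi> d)" "j < card (orbit \<pi> d)"
  shows "(\<pi> ^^ i) d = (\<pi> ^^ j) d \<longleftrightarrow> i = j"
  using orbit_powers(1)[OF assms(1), of d] assms(2,3) by (auto simp: bij_betw_def inj_on_def)

text \<open>After composition the predecessor of \<open>s\<close> is sent to \<open>d\<close> and
  the predecessor of \<open>d\<close> to \<open>s\<close>, which closes the cycle early and leaves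
  its tail as a second cycle.\<close>

lemma orbit_cut:
  assumes p: "permutation \<pi>" and k: "0 < k" "k < card (orbit \<pi> d)" and s: "s = (\<pi> ^^ k) d"
  defines "\<tau> \<equiv> transpose s d \<circ> \<pi>"
  shows "orbit \<tau> d = (\<lambda>i. (\<pi> ^^ i) d) ` {..<k}"
    and "orbit \<tau> s = (\<lambda>i. (\<pi> ^^ i) d) ` {k..<card (orbit \<pi> d)}"
proof -
  let ?a = "card (orbit \<pi> d)"
  have d: "d = (\<pi> ^^ 0) d" by simp
  have eq_d: "(\<pi> ^^ i) d = d \<longleftrightarrow> i = 0" if "i < ?a" for i
    using funpow_eq_iff_lt[OF p that, of 0] k by simp
  have eq_s: "(\<pi> ^^ i) d = s \<longleftrightarrow> i = k" if "i < ?a" for i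
    unfolding s using funpow_eq_iff_lt[OF p that, of k] k by simp
  have step: "\<tau> ((\<pi> ^^ i) d) = (\<pi> ^^ Suc i) d" if "Suc i < ?a" "Suc i \<noteq> k" for i
    unfolding \<tau>_def using that eq_d[of "Suc i"] eq_s[of "Suc i"] by (simp add: transpose_def)
  have step_k: "\<tau> ((\<pi> ^^ (k - 1)) d) = d"
  proof -
    have "\<pi> ((\<pi> ^^ (k - 1)) d) = (\<pi> ^^ Suc (k - 1)) d" by simp
    also have "\<dots> = s" using k s by simp
    finally show ?thesis by (simp add: \<tau>_def)
  qed
  have step_a: "\<tau> ((\<pi> ^^ (?a - 1)) d) = s"
  proof -
    have "\<pi> ((\<pi> ^^ (?a - 1)) d) = (\<pi> ^^ Suc (?a - 1)) d" by simp
    also have "\<dots> = d" using orbit_powers(2,3)[OF p, of d] by simp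
    finally show ?thesis by (simp add: \<tau>_def)
  qed
  have "orbit \<tau> ((\<pi> ^^ 0) d) = (\<lambda>i. (\<pi> ^^ i) d) ` {..<k}"
    by (rule orbit_of_cycle[where x = "\<lambda>i. (\<pi> ^^ i) d"]) (use k step step_k in auto)
  then show "orbit \<tau> d = (\<lambda>i. (\<pi> ^^ i) d) ` {..<k}" by simp
  have "orbit \<tau> ((\<pi> ^^ (k + 0)) d) = (\<lambda>i. (\<pi> ^^ (k + i)) d) ` {..<?a - k}"
    by (rule orbit_of_cycle[where x = "\<lambda>i. (\<pi> ^^ (k + i)) d"]) (use k step[of "k + i" for i] step_a s in auto)
  also have "\<dots> = (\<lambda>i. (\<pi> ^^ i) d) ` ((+) k ` {..<?a - k})"
    by (simp add: image_image)
  also have "(+) k ` {..<?a - k} = {k..<?a}"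
    using k by (simp add: lessThan_atLeast0)
  finally show "orbit \<tau> s = (\<lambda>i. (\<pi> ^^ i) d) ` {k..<?a}" by (simp add: s)
qed

text \<open>The same redirection of predecessors concatenates two cycles: \<open>x\<close> runs
  through that of \<open>d\<close> and then through that of \<open>s\<close>.\<close>

lemma orbit_join:
  assumes p: "permutation \<pi>" and s: "s \<notin> orbit \<pi> d" and z: "z \<in> orbit \<pi> d \<union> orbit \<pi> s"
  shows "orbit (transpose s d \<circ> \<pi>) z = orbit \<pi> d \<union> orbit \<pi> s"
proof -
  let ?\<tau> = "transpose s d \<circ> \<pi>" and ?a = "card (orbit \<pi> d)" and ?b = "card (orbit \<pi> s)"
  define x where "x i = (if i < ?a then (\<pi> ^^ i) d else (\<pi> ^^ (i - ?a)) s)" for i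
  have disj: "orbit \<pi> d \<inter> orbit \<pi> s = {}"
    using orbit_disjoint[OF p, of d s] s orbit_eq_iff_mem[OF p, of s d] by argo
  have self: "d \<in> orbit \<pi> d" "s \<in> orbit \<pi> s" using p by (auto intro: permutation_self_in_orbit)
  have in_d: "(\<pi> ^^ i) d \<in> orbit \<pi> d" and in_s: "(\<pi> ^^ i) s \<in> orbit \<pi> s" for i
    using self by (auto intro: funpow_in_orbit)
  have step: "?\<tau> ((\<pi> ^^ i) d) = (\<pi> ^^ Suc i) d" if "Suc i < ?a" for i
  proof -
    have "(\<pi> ^^ Suc i) d \<noteq> d" using funpow_eq_iff_lt[OF p that, of 0] orbit_powers(3)[OF p, of d] by simp
    moreover have "(\<pi> ^^ Suc i) d \<noteq> s" using in_d[of "Suc i"] s by metis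
    ultimately show ?thesis by simp
  qed
  have step': "?\<tau> ((\<pi> ^^ i) s) = (\<pi> ^^ Suc i) s" if "Suc i < ?b" for i
  proof -
    have "(\<pi> ^^ Suc i) s \<noteq> s" using funpow_eq_iff_lt[OF p that, of 0] orbit_powers(3)[OF p, of s] by simp
    moreover have "(\<pi> ^^ Suc i) s \<noteq> d" using in_s[of "Suc i"] disj self by (metis disjoint_iff)
    ultimately show ?thesis by simp
  qed
  have last: "\<pi> ((\<pi> ^^ (card (orbit \<pi> y) - 1)) y) = y" for y
  proof -
    have "\<pi> ((\<pi> ^^ (card (orbit \<pi> y) - 1)) y) = (\<pi> ^^ Suc (card (orbit \<pi> y) - 1)) y" by simp
    then show ?thesis using orbit_powers(2,3)[OF p, of y] by simp
  qed
  have pos: "0 < ?a" "0 < ?b" using orbit_powers(3)[OF p] by auto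
  have succ: "?\<tau> (x i) = x (Suc i)" if "Suc i < ?a + ?b" for i
  proof -
    consider "Suc i < ?a" | "Suc i = ?a" | "?a \<le> i" by linarith
    then show ?thesis
    proof cases
      case 1
      then show ?thesis using step[OF 1] by (simp add: x_def)
    next
      case 2
      then have "i = ?a - 1" "i < ?a" by auto
      then show ?thesis using last[of d] 2 by (simp add: x_def)
    next
      case 3
      then show ?thesis using step'[of "i - ?a"] that by (simp add: x_def Suc_diff_le)
    qed
  qed
  have wrap: "?\<tau> (x (?a + ?b - 1)) = x 0"
  proof -
    have "\<not> ?a + ?b - 1 < ?a" "?a + ?b - 1 - ?a = ?b - 1" using pos by linarith+
    then show ?thesis using last[of s] pos by (simp add: x_def del: One_nat_def)
  qed
  have img: "x ` {..<?a + ?b} = orbit \<pi> d \<union> orbit \<pi> s"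
  proof -
    have "{..<?a + ?b} = {..<?a} \<union> (+) ?a ` {..<?b}"
      by (auto simp: lessThan_atLeast0)
    then have "x ` {..<?a + ?b} = x ` {..<?a} \<union> (\<lambda>i. x (?a + i)) ` {..<?b}"
      by (simp add: image_Un image_image)
    also have "x ` {..<?a} = orbit \<pi> d"
      using orbit_powers(1)[OF p, of d] by (simp add: x_def bij_betw_def)
    also have "(\<lambda>i. x (?a + i)) ` {..<?b} = orbit \<pi> s"
      using orbit_powers(1)[OF p, of s] by (simp add: x_def bij_betw_def)
    finally show ?thesis .
  qed
  obtain i where i: "i < ?a + ?b" "z = x i" using z unfolding img[symmetric] by auto
  show ?thesis
    unfolding img[symmetric] i(2) by (rule orbit_of_cycle[OF _ succ wrap i(1)]) (use pos in simp)
qed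

lemma orbit_transpose_comp_other:
  assumes "permutation \<pi>" "y \<notin> orbit \<pi> d" "y \<notin> orbit \<pi> s"
  shows "orbit (transpose s d \<circ> \<pi>) y = orbit \<pi> y"
proof (rule orbit_cong)
  show y: "y \<in> orbit \<pi> y" using assms(1) by (rule permutation_self_in_orbit)
  fix z assume "z \<in> orbit \<pi> y"
  then have "\<pi> z \<in> orbit \<pi> y" by (rule orbit.step)
  then have "\<pi> z \<noteq> d" "\<pi> z \<noteq> s"
    using assms orbit_swap[OF y] by blast+
  then show "(transpose s d \<circ> \<pi>) z = \<pi> z" by simp
qed

lemma orbits_join:
  assumes p: "permutation \<pi>" and "d \<in> A" "s \<in> A" and s: "s \<notin> orbit \<pi> d"
  shows "orbit (transpose s d \<circ> \<pi>) ` A =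
    insert (orbit \<pi> d \<union> orbit \<pi> s) (orbit \<pi> ` A - {orbit \<pi> d, orbit \<pi> s})"
proof -
  let ?\<tau> = "transpose s d \<circ> \<pi>" and ?U = "orbit \<pi> d \<union> orbit \<pi> s"
  have self: "d \<in> orbit \<pi> d" using p by (rule permutation_self_in_orbit)
  have "orbit ?\<tau> ` A = orbit ?\<tau> ` (A \<inter> ?U) \<union> orbit ?\<tau> ` (A - ?U)" by blast
  also have "orbit ?\<tau> ` (A \<inter> ?U) = {?U}"
    using orbit_join[OF p s] self assms(2) by auto
  also have "orbit ?\<tau> ` (A - ?U) = orbit \<pi> ` (A - ?U)"
    using orbit_transpose_comp_other[OF p] by (intro image_cong) auto
  also have "\<dots> = orbit \<pi> ` A - {orbit \<pi> d, orbit \<pi> s}"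
  proof -
    have "A - ?U = {y \<in> A. orbit \<pi> y \<noteq> orbit \<pi> d \<and> orbit \<pi> y \<noteq> orbit \<pi> s}"
      by (auto simp: orbit_eq_iff_mem[OF p])
    then show ?thesis by auto
  qed
  finally show ?thesis by (simp only: Un_insert_left Un_empty_left)
qed

lemma orbits_cut:
  assumes p: "permutation \<pi>" and "d \<in> A" "s \<in> A"
    and k: "0 < k" "k < card (orbit \<pi> d)" and s: "s = (\<pi> ^^ k) d"
  defines "\<tau> \<equiv> transpose s d \<circ> \<pi>"
  shows "orbit \<tau> ` A = insert (orbit \<tau> d) (insert (orbit \<tau> s) (orbit \<pi> ` A - {orbit \<pi> d}))"
    and "orbit \<tau> d \<union> orbit \<tau> s = orbit \<pi> d" and "orbit \<tau> d \<inter> orbit \<tau> s = {}"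
    and "card (orbit \<tau> d) = k" and "card (orbit \<tau> s) = card (orbit \<pi> d) - k"
proof -
  let ?a = "card (orbit \<pi> d)"
  have eqs: "orbit \<tau> d = (\<lambda>i. (\<pi> ^^ i) d) ` {..<k}" "orbit \<tau> s = (\<lambda>i. (\<pi> ^^ i) d) ` {k..<?a}"
    unfolding \<tau>_def by (rule orbit_cut[OF p k s])+
  have inj: "inj_on (\<lambda>i. (\<pi> ^^ i) d) {..<?a}" and O: "orbit \<pi> d = (\<lambda>i. (\<pi> ^^ i) d) ` {..<?a}"
    using orbit_powers(1)[OF p, of d] by (auto simp: bij_betw_def)
  have "{..<k} \<union> {k..<?a} = {..<?a}" using k by auto
  then show un: "orbit \<tau> d \<union> orbit \<tau> s = orbit \<pi> d"
    using O unfolding eqs image_Un[symmetric] by argo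
  show "orbit \<tau> d \<inter> orbit \<tau> s = {}"
    unfolding eqs using k by (subst inj_on_image_Int[OF inj, symmetric]) auto
  show "card (orbit \<tau> d) = k"
    unfolding eqs using k by (subst card_image) (auto intro: inj_on_subset[OF inj])
  show "card (orbit \<tau> s) = ?a - k"
    unfolding eqs using k by (subst card_image) (auto intro: inj_on_subset[OF inj])
  have p': "permutation \<tau>" unfolding \<tau>_def using p by (auto intro: permutation_compose permutation_swap_id)
  have so: "s \<in> orbit \<pi> d" unfolding s using p by (intro funpow_in_orbit permutation_self_in_orbit)
  have self: "d \<in> orbit \<tau> d" "s \<in> orbit \<tau> s" using p' by (auto intro: permutation_self_in_orbit)
  have "orbit \<tau> ` A = orbit \<tau> ` (A \<inter> orbit \<pi> d) \<union> orbit \<tau> ` (A - orbit \<pi> d)" by blast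
  also have "orbit \<tau> ` (A \<inter> orbit \<pi> d) = {orbit \<tau> d, orbit \<tau> s}"
  proof -
    have "orbit \<tau> z = orbit \<tau> d \<or> orbit \<tau> z = orbit \<tau> s" if "z \<in> orbit \<pi> d" for z
      using that un orbit_eq_iff_mem[OF p'] by blast
    moreover have "d \<in> A \<inter> orbit \<pi> d" "s \<in> A \<inter> orbit \<pi> d" using self un assms(2,3) by auto
    ultimately show ?thesis by blast
  qed
  also have "orbit \<tau> ` (A - orbit \<pi> d) = orbit \<pi> ` (A - orbit \<pi> d)"
  proof (rule image_cong)
    fix y assume "y \<in> A - orbit \<pi> d"
    moreover have "orbit \<pi> s = orbit \<pi> d" using so orbit_eq_iff_mem[OF p] by blast
    ultimately show "orbit \<tau> y = orbit \<pi> y"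
      unfolding \<tau>_def using orbit_transpose_comp_other[OF p] by auto
  qed simp
  also have "\<dots> = orbit \<pi> ` A - {orbit \<pi> d}"
  proof -
    have "A - orbit \<pi> d = {y \<in> A. orbit \<pi> y \<noteq> orbit \<pi> d}"
      by (auto simp: orbit_eq_iff_mem[OF p])
    then show ?thesis by auto
  qed
  finally show "orbit \<tau> ` A = insert (orbit \<tau> d) (insert (orbit \<tau> s) (orbit \<pi> ` A - {orbit \<pi> d}))"
    by simp
qed

section \<open>The join-cut recursion\<close>

lemma cycle_lengths_join:
  assumes \<pi>: "\<pi> permutes A" "finite A" and ds: "d \<in> A" "s \<in> A" and s: "s \<notin> orbit \<pi> d"
  shows "cycle_lengths A (transpose s d \<circ> \<pi>) = add_mset (card (orbit \<pi> d) + card (orbit \<pi> s))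
    (image_mset card (mset_set (orbit \<pi> ` A - {orbit \<pi> d} - {orbit \<pi> s})))"
proof -
  have p: "permutation \<pi>" using \<pi> by (rule permutes_imp_permutation)
  have self: "s \<in> orbit \<pi> s" "d \<in> orbit \<pi> d" using p by (auto intro: permutation_self_in_orbit)
  have fin: "finite (orbit \<pi> d)" "finite (orbit \<pi> s)" using self by (auto intro: finite_orbit)
  have disj: "orbit \<pi> d \<inter> orbit \<pi> s = {}"
    using orbit_disjoint[OF p, of d s] s orbit_eq_iff_mem[OF p, of s d] by argo
  \<comment> \<open>\<open>cycle_lengths\<close> counts a set of orbits, so the merged orbit must be
    new for its length to be added.\<close>
  have "orbit \<pi> d \<union> orbit \<pi> s \<notin> orbit \<pi> ` A"
  proof
    assume "orbit \<pi> d \<union> orbit \<pi> s \<in> orbit \<pi> ` A"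
    then obtain y where y: "orbit \<pi> d \<union> orbit \<pi> s = orbit \<pi> y" by auto
    then have "d \<in> orbit \<pi> y" "s \<in> orbit \<pi> y" using self by auto
    then have "orbit \<pi> d = orbit \<pi> s" using orbit_eq_iff_mem[OF p] by metis
    then show False using s self by simp
  qed
  moreover have "orbit \<pi> ` A - {orbit \<pi> d, orbit \<pi> s} = orbit \<pi> ` A - {orbit \<pi> d} - {orbit \<pi> s}" by blast
  ultimately show ?thesis
    unfolding cycle_lengths_def orbits_join[OF p ds s]
    using \<pi>(2) disj fin by (subst mset_set.insert) (auto simp: card_Un_disjoint)
qed

section \<open>Invariant sets as unions of cycles\<close>

lemma image_invariant_iff:
  assumes "f permutes A" "finite B"
  shows "f ` B = B \<longleftrightarrow> (\<forall>x\<in>B. f x \<in> B)"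
  using assms endo_inj_surj[of B f] inj_on_subset[OF permutes_inj[OF assms(1)], of B] by blast

lemma invariant_eq_Union_orbits:
  assumes "\<tau> permutes A" "finite A" "B \<subseteq> A"
  shows "\<tau> ` B = B \<longleftrightarrow> B = \<Union> (orbit \<tau> ` B)"
proof -
  have p: "permutation \<tau>" using assms by (auto intro: permutes_imp_permutation)
  have "\<tau> ` B = B \<longleftrightarrow> (\<forall>x\<in>B. \<tau> x \<in> B)"
    using assms by (intro image_invariant_iff) (auto intro: finite_subset)
  also have "\<dots> \<longleftrightarrow> (\<forall>x\<in>B. orbit \<tau> x \<subseteq> B)"
  proof (intro iffI ballI)
    fix x assume x: "x \<in> B" and inv: "\<forall>x\<in>B. \<tau> x \<in> B"
    show "orbit \<tau> x \<subseteq> B"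
    proof
      fix y assume "y \<in> orbit \<tau> x"
      then show "y \<in> B" by induction (use x inv in auto)
    qed
  qed (auto intro: orbit.base)
  also have "\<dots> \<longleftrightarrow> B = \<Union> (orbit \<tau> ` B)"
    using permutation_self_in_orbit[OF p] by blast
  finally show ?thesis .
qed

lemma orbits_of_Union:
  assumes "permutation \<tau>" "S \<subseteq> orbit \<tau> ` A"
  shows "orbit \<tau> ` \<Union> S = S"
proof (intro equalityI subsetI)
  fix O' assume "O' \<in> orbit \<tau> ` \<Union> S"
  then obtain x y where "O' = orbit \<tau> x" "x \<in> orbit \<tau> y" "orbit \<tau> y \<in> S"
    using assms(2) by blast
  then show "O' \<in> S" using orbit_eq_iff_mem[OF assms(1)] by metis
next
  fix O' assume "O' \<in> S"
  then obtain y where y: "O' = orbit \<tau> y" using assms(2) by blast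
  moreover have "y \<in> orbit \<tau> y" using assms(1) by (rule permutation_self_in_orbit)
  ultimately show "O' \<in> orbit \<tau> ` \<Union> S" using \<open>O' \<in> S\<close> by blast
qed

text \<open>An invariant set is a union of cycles. It has to contain the cycle \<open>D\<close> of
  \<open>d\<close> and avoid the cycle \<open>E\<close> of \<open>s\<close>, so only the choice
  \<open>S\<close> among the remaining cycles \<open>Q\<close> is free.\<close>

lemma bij_betw_Union_orbits:
  assumes \<tau>: "\<tau> permutes A" "finite A" and ds: "orbit \<tau> ` A = insert D (insert E Q)"
    and dE: "d \<in> D" "d \<notin> E" "d \<notin> \<Union> Q" and sE: "s \<in> E" "s \<notin> D" "s \<notin> \<Union> Q"
  shows "bij_betw (\<lambda>S. \<Union> (insert D S)) (Pow Q) {B. B \<subseteq> A \<and> d \<in> B \<and> s \<notin> B \<and> \<tau> ` B = B}"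
proof -
  have p: "permutation \<tau>" using \<tau> by (rule permutes_imp_permutation)
  have sub: "\<Union> (orbit \<tau> ` A) \<subseteq> A" using permutes_orbit_subset[OF \<tau>(1)] by blast
  have orb: "orbit \<tau> ` \<Union> (insert D S) = insert D S" if "S \<subseteq> Q" for S
    using that ds by (intro orbits_of_Union[OF p]) auto
  have DQ: "D \<notin> Q" using dE by blast
  show ?thesis
  proof (rule bij_betw_byWitness[where f' = "\<lambda>B. orbit \<tau> ` B - {D}"])
    show "\<forall>S\<in>Pow Q. orbit \<tau> ` \<Union> (insert D S) - {D} = S"
    proof
      fix S assume "S \<in> Pow Q"
      then have "orbit \<tau> ` \<Union> (insert D S) = insert D S" "D \<notin> S" using orb DQ by blast+
      then show "orbit \<tau> ` \<Union> (insert D S) - {D} = S" by simp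
    qed
    show "\<forall>B\<in>{B. B \<subseteq> A \<and> d \<in> B \<and> s \<notin> B \<and> \<tau> ` B = B}. \<Union> (insert D (orbit \<tau> ` B - {D})) = B"
    proof
      fix B assume B: "B \<in> {B. B \<subseteq> A \<and> d \<in> B \<and> s \<notin> B \<and> \<tau> ` B = B}"
      then have U: "B = \<Union> (orbit \<tau> ` B)"
        using invariant_eq_Union_orbits[OF \<tau>, of B] by simp
      have "D \<in> orbit \<tau> ` A" using ds by simp
      then have "orbit \<tau> d = D" using dE(1) orbit_eq_iff_mem[OF p] by auto
      then have "insert D (orbit \<tau> ` B - {D}) = orbit \<tau> ` B" using B by blast
      then show "\<Union> (insert D (orbit \<tau> ` B - {D})) = B" using U by simp
    qed
    show "(\<lambda>S. \<Union> (insert D S)) ` Pow Q \<subseteq> {B. B \<subseteq> A \<and> d \<in> B \<and> s \<notin> B \<and> \<tau> ` B = B}"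
    proof clarify
      fix S assume S: "S \<subseteq> Q"
      have A: "\<Union> (insert D S) \<subseteq> A"
      proof -
        have "insert D S \<subseteq> orbit \<tau> ` A" unfolding ds using S by blast
        then show ?thesis using sub by blast
      qed
      moreover have "\<tau> ` \<Union> (insert D S) = \<Union> (insert D S)"
        unfolding invariant_eq_Union_orbits[OF \<tau> A] orb[OF S] ..
      moreover have "d \<in> \<Union> (insert D S)" "s \<notin> \<Union> (insert D S)" using dE sE S by auto
      ultimately show "\<Union> (insert D S) \<subseteq> A \<and> d \<in> \<Union> (insert D S) \<and> s \<notin> \<Union> (insert D S) \<and>
        \<tau> ` \<Union> (insert D S) = \<Union> (insert D S)" by blast
    qed
    show "(\<lambda>B. orbit \<tau> ` B - {D}) ` {B. B \<subseteq> A \<and> d \<in> B \<and> s \<notin> B \<and> \<tau> ` B = B} \<subseteq> Pow Q"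
    proof clarify
      fix B x assume B: "B \<subseteq> A" "s \<notin> B" "\<tau> ` B = B" and x: "x \<in> B" "orbit \<tau> x \<notin> Q"
      then have "B = \<Union> (orbit \<tau> ` B)"
        using invariant_eq_Union_orbits[OF \<tau>, of B] by simp
      then have "orbit \<tau> x \<noteq> E" using x sE B(2) by blast
      moreover have "orbit \<tau> x \<in> insert D (insert E Q)" unfolding ds[symmetric] using x B by blast
      ultimately show "orbit \<tau> x = D" using x by blast
    qed
  qed
qed

lemma perm_restrict_permutes:
  assumes "\<tau> permutes A" "\<tau> ` B = B"
  shows "perm_restrict \<tau> B permutes B"
proof -
  have "bij_betw \<tau> B B" using assms permutes_inj_on by (auto simp: bij_betw_def)
  then have "bij_betw (perm_restrict \<tau> B) B B"
    by (rule bij_betw_cong[THEN iffD1, rotated]) (simp add: perm_restrict_def)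
  then show ?thesis
    by (rule bij_imp_permutes) (simp add: perm_restrict_def)
qed

lemma cycle_lengths_perm_restrict:
  assumes "\<tau> ` B = B"
  shows "cycle_lengths B (perm_restrict \<tau> B) = image_mset card (mset_set (orbit \<tau> ` B))"
proof -
  have "orbit (perm_restrict \<tau> B) x = orbit \<tau> x" if "x \<in> B" for x
    using that assms by (intro orbit_cong0[of x B]) (auto simp: perm_restrict_def)
  then show ?thesis by (simp add: cycle_lengths_def cong: image_cong)
qed

text \<open>Elements of other cycles lead to joins, elements of the cycle of \<open>d\<close> to
  cuts. In a cut, \<open>k\<close> becomes the length of the piece that keeps
  \<open>d\<close>.\<close>

lemma sum_diff_orbit:
  assumes \<pi>: "\<pi> permutes A" "finite A" and d: "d \<in> A"
  shows "(\<Sum>s\<in>A - {d}. f s :: nat) = (\<Sum>U\<in>orbit \<pi> ` A - {orbit \<pi> d}. \<Sum>s\<in>U. f s)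
    + (\<Sum>k = 1..<card (orbit \<pi> d). f ((\<pi> ^^ k) d))"
proof -
  have p: "permutation \<pi>" using \<pi> by (rule permutes_imp_permutation)
  let ?O = "orbit \<pi> d"
  have self: "x \<in> orbit \<pi> x" for x using p by (rule permutation_self_in_orbit)
  have sub: "orbit \<pi> x \<subseteq> A" if "x \<in> A" for x using permutes_orbit_subset[OF \<pi>(1) that] .
  have "A - {d} = (A - ?O) \<union> (?O - {d})" using self sub d by auto
  then have "(\<Sum>s\<in>A - {d}. f s) = (\<Sum>s\<in>A - ?O. f s) + (\<Sum>s\<in>?O - {d}. f s)"
    using \<pi>(2) finite_orbit[OF self] by (simp only:, intro sum.union_disjoint) auto
  also have "(\<Sum>s\<in>?O - {d}. f s) = (\<Sum>k = 1..<card ?O. f ((\<pi> ^^ k) d))"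
  proof (rule sum.reindex_bij_betw[symmetric])
    have "bij_betw (\<lambda>k. (\<pi> ^^ k) d) ({..<card ?O} - {0}) (?O - {d})"
      using orbit_powers(3)[OF p, of d] by (intro bij_betw_DiffI orbit_powers(1)[OF p]) (auto simp: bij_betw_def self)
    moreover have "{..<card ?O} - {0} = {1..<card ?O}" by auto
    ultimately show "bij_betw (\<lambda>k. (\<pi> ^^ k) d) {1..<card ?O} (?O - {d})" by simp
  qed
  also have "(\<Sum>s\<in>A - ?O. f s) = (\<Sum>U\<in>orbit \<pi> ` A - {?O}. \<Sum>s\<in>U. f s)"
  proof -
    have "A - ?O = \<Union> (orbit \<pi> ` A - {?O})"
    proof (intro equalityI subsetI)
      fix x assume "x \<in> A - ?O"
      then have "orbit \<pi> x \<in> orbit \<pi> ` A - {?O}" using self by blast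
      then show "x \<in> \<Union> (orbit \<pi> ` A - {?O})" using self by blast
    next
      fix x assume "x \<in> \<Union> (orbit \<pi> ` A - {?O})"
      then obtain y where "x \<in> orbit \<pi> y" "y \<in> A" "orbit \<pi> y \<noteq> ?O" by auto
      then show "x \<in> A - ?O" using sub orbit_disjoint[OF p, of y d] by blast
    qed
    then have "(\<Sum>s\<in>A - ?O. f s) = sum f (\<Union> (orbit \<pi> ` A - {?O}))" by simp
    also have "\<dots> = (sum \<circ> sum) f (orbit \<pi> ` A - {?O})"
    proof (rule sum.Union_disjoint)
      show "\<forall>U\<in>orbit \<pi> ` A - {?O}. finite U" using finite_orbit[OF self] by auto
      show "\<forall>U\<in>orbit \<pi> ` A - {?O}. \<forall>V\<in>orbit \<pi> ` A - {?O}. U \<noteq> V \<longrightarrow> U \<inter> V = {}"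
        using orbit_disjoint[OF p] by fastforce
    qed
    finally show ?thesis by simp
  qed
  finally show ?thesis .
qed

text \<open>\<open>w j\<close> is the length of the cycle labelled \<open>j \<in> I\<close>, and \<open>a\<close> is the length of the cycle
  that contains the element moved by the last transposition.\<close>

definition join_cut :: "(nat \<Rightarrow> nat multiset \<Rightarrow> nat) \<Rightarrow> nat \<Rightarrow> nat \<Rightarrow> 'i set \<Rightarrow> ('i \<Rightarrow> nat) \<Rightarrow> nat" where
  "join_cut N r a I w =
     (\<Sum>j\<in>I. w j * N r (add_mset (a + w j) (image_mset w (mset_set (I - {j})))))
   + (\<Sum>k = 1..<a. N r (add_mset k (add_mset (a - k) (image_mset w (mset_set I))))
        + (\<Sum>S\<in>Pow I. \<Sum>i\<le>r. N i (add_mset k (image_mset w (mset_set S)))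
             * N (r - i) (add_mset (a - k) (image_mset w (mset_set (I - S))))))"

text \<open>\<open>N\<close> stands for any function of the cycle type that gives the counts up to
  length \<open>r\<close>. In this form the lemma serves as the induction step before class
  invariance is established.\<close>

lemma card_factorizations_join_cut:
  assumes N: "\<And>i A \<pi>. i \<le> r \<Longrightarrow> finite A \<Longrightarrow> \<pi> permutes A \<Longrightarrow>
      card (factorizations A UNIV i \<pi>) = N i (cycle_lengths A \<pi>)"
    and \<pi>: "\<pi> permutes A" "finite A" and d: "d \<in> A"
  shows "card (factorizations A UNIV (Suc r) \<pi>) =
    join_cut N r (card (orbit \<pi> d)) (orbit \<pi> ` A - {orbit \<pi> d}) card"
proof -
  have p: "permutation \<pi>" using \<pi> by (rule permutes_imp_permutation)
  let ?O = "orbit \<pi> d" and ?Q = "orbit \<pi> ` A - {orbit \<pi> d}"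
  have self: "x \<in> orbit \<pi> x" for x using p by (rule permutation_self_in_orbit)
  have sub: "orbit \<pi> x \<subseteq> A" if "x \<in> A" for x using permutes_orbit_subset[OF \<pi>(1) that] .
  have finQ: "finite ?Q" using \<pi>(2) by simp
  let ?f = "\<lambda>s. card (factorizations A {B. s \<in> B \<longleftrightarrow> d \<in> B} r (transpose s d \<circ> \<pi>))"
  have comp_perm: "transpose s d \<circ> \<pi> permutes A" if "s \<in> A" for s
    using that d \<pi> by (intro permutes_compose) (auto intro: permutes_swap_id)
  have join: "?f s = N r (add_mset (card ?O + card U) (image_mset card (mset_set (?Q - {U}))))"
    if U: "U \<in> ?Q" and s: "s \<in> U" for U s
  proof -
    obtain y where y: "U = orbit \<pi> y" "y \<in> A" "orbit \<pi> y \<noteq> ?O" using U by blast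
    have sA: "s \<in> A" using sub[OF y(2)] s y(1) by blast
    have "orbit \<pi> s = orbit \<pi> y" using s y(1) by (simp add: orbit_eq_iff_mem[OF p])
    then have Us: "U = orbit \<pi> s" and sO: "s \<notin> ?O"
      using y(1,3) orbit_eq_iff_mem[OF p, of s d] by simp_all
    have "s \<noteq> d" using sO self by blast
    let ?\<tau> = "transpose s d \<circ> \<pi>"
    \<comment> \<open>After a join \<open>s\<close> and \<open>d\<close> share a cycle, so no
      invariant set separates them. Therefore products of two counts arise from cuts only.\<close>
    have "s \<in> B" if B: "B \<subseteq> A" "d \<in> B" "?\<tau> ` B = B" for B
    proof -
      have "B = \<Union> (orbit ?\<tau> ` B)"
        using invariant_eq_Union_orbits[OF comp_perm[OF sA] \<pi>(2) B(1)] B(3) by simp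
      moreover have "orbit ?\<tau> d = ?O \<union> orbit \<pi> s" by (rule orbit_join[OF p sO]) (use self in auto)
      ultimately show ?thesis using B(2) self by blast
    qed
    then have none: "{B. B \<subseteq> A \<and> d \<in> B \<and> s \<notin> B \<and> ?\<tau> ` B = B} = {}" by blast
    have "?f s = card (factorizations A UNIV r ?\<tau>)"
      unfolding card_factorizations_one_edge[OF \<pi>(2) sA d \<open>s \<noteq> d\<close> comp_perm[OF sA]] none by simp
    also have "\<dots> = N r (cycle_lengths A ?\<tau>)" using \<pi> comp_perm[OF sA] by (intro N) auto
    finally show ?thesis unfolding cycle_lengths_join[OF \<pi> d sA sO] Us .
  qed
  have cut: "?f ((\<pi> ^^ k) d) = N r (add_mset k (add_mset (card ?O - k) (image_mset card (mset_set ?Q))))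
        + (\<Sum>S\<in>Pow ?Q. \<Sum>i\<le>r. N i (add_mset k (image_mset card (mset_set S)))
             * N (r - i) (add_mset (card ?O - k) (image_mset card (mset_set (?Q - S)))))"
    if k: "k \<in> {1..<card ?O}" for k
  proof -
    define s where "s = (\<pi> ^^ k) d"
    define \<tau> where "\<tau> = transpose s d \<circ> \<pi>"
    have k': "0 < k" "k < card ?O" using k by auto
    have sO: "s \<in> ?O" unfolding s_def using self by (rule funpow_in_orbit)
    then have sA: "s \<in> A" using sub[OF d] by blast
    have "s \<noteq> d" using funpow_eq_iff_lt[OF p k'(2), of 0] k' by (simp add: s_def)
    note cut = orbits_cut[OF p d sA k' s_def, folded \<tau>_def]
    have \<tau>: "\<tau> permutes A" unfolding \<tau>_def using sA by (rule comp_perm)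
    have p': "permutation \<tau>" using \<tau> \<pi>(2) by (rule permutes_imp_permutation)
    let ?D = "orbit \<tau> d" and ?E = "orbit \<tau> s"
    have self': "d \<in> ?D" "s \<in> ?E" using p' by (auto intro: permutation_self_in_orbit)
    have Q_disj: "V \<inter> ?O = {}" if "V \<in> ?Q" for V
      using that orbit_disjoint[OF p] by auto
    have DE: "d \<notin> ?E" "s \<notin> ?D" "d \<notin> \<Union> ?Q" "s \<notin> \<Union> ?Q" "?D \<notin> ?Q" "?E \<notin> ?Q" "?D \<noteq> ?E"
      using self' cut(2,3) Q_disj self[of d] sO by blast+
    have ms: "cycle_lengths A \<tau> = add_mset k (add_mset (card ?O - k) (image_mset card (mset_set ?Q)))"
      unfolding cycle_lengths_def cut(1) using DE(5-7) finQ cut(4,5) by simp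
    have "?f s = card (factorizations A UNIV r \<tau>)
      + (\<Sum>B | B \<subseteq> A \<and> d \<in> B \<and> s \<notin> B \<and> \<tau> ` B = B. \<Sum>i\<le>r.
        card (factorizations B UNIV i (perm_restrict \<tau> B)) *
        card (factorizations (A - B) UNIV (r - i) (perm_restrict \<tau> (A - B))))"
      unfolding \<tau>_def[symmetric] by (rule card_factorizations_one_edge[OF \<pi>(2) sA d \<open>s \<noteq> d\<close> \<tau>])
    also have "card (factorizations A UNIV r \<tau>) = N r (cycle_lengths A \<tau>)"
      using \<pi>(2) \<tau> by (intro N) auto
    also have "(\<Sum>B | B \<subseteq> A \<and> d \<in> B \<and> s \<notin> B \<and> \<tau> ` B = B. \<Sum>i\<le>r.
        card (factorizations B UNIV i (perm_restrict \<tau> B)) *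
        card (factorizations (A - B) UNIV (r - i) (perm_restrict \<tau> (A - B)))) =
      (\<Sum>S\<in>Pow ?Q. \<Sum>i\<le>r.
        card (factorizations (\<Union> (insert ?D S)) UNIV i (perm_restrict \<tau> (\<Union> (insert ?D S)))) *
        card (factorizations (A - \<Union> (insert ?D S)) UNIV (r - i) (perm_restrict \<tau> (A - \<Union> (insert ?D S)))))"
      by (rule sum.reindex_bij_betw[symmetric])
        (rule bij_betw_Union_orbits[OF \<tau> \<pi>(2) cut(1) self'(1) DE(1,3) self'(2) DE(2,4)])
    also have "\<dots> = (\<Sum>S\<in>Pow ?Q. \<Sum>i\<le>r. N i (add_mset k (image_mset card (mset_set S)))
             * N (r - i) (add_mset (card ?O - k) (image_mset card (mset_set (?Q - S)))))"
    proof (intro sum.cong refl arg_cong2[where f = "(*)"])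
      fix S i assume S: "S \<in> Pow ?Q" and i: "i \<in> {..r}"
      let ?B = "\<Union> (insert ?D S)"
      have B: "?B \<subseteq> A" "\<tau> ` ?B = ?B"
        using bij_betw_apply[OF bij_betw_Union_orbits[OF \<tau> \<pi>(2) cut(1) self'(1) DE(1,3) self'(2) DE(2,4)] S] by auto
      have AB: "\<tau> ` (A - ?B) = A - ?B"
        using B permutes_image[OF \<tau>] permutes_inj[OF \<tau>] by (simp add: image_set_diff)
      have orb: "orbit \<tau> ` ?B = insert ?D S"
        using S by (intro orbits_of_Union[OF p', of _ A]) (auto simp: cut(1))
      have orb': "orbit \<tau> ` (A - ?B) = insert ?E (?Q - S)"
      proof -
        have "orbit \<tau> ` (A - ?B) = orbit \<tau> ` A - orbit \<tau> ` ?B"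
        proof (intro equalityI subsetI)
          fix V assume "V \<in> orbit \<tau> ` A - orbit \<tau> ` ?B"
          then show "V \<in> orbit \<tau> ` (A - ?B)" by blast
        next
          fix V assume "V \<in> orbit \<tau> ` (A - ?B)"
          then obtain y where y: "V = orbit \<tau> y" "y \<in> A" "y \<notin> ?B" by blast
          have "V \<notin> insert ?D S"
            using y permutation_self_in_orbit[OF p', of y] by blast
          then show "V \<in> orbit \<tau> ` A - orbit \<tau> ` ?B" unfolding orb using y by blast
        qed
        also have "\<dots> = insert ?E (?Q - S)"
          unfolding orb cut(1) using S DE(5-7) by blast
        finally show ?thesis .
      qed
      have finB: "finite ?B" using B(1) \<pi>(2) by (rule finite_subset)
      have finS: "finite S" using S finQ by (auto intro: finite_subset)
      have "card (factorizations ?B UNIV i (perm_restrict \<tau> ?B)) = N i (cycle_lengths ?B (perm_restrict \<tau> ?B))"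
        using i finB by (intro N perm_restrict_permutes[OF \<tau> B(2)]) auto
      also have "cycle_lengths ?B (perm_restrict \<tau> ?B) = add_mset k (image_mset card (mset_set S))"
        unfolding cycle_lengths_perm_restrict[OF B(2)] orb
        using S DE(5) finS cut(4) by (subst mset_set.insert) auto
      finally show "card (factorizations ?B UNIV i (perm_restrict \<tau> ?B)) = N i (add_mset k (image_mset card (mset_set S)))" .
      have "card (factorizations (A - ?B) UNIV (r - i) (perm_restrict \<tau> (A - ?B)))
          = N (r - i) (cycle_lengths (A - ?B) (perm_restrict \<tau> (A - ?B)))"
        using \<pi>(2) by (intro N perm_restrict_permutes[OF \<tau> AB]) auto
      also have "cycle_lengths (A - ?B) (perm_restrict \<tau> (A - ?B)) = add_mset (card ?O - k) (image_mset card (mset_set (?Q - S)))"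
        unfolding cycle_lengths_perm_restrict[OF AB] orb'
        using DE(6) finQ cut(5) by (subst mset_set.insert) auto
      finally show "card (factorizations (A - ?B) UNIV (r - i) (perm_restrict \<tau> (A - ?B)))
          = N (r - i) (add_mset (card ?O - k) (image_mset card (mset_set (?Q - S))))" .
    qed
    finally show ?thesis unfolding ms s_def .
  qed
  have "card (factorizations A UNIV (Suc r) \<pi>) = (\<Sum>s\<in>A - {d}. ?f s)"
    by (rule card_factorizations_Suc[OF \<pi>(2) d])
  also have "\<dots> = (\<Sum>U\<in>?Q. \<Sum>s\<in>U. ?f s) + (\<Sum>k = 1..<card ?O. ?f ((\<pi> ^^ k) d))"
    by (rule sum_diff_orbit[OF \<pi> d])
  also have "(\<Sum>U\<in>?Q. \<Sum>s\<in>U. ?f s) =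
      (\<Sum>U\<in>?Q. \<Sum>s\<in>U. N r (add_mset (card ?O + card U) (image_mset card (mset_set (?Q - {U})))))"
    by (intro sum.cong refl join)
  also have "(\<Sum>k = 1..<card ?O. ?f ((\<pi> ^^ k) d)) = (\<Sum>k = 1..<card ?O. N r (add_mset k (add_mset (card ?O - k) (image_mset card (mset_set ?Q))))
        + (\<Sum>S\<in>Pow ?Q. \<Sum>i\<le>r. N i (add_mset k (image_mset card (mset_set S)))
             * N (r - i) (add_mset (card ?O - k) (image_mset card (mset_set (?Q - S))))))"
    by (intro sum.cong refl cut)
  finally show ?thesis by (simp add: join_cut_def)
qed

section \<open>Dependence on the cycle type\<close>

lemma sum_mset_cycle_lengths:
  assumes "\<pi> permutes A" "finite A"
  shows "sum_mset (cycle_lengths A \<pi>) = card A"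
proof -
  have p: "permutation \<pi>" using assms by (rule permutes_imp_permutation)
  have "card A = card (\<Union> (orbit \<pi> ` A))"
    using permutes_orbit_subset[OF assms(1)] permutation_self_in_orbit[OF p] by (intro arg_cong[of _ _ card]) blast
  also have "\<dots> = sum card (orbit \<pi> ` A)"
  proof (rule card_Union_disjoint)
    show "pairwise disjnt (orbit \<pi> ` A)"
      using orbit_disjoint[OF p] by (auto simp: pairwise_def disjnt_def)
    show "\<And>U. U \<in> orbit \<pi> ` A \<Longrightarrow> finite U"
      using finite_orbit[OF permutation_self_in_orbit[OF p]] by auto
  qed
  finally show ?thesis by (simp add: cycle_lengths_def sum_unfold_sum_mset)
qed

section \<open>Join-cut sums depend only on the multiset of cycle lengths\<close>

lemma image_mset_reindex:
  assumes "inj_on h S" "\<And>i. i \<in> S \<Longrightarrow> w i = v (h i)"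
  shows "image_mset w (mset_set S) = image_mset v (mset_set (h ` S))"
proof (cases "finite S")
  case True
  have "image_mset v (mset_set (h ` S)) = image_mset v (image_mset h (mset_set S))"
    using assms(1) by (simp add: image_mset_mset_set)
  also have "\<dots> = image_mset w (mset_set S)"
    using assms(2) True by (auto simp: multiset.map_comp intro!: image_mset_cong)
  finally show ?thesis ..
next
  case False
  then show ?thesis using finite_imageD[OF _ assms(1)] by (metis image_mset_empty mset_set.infinite)
qed

lemma join_cut_reindex:
  assumes h: "bij_betw h I J" and w: "\<And>i. i \<in> I \<Longrightarrow> w i = v (h i)"
  shows "join_cut N r a I w = join_cut N r a J v"
proof -
  have inj: "inj_on h I" and J: "J = h ` I" using h by (auto simp: bij_betw_def)
  have ms: "image_mset w (mset_set S) = image_mset v (mset_set (h ` S))" if "S \<subseteq> I" for S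
    using that inj_on_subset[OF inj that] w by (intro image_mset_reindex) auto
  have diff: "h ` (I - S) = J - h ` S" if "S \<subseteq> I" for S
    unfolding J using that inj by (intro inj_on_image_set_diff) auto
  have P: "bij_betw ((`) h) (Pow I) (Pow J)" using h by (rule bij_betw_Pow)
  have "(\<Sum>j\<in>I. w j * N r (add_mset (a + w j) (image_mset w (mset_set (I - {j}))))) =
      (\<Sum>j\<in>I. v (h j) * N r (add_mset (a + v (h j)) (image_mset v (mset_set (J - {h j})))))"
    using w ms[of "I - {j}" for j] diff[of "{j}" for j] by (intro sum.cong) auto
  also have "\<dots> = (\<Sum>j\<in>J. v j * N r (add_mset (a + v j) (image_mset v (mset_set (J - {j})))))"
    by (rule sum.reindex_bij_betw[OF h])
  finally have 1: "(\<Sum>j\<in>I. w j * N r (add_mset (a + w j) (image_mset w (mset_set (I - {j}))))) = \<dots>" .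
  have 2: "(\<Sum>S\<in>Pow I. \<Sum>i\<le>r. N i (add_mset k (image_mset w (mset_set S)))
             * N (r - i) (add_mset (a - k) (image_mset w (mset_set (I - S))))) =
      (\<Sum>S\<in>Pow J. \<Sum>i\<le>r. N i (add_mset k (image_mset v (mset_set S)))
             * N (r - i) (add_mset (a - k) (image_mset v (mset_set (J - S)))))" for k
  proof -
    have "(\<Sum>S\<in>Pow I. \<Sum>i\<le>r. N i (add_mset k (image_mset w (mset_set S)))
             * N (r - i) (add_mset (a - k) (image_mset w (mset_set (I - S))))) =
        (\<Sum>S\<in>Pow I. \<Sum>i\<le>r. N i (add_mset k (image_mset v (mset_set (h ` S))))
             * N (r - i) (add_mset (a - k) (image_mset v (mset_set (J - h ` S)))))"
      using ms ms[of "I - S" for S] diff by (intro sum.cong) auto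
    also have "\<dots> = (\<Sum>S\<in>Pow J. \<Sum>i\<le>r. N i (add_mset k (image_mset v (mset_set S)))
             * N (r - i) (add_mset (a - k) (image_mset v (mset_set (J - S)))))"
      by (rule sum.reindex_bij_betw[OF P])
    finally show ?thesis .
  qed
  have 3: "image_mset w (mset_set I) = image_mset v (mset_set J)" using ms[of I] J by simp
  show ?thesis unfolding join_cut_def 1 2 3 ..
qed

lemma image_mset_eq_imp_bij_betw:
  assumes "finite I" "finite J" "image_mset w (mset_set I) = image_mset v (mset_set J)"
  shows "\<exists>h. bij_betw h I J \<and> (\<forall>i\<in>I. w i = v (h i))"
  using assms
proof (induction I arbitrary: J rule: finite_induct)
  case empty
  then show ?case by (auto simp: mset_set_empty_iff bij_betw_def)
next
  case (insert i I)
  then have "w i \<in># image_mset v (mset_set J)" by (metis image_mset_add_mset mset_set.insert union_single_eq_member)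
  then obtain j where j: "j \<in> J" "w i = v j" using insert.prems by auto
  have "image_mset w (mset_set I) = image_mset v (mset_set (J - {j}))"
    using insert j by (simp add: mset_set.remove)
  then obtain h where h: "bij_betw h I (J - {j})" "\<forall>i\<in>I. w i = v (h i)"
    using insert.IH[of "J - {j}"] insert.prems by auto
  have "bij_betw (h(i := j)) (insert i I) (insert j (J - {j}))"
  proof -
    have "bij_betw (h(i := j)) I (J - {j}) \<longleftrightarrow> bij_betw h I (J - {j})"
      using insert.hyps(2) by (intro bij_betw_cong) auto
    with h(1) have "bij_betw (h(i := j)) I (J - {j})" by blast
    then have "bij_betw (h(i := j)) (I \<union> {i}) ((J - {j}) \<union> {j})"
      by (rule bij_betw_combine) (auto simp: bij_betw_def)
    then show ?thesis by simp
  qed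
  then have "bij_betw (h(i := j)) (insert i I) J" using j by (simp add: insert_absorb)
  moreover have "\<forall>i'\<in>insert i I. w i' = v ((h(i := j)) i')" using h(2) j insert.hyps(2) by auto
  ultimately show ?case by blast
qed

text \<open>Independence of the representative is not yet known, hence the choice. \<open>A\<close>
  is arbitrary because components of words live on arbitrary label sets. The value is unspecified if
  no permutation has type \<open>\<mu>\<close>, that is, if 0 is a part.\<close>

definition hurwitz_count :: "nat \<Rightarrow> nat multiset \<Rightarrow> nat" where
  "hurwitz_count r \<mu> = (SOME n. \<exists>A \<pi>. finite A \<and> \<pi> permutes A \<and> cycle_lengths A \<pi> = \<mu> \<and>
     n = card (factorizations A UNIV r \<pi>))"

lemma card_factorizations_0:
  assumes "finite A" "\<pi> permutes A"
  shows "card (factorizations A UNIV 0 \<pi>) = of_bool (card A \<le> 1)"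
proof (cases "card A \<le> 1")
  case True
  then have A: "A = {} \<or> (\<exists>a. A = {a})" using assms(1) card_1_singletonE by (metis card_0_eq le_neq_implies_less less_one)
  then have "\<pi> = id" using assms(2) by (auto simp: permutes_sing)
  then have "factorizations A UNIV 0 \<pi> = {[]}"
    using A by (auto simp: factorizations_def)
  then show ?thesis using True by simp
next
  case False
  then obtain x where x: "x \<in> A" by fastforce
  then have "{x} \<noteq> A" using False by auto
  then have "factorizations A UNIV 0 \<pi> = {}"
    using x by (auto simp: factorizations_def intro!: exI[of _ "{x}"])
  then show ?thesis using False by simp
qed

lemma cycle_lengths_remove_orbit:
  assumes "finite A" "d \<in> A"
  shows "cycle_lengths A \<pi> = add_mset (card (orbit \<pi> d)) (image_mset card (mset_set (orbit \<pi> ` A - {orbit \<pi> d})))"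
proof -
  have "mset_set (orbit \<pi> ` A) = add_mset (orbit \<pi> d) (mset_set (orbit \<pi> ` A - {orbit \<pi> d}))"
    using assms by (intro mset_set.remove) auto
  then show ?thesis by (simp add: cycle_lengths_def)
qed

text \<open>Centrality of the complete symmetric polynomials in the Jucys-Murphy elements: the recursion may be
  started at any element, so the counts for two permutations of the same type can be expanded along cycles of
  equal length.\<close>

lemma card_factorizations_eq_hurwitz_count:
  assumes "finite A" "\<pi> permutes A"
  shows "card (factorizations A UNIV r \<pi>) = hurwitz_count r (cycle_lengths A \<pi>)"
  using assms
proof (induction r arbitrary: A \<pi> rule: less_induct)
  case (less r)
  have eq: "card (factorizations A' UNIV r \<pi>') = card (factorizations A UNIV r \<pi>)"
    if A': "finite A'" "\<pi>' permutes A'" and cl: "cycle_lengths A' \<pi>' = cycle_lengths A \<pi>" for A' \<pi>'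
  proof (cases r)
    case 0
    have "card A' = card A"
      using sum_mset_cycle_lengths[OF A'(2,1)] sum_mset_cycle_lengths[OF less.prems(2,1)] cl by simp
    then show ?thesis unfolding 0 using A' less.prems by (simp add: card_factorizations_0)
  next
    case (Suc r')
    show ?thesis
    proof (cases "A = {}")
      case True
      then have "A' = {}"
        using sum_mset_cycle_lengths[OF A'(2,1)] sum_mset_cycle_lengths[OF less.prems(2,1)] cl A'(1) by simp
      then show ?thesis using True A'(2) less.prems(2) by simp
    next
      case False
      then obtain d where d: "d \<in> A" by blast
      have "card (orbit \<pi> d) \<in># cycle_lengths A' \<pi>'"
        unfolding cl cycle_lengths_remove_orbit[OF less.prems(1) d] by simp
      then obtain d' where d': "d' \<in> A'" "card (orbit \<pi>' d') = card (orbit \<pi> d)"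
        using A'(1) by (auto simp: cycle_lengths_def)
      have "image_mset card (mset_set (orbit \<pi>' ` A' - {orbit \<pi>' d'})) =
          image_mset card (mset_set (orbit \<pi> ` A - {orbit \<pi> d}))"
        using cl d'(2) cycle_lengths_remove_orbit[OF A'(1) d'(1), of \<pi>'] cycle_lengths_remove_orbit[OF less.prems(1) d, of \<pi>]
        by simp
      then obtain h where h: "bij_betw h (orbit \<pi>' ` A' - {orbit \<pi>' d'}) (orbit \<pi> ` A - {orbit \<pi> d})"
          "\<forall>U\<in>orbit \<pi>' ` A' - {orbit \<pi>' d'}. card U = card (h U)"
        using image_mset_eq_imp_bij_betw[of "orbit \<pi>' ` A' - {orbit \<pi>' d'}" "orbit \<pi> ` A - {orbit \<pi> d}" card card]
          A'(1) less.prems(1) by auto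
      have IH: "card (factorizations B UNIV i \<rho>) = hurwitz_count i (cycle_lengths B \<rho>)"
        if "i \<le> r'" "finite B" "\<rho> permutes B" for i B \<rho>
        using that Suc by (intro less.IH) auto
      have "card (factorizations A' UNIV (Suc r') \<pi>') =
          join_cut hurwitz_count r' (card (orbit \<pi> d)) (orbit \<pi>' ` A' - {orbit \<pi>' d'}) card"
        unfolding d'(2)[symmetric] using A' d'(1) by (intro card_factorizations_join_cut IH)
      also have "\<dots> = join_cut hurwitz_count r' (card (orbit \<pi> d)) (orbit \<pi> ` A - {orbit \<pi> d}) card"
        by (rule join_cut_reindex[OF h(1)]) (use h(2) in blast)
      also have "\<dots> = card (factorizations A UNIV (Suc r') \<pi>)"
        using less.prems d by (intro card_factorizations_join_cut[symmetric] IH)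
      finally show ?thesis unfolding Suc .
    qed
  qed
  have "\<exists>A' \<pi>'. finite A' \<and> \<pi>' permutes A' \<and> cycle_lengths A' \<pi>' = cycle_lengths A \<pi> \<and>
      hurwitz_count r (cycle_lengths A \<pi>) = card (factorizations A' UNIV r \<pi>')"
    unfolding hurwitz_count_def by (rule someI_ex) (use less.prems in blast)
  then show ?case using eq by metis
qed

text \<open>Induction removes one point \<open>x\<close>. A part 1 becomes the fixed point
  \<open>x\<close>; a larger part \<open>a\<close> comes from a cycle of length
  \<open>a - 1\<close>, into which the fixed point \<open>x\<close> is joined by a
  transposition.\<close>

lemma ex_permutation_of_type:
  assumes "finite A" "\<forall>a\<in>#\<mu>. 1 \<le> a" "sum_mset \<mu> = card A"
  shows "\<exists>\<pi>. \<pi> permutes A \<and> cycle_lengths A \<pi> = \<mu>"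
  using assms
proof (induction "card A" arbitrary: A \<mu>)
  case 0
  then have "A = {}" by simp
  moreover have "\<mu> = {#}"
  proof (rule ccontr)
    assume "\<mu> \<noteq> {#}"
    then obtain a where "a \<in># \<mu>" by blast
    moreover have "a = 0" using 0 \<open>a \<in># \<mu>\<close> by (metis sum_mset_0_iff)
    ultimately show False using 0 by auto
  qed
  ultimately show ?case by (auto simp: cycle_lengths_def intro!: exI[of _ id] permutes_id)
next
  case (Suc n)
  then obtain x where x: "x \<in> A" by (metis card.empty nat.distinct(1) ex_in_conv)
  have cA: "card (A - {x}) = n" "finite (A - {x})" using Suc x by auto
  have "\<mu> \<noteq> {#}" using Suc by auto
  then obtain a \<nu> where \<mu>: "\<mu> = add_mset a \<nu>" by (metis multiset_cases)
  have fixed: "\<pi> permutes A \<and> orbit \<pi> x = {x} \<and> orbit \<pi> ` A - {orbit \<pi> x} = orbit \<pi> ` (A - {x})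
      \<and> cycle_lengths A \<pi> = add_mset 1 (cycle_lengths (A - {x}) \<pi>)" if \<pi>: "\<pi> permutes A - {x}" for \<pi>
  proof -
    have p: "permutation \<pi>" using \<pi> cA(2) by (rule permutes_imp_permutation)
    have "\<pi> permutes A" using \<pi> by (rule permutes_subset) auto
    moreover have fx: "orbit \<pi> x = {x}"
      using permutes_not_in[OF \<pi>] by (simp add: orbit_eq_singleton_iff)
    moreover have im: "orbit \<pi> ` A - {orbit \<pi> x} = orbit \<pi> ` (A - {x})"
      using permutation_self_in_orbit[OF p] fx by (auto simp: set_eq_iff)
    ultimately show ?thesis
      using cycle_lengths_remove_orbit[OF Suc.prems(1) x, of \<pi>] by (simp add: cycle_lengths_def)
  qed
  show ?case
  proof (cases "a = 1")
    case True
    then have "\<exists>\<pi>. \<pi> permutes A - {x} \<and> cycle_lengths (A - {x}) \<pi> = \<nu>"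
      using Suc cA \<mu> by (intro Suc.hyps(1)) auto
    then show ?thesis using fixed \<mu> True by metis
  next
    case False
    then have a: "a \<ge> 2" using Suc.prems(2) \<mu> by force
    have "\<exists>\<pi>. \<pi> permutes A - {x} \<and> cycle_lengths (A - {x}) \<pi> = add_mset (a - 1) \<nu>"
      using Suc cA \<mu> a by (intro Suc.hyps(1)) auto
    then obtain \<pi> where \<pi>: "\<pi> permutes A - {x}" "cycle_lengths (A - {x}) \<pi> = add_mset (a - 1) \<nu>" by blast
    then have "a - 1 \<in># cycle_lengths (A - {x}) \<pi>" by simp
    then have "a - 1 \<in> card ` orbit \<pi> ` (A - {x})"
      unfolding cycle_lengths_def set_image_mset using cA(2) by (simp del: finite_Diff)
    then obtain s where s: "s \<in> A - {x}" "card (orbit \<pi> s) = a - 1" by (metis imageE)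
    note f = fixed[OF \<pi>(1)]
    have f1: "\<pi> permutes A" and f2: "orbit \<pi> x = {x}" and f3: "orbit \<pi> ` A - {orbit \<pi> x} = orbit \<pi> ` (A - {x})"
      using f by blast+
    have sx: "s \<notin> orbit \<pi> x" using s f2 by simp
    have "cycle_lengths A (transpose s x \<circ> \<pi>) =
        add_mset (1 + (a - 1)) (image_mset card (mset_set (orbit \<pi> ` (A - {x}) - {orbit \<pi> s})))"
      using cycle_lengths_join[OF f1 Suc.prems(1) x _ sx] s f2 unfolding f3 by simp
    also have "image_mset card (mset_set (orbit \<pi> ` (A - {x}) - {orbit \<pi> s})) = \<nu>"
      using cycle_lengths_remove_orbit[OF cA(2) s(1), of \<pi>] \<pi>(2) s(2) by simp
    finally have cl: "cycle_lengths A (transpose s x \<circ> \<pi>) = add_mset (1 + (a - 1)) \<nu>" .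
    have "cycle_lengths A (transpose s x \<circ> \<pi>) = \<mu>" unfolding cl \<mu> using a by simp
    moreover have "transpose s x \<circ> \<pi> permutes A"
      using f1 s x by (intro permutes_compose permutes_swap_id) auto
    ultimately show ?thesis by blast
  qed
qed

text \<open>Positivity of the parts provides a permutation of this type, which ties the chosen value
  to an actual count; its cycles are then relabelled by \<open>I\<close>.\<close>

lemma hurwitz_count_Suc:
  assumes "finite I" "1 \<le> a" "\<forall>i\<in>I. 1 \<le> w i"
  shows "hurwitz_count (Suc r) (add_mset a (image_mset w (mset_set I))) = join_cut hurwitz_count r a I w"
proof -
  let ?\<mu> = "add_mset a (image_mset w (mset_set I))"
  have "\<exists>\<pi>. \<pi> permutes {1..sum_mset ?\<mu>} \<and> cycle_lengths {1..sum_mset ?\<mu>} \<pi> = ?\<mu>"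
    using assms by (intro ex_permutation_of_type) auto
  then obtain A \<pi> where A: "finite A" "\<pi> permutes A" "cycle_lengths A \<pi> = ?\<mu>" by blast
  then have "a \<in># cycle_lengths A \<pi>" by simp
  then obtain d where d: "d \<in> A" "card (orbit \<pi> d) = a" using A(1) by (auto simp: cycle_lengths_def)
  have "image_mset card (mset_set (orbit \<pi> ` A - {orbit \<pi> d})) = image_mset w (mset_set I)"
    using cycle_lengths_remove_orbit[OF A(1) d(1), of \<pi>] A(3) d(2) by simp
  then obtain h where h: "bij_betw h (orbit \<pi> ` A - {orbit \<pi> d}) I" "\<forall>U\<in>orbit \<pi> ` A - {orbit \<pi> d}. card U = w (h U)"
    using image_mset_eq_imp_bij_betw[of "orbit \<pi> ` A - {orbit \<pi> d}" I card w] A(1) assms(1) by auto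
  have "hurwitz_count (Suc r) ?\<mu> = card (factorizations A UNIV (Suc r) \<pi>)"
    using card_factorizations_eq_hurwitz_count[OF A(1,2), of "Suc r"] A(3) by simp
  also have "\<dots> = join_cut hurwitz_count r a (orbit \<pi> ` A - {orbit \<pi> d}) card"
    using card_factorizations_join_cut[where N = hurwitz_count, OF card_factorizations_eq_hurwitz_count A(2,1) d(1)] d(2)
    by blast
  also have "\<dots> = join_cut hurwitz_count r a I w"
    by (rule join_cut_reindex[OF h(1)]) (use h(2) in blast)
  finally show ?thesis .
qed

lemma hurwitz_count_0:
  assumes "\<forall>a\<in>#\<mu>. 1 \<le> a"
  shows "hurwitz_count 0 \<mu> = of_bool (sum_mset \<mu> \<le> 1)"
proof -
  obtain \<pi> where \<pi>: "\<pi> permutes {1..sum_mset \<mu>}" "cycle_lengths {1..sum_mset \<mu>} \<pi> = \<mu>"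
    using ex_permutation_of_type[of "{1..sum_mset \<mu>}" \<mu>] assms by auto
  then show ?thesis
    using card_factorizations_eq_hurwitz_count[OF _ \<pi>(1), of 0] card_factorizations_0[OF _ \<pi>(1)] by simp
qed

section \<open>Genus\<close>

text \<open>The recursion removes single cycles and forms subsets of them, so equal parts have to be
  told apart by labels.\<close>

lemma ex_indexed_multiset:
  "\<exists>(I :: nat set) w. finite I \<and> \<nu> = image_mset w (mset_set I)"
proof -
  obtain xs where "mset xs = \<nu>" using ex_mset by blast
  then have "\<nu> = image_mset ((!) xs) (mset_set {..<length xs})"
    by (metis lessThan_atLeast0 map_nth mset_map mset_upt)
  then show ?thesis by blast
qed

lemma join_cut_eq_0_iff:
  assumes "finite I"
  shows "join_cut N r a I w = 0 \<longleftrightarrow>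
     (\<forall>j\<in>I. w j * N r (add_mset (a + w j) (image_mset w (mset_set (I - {j})))) = 0)
   \<and> (\<forall>k\<in>{1..<a}. N r (add_mset k (add_mset (a - k) (image_mset w (mset_set I)))) = 0
        \<and> (\<forall>S\<subseteq>I. \<forall>i\<le>r. N i (add_mset k (image_mset w (mset_set S)))
             * N (r - i) (add_mset (a - k) (image_mset w (mset_set (I - S)))) = 0))"
  using assms by (simp add: join_cut_def Ball_def)

text \<open>The Riemann-Hurwitz formula; it discards all terms of the recursion without a genus.\<close>

lemma hurwitz_count_genus:
  assumes "hurwitz_count r \<mu> \<noteq> 0" "\<forall>a\<in>#\<mu>. 1 \<le> a" "\<mu> \<noteq> {#}"
  shows "\<exists>g. r + 2 = 2 * g + size \<mu> + sum_mset \<mu>"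
  using assms
proof (induction r arbitrary: \<mu> rule: less_induct)
  case (less r)
  obtain a \<nu> where \<mu>: "\<mu> = add_mset a \<nu>" using less.prems(3) by (metis multiset_cases)
  obtain I :: "nat set" and w where I: "finite I" "\<nu> = image_mset w (mset_set I)"
    using ex_indexed_multiset by blast
  have pos: "1 \<le> a" "\<forall>i\<in>I. 1 \<le> w i" using less.prems(2) \<mu> I by auto
  have sw: "sum_mset (image_mset w (mset_set S)) = sum w S" for S
    by (simp add: sum_unfold_sum_mset)
  have remove: "card I = Suc (card (I - {j}))" "sum w I = w j + sum w (I - {j})" if "j \<in> I" for j
    by (rule card.remove[OF I(1) that] sum.remove[OF I(1) that])+
  have split: "card I = card S + card (I - S)" "sum w I = sum w S + sum w (I - S)" if "S \<subseteq> I" for S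
    using that I(1) by (simp_all add: sum.subset_diff card_mono finite_subset card_Diff_subset)
  show ?case
  proof (cases r)
    case 0
    then have le: "a + sum_mset \<nu> \<le> 1" using less.prems hurwitz_count_0[of \<mu>] \<mu> by auto
    then have a1: "a = 1" and s0: "sum_mset \<nu> = 0" using pos(1) by linarith+
    then have "sum w I = 0" using sw I(2) by simp
    then have "I = {}" using pos(2) I(1) by (auto simp: sum_eq_0_iff)
    then show ?thesis using 0 a1 I(2) \<mu> by simp
  next
    case (Suc r')
    have step: "\<exists>g. r' + 2 = 2 * g + size \<kappa> + sum_mset \<kappa>"
      if "hurwitz_count r' \<kappa> \<noteq> 0" "\<forall>a\<in>#\<kappa>. 1 \<le> a" "\<kappa> \<noteq> {#}" for \<kappa>
      using less.IH[of r' \<kappa>] that Suc by simp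
    have "join_cut hurwitz_count r' a I w \<noteq> 0"
      using less.prems(1) hurwitz_count_Suc[OF I(1) pos] unfolding \<mu> I(2) Suc by simp
    \<comment> \<open>Some term of the recursion is nonzero. One letter is lost each time: a join
      has one part less and the same genus, a connected cut has one part more and genus one less,
      and in a disconnecting cut the two genera add up.\<close>
    then consider
        j where "j \<in> I" "hurwitz_count r' (add_mset (a + w j) (image_mset w (mset_set (I - {j})))) \<noteq> 0"
      | k where "k \<in> {1..<a}" "hurwitz_count r' (add_mset k (add_mset (a - k) (image_mset w (mset_set I)))) \<noteq> 0"
      | k S i where "k \<in> {1..<a}" "S \<subseteq> I" "i \<le> r'"
          "hurwitz_count i (add_mset k (image_mset w (mset_set S))) \<noteq> 0"
          "hurwitz_count (r' - i) (add_mset (a - k) (image_mset w (mset_set (I - S)))) \<noteq> 0"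
      unfolding join_cut_eq_0_iff[OF I(1)] mult_eq_0_iff by blast
    then show ?thesis
    proof cases
      case (1 j)
      have "\<exists>g. r' + 2 = 2 * g + Suc (card (I - {j})) + (a + w j + sum w (I - {j}))"
        using step[OF 1(2)] pos I(1) by (auto simp: sw)
      then obtain g where "r' + 2 = 2 * g + Suc (card (I - {j})) + (a + w j + sum w (I - {j}))" ..
      then show ?thesis using remove[OF 1(1)] by (intro exI[of _ g]) (simp add: Suc \<mu> I(2) sw)
    next
      case (2 k)
      have "\<exists>g. r' + 2 = 2 * g + Suc (Suc (card I)) + (k + (a - k + sum w I))"
        using step[OF 2(2)] pos I(1) 2(1) by (auto simp: sw)
      then obtain g where "r' + 2 = 2 * g + Suc (Suc (card I)) + (k + (a - k + sum w I))" ..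
      then show ?thesis using 2(1) by (intro exI[of _ "Suc g"]) (simp add: Suc \<mu> I(2) sw)
    next
      case (3 k S i)
      have "\<exists>g. i + 2 = 2 * g + Suc (card S) + (k + sum w S)"
        using less.IH[of i "add_mset k (image_mset w (mset_set S))"] 3 Suc pos I(1) finite_subset[OF 3(2) I(1)]
        by (auto simp: sw)
      moreover have "\<exists>g. r' - i + 2 = 2 * g + Suc (card (I - S)) + (a - k + sum w (I - S))"
        using less.IH[of "r' - i" "add_mset (a - k) (image_mset w (mset_set (I - S)))"] 3 Suc pos I(1)
        by (auto simp: sw)
      ultimately obtain g1 g2 where "i + 2 = 2 * g1 + Suc (card S) + (k + sum w S)"
        "r' - i + 2 = 2 * g2 + Suc (card (I - S)) + (a - k + sum w (I - S))" by blast
      then show ?thesis using 3(1,3) split[OF 3(2)]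
        by (intro exI[of _ "g1 + g2"]) (simp add: Suc \<mu> I(2) sw)
    qed
  qed
qed

text \<open>The permutation of type \<open>\<mu>\<close> is fixed here, so this is the quotient of
  the monotone Hurwitz number by the size of the conjugacy class, see
  \<open>monotone_hurwitz_ratio\<close>.\<close>

definition genus_count :: "nat \<Rightarrow> nat multiset \<Rightarrow> nat" where
  "genus_count g \<mu> = hurwitz_count (2 * g + size \<mu> + sum_mset \<mu> - 2) \<mu>"

text \<open>By \<open>hurwitz_count_genus\<close> only lengths \<open>i\<close> of the form
  \<open>?f h\<close> contribute. The 4 in the hypothesis collects the shift by 2 of each of the two
  components.\<close>

lemma genus_count_convolution:
  assumes \<mu>: "\<forall>a\<in>#\<mu>. 1 \<le> a" "\<mu> \<noteq> {#}" and \<nu>: "\<forall>a\<in>#\<nu>. 1 \<le> a" "\<nu> \<noteq> {#}"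
    and r: "r + 4 = 2 * g + size \<mu> + sum_mset \<mu> + (size \<nu> + sum_mset \<nu>)"
  shows "(\<Sum>i\<le>r. hurwitz_count i \<mu> * hurwitz_count (r - i) \<nu>) = (\<Sum>h\<le>g. genus_count h \<mu> * genus_count (g - h) \<nu>)"
proof -
  have two: "2 \<le> size \<kappa> + sum_mset \<kappa>" if \<kappa>: "\<forall>a\<in>#\<kappa>. 1 \<le> a" "\<kappa> \<noteq> {#}" for \<kappa> :: "nat multiset"
  proof -
    obtain a \<kappa>' where "\<kappa> = add_mset a \<kappa>'" using \<kappa>(2) by (metis multiset_cases)
    then show ?thesis using \<kappa>(1) by simp
  qed
  let ?f = "\<lambda>h. 2 * h + size \<mu> + sum_mset \<mu> - 2"
  note tm = two[OF \<mu>] and tn = two[OF \<nu>]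
  have "(\<Sum>i\<le>r. hurwitz_count i \<mu> * hurwitz_count (r - i) \<nu>) =
      (\<Sum>i\<in>?f ` {..g}. hurwitz_count i \<mu> * hurwitz_count (r - i) \<nu>)"
  proof (rule sum.mono_neutral_right)
    show "?f ` {..g} \<subseteq> {..r}" using r tn by auto
    show "\<forall>i\<in>{..r} - ?f ` {..g}. hurwitz_count i \<mu> * hurwitz_count (r - i) \<nu> = 0"
    proof (intro ballI, rule ccontr)
      fix i assume i: "i \<in> {..r} - ?f ` {..g}" and nz: "hurwitz_count i \<mu> * hurwitz_count (r - i) \<nu> \<noteq> 0"
      obtain h where h: "i + 2 = 2 * h + size \<mu> + sum_mset \<mu>" using hurwitz_count_genus[OF _ \<mu>] nz by force
      moreover obtain h' where "r - i + 2 = 2 * h' + size \<nu> + sum_mset \<nu>" using hurwitz_count_genus[OF _ \<nu>] nz by force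
      ultimately have "h \<le> g" using r i by auto
      moreover have "i = ?f h" using h by simp
      ultimately show False using i by blast
    qed
  qed simp
  also have "\<dots> = (\<Sum>h\<le>g. hurwitz_count (?f h) \<mu> * hurwitz_count (r - ?f h) \<nu>)"
    using tm by (subst sum.reindex) (auto simp: inj_on_def)
  also have "\<dots> = (\<Sum>h\<le>g. genus_count h \<mu> * genus_count (g - h) \<nu>)"
  proof (rule sum.cong)
    fix h assume "h \<in> {..g}"
    then have "r - ?f h = 2 * (g - h) + size \<nu> + sum_mset \<nu> - 2" using r tm tn by auto
    then show "hurwitz_count (?f h) \<mu> * hurwitz_count (r - ?f h) \<nu> = genus_count h \<mu> * genus_count (g - h) \<nu>"
      by (simp add: genus_count_def)
  qed simp
  finally show ?thesis .
qed

lemma genus_count_rec: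
  assumes "finite I" "1 \<le> a" "\<forall>i\<in>I. 1 \<le> w i"
  shows "genus_count g (add_mset a (image_mset w (mset_set I))) =
      of_bool (g = 0 \<and> I = {} \<and> a = 1)
    + (\<Sum>k = 1..<a. if g = 0 then 0 else genus_count (g - 1) (add_mset k (add_mset (a - k) (image_mset w (mset_set I)))))
    + (\<Sum>j\<in>I. w j * genus_count g (add_mset (a + w j) (image_mset w (mset_set (I - {j})))))
    + (\<Sum>k = 1..<a. \<Sum>S\<in>Pow I. \<Sum>h\<le>g. genus_count h (add_mset k (image_mset w (mset_set S)))
        * genus_count (g - h) (add_mset (a - k) (image_mset w (mset_set (I - S)))))"
proof -
  have sw: "sum_mset (image_mset w (mset_set S)) = sum w S" for S
    by (simp add: sum_unfold_sum_mset)
  have remove: "card I = Suc (card (I - {j}))" "sum w I = w j + sum w (I - {j})" if "j \<in> I" for j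
    by (rule card.remove[OF assms(1) that] sum.remove[OF assms(1) that])+
  have split: "card I = card S + card (I - S)" "sum w I = sum w S + sum w (I - S)" if "S \<subseteq> I" for S
    using that assms(1) by (simp_all add: sum.subset_diff card_mono finite_subset card_Diff_subset)
  let ?r = "2 * g + Suc (card I) + (a + sum w I) - 2"
  have G: "genus_count g (add_mset a (image_mset w (mset_set I))) = hurwitz_count ?r (add_mset a (image_mset w (mset_set I)))"
    by (simp add: genus_count_def sw)
  show ?thesis
  \<comment> \<open>Length 0 forces genus 0 and a single part 1; this is the Kronecker delta, and
    every sum in the recursion is then empty.\<close>
  proof (cases ?r)
    case 0
    then have "g = 0" "card I = 0" "a = 1" using assms(2) by auto
    moreover from this have "I = {}" using assms(1) by simp
    ultimately show ?thesis unfolding G 0 by (simp add: hurwitz_count_0)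
  next
    case (Suc r)
    have triv: "\<not> (g = 0 \<and> I = {} \<and> a = 1)" using Suc by auto
    have join: "hurwitz_count r (add_mset (a + w j) (image_mset w (mset_set (I - {j})))) =
        genus_count g (add_mset (a + w j) (image_mset w (mset_set (I - {j}))))" if "j \<in> I" for j
    proof -
      have "2 * g + Suc (card (I - {j})) + (a + w j + sum w (I - {j})) - 2 = r"
        using Suc remove[OF that] by simp
      then show ?thesis by (simp add: genus_count_def sw)
    qed
    have cut: "hurwitz_count r (add_mset k (add_mset (a - k) (image_mset w (mset_set I)))) =
        (if g = 0 then 0 else genus_count (g - 1) (add_mset k (add_mset (a - k) (image_mset w (mset_set I)))))"
      if k: "k \<in> {1..<a}" for k
    proof (cases "g = 0")
      case True
      \<comment> \<open>In genus 0 a connected cut would need genus -1.\<close>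
      have "hurwitz_count r (add_mset k (add_mset (a - k) (image_mset w (mset_set I)))) = 0"
      proof (rule ccontr)
        assume nz: "hurwitz_count r (add_mset k (add_mset (a - k) (image_mset w (mset_set I)))) \<noteq> 0"
        have "\<exists>h. r + 2 = 2 * h + Suc (Suc (card I)) + (k + (a - k + sum w I))"
          using hurwitz_count_genus[OF nz] assms k by (auto simp: sw)
        then show False using Suc True k by auto
      qed
      then show ?thesis using True by simp
    next
      case False
      then have "2 * (g - 1) + Suc (Suc (card I)) + (k + (a - k + sum w I)) - 2 = r"
        using Suc k by auto
      then show ?thesis using False by (simp add: genus_count_def sw)
    qed
    have split_cut: "(\<Sum>i\<le>r. hurwitz_count i (add_mset k (image_mset w (mset_set S)))
             * hurwitz_count (r - i) (add_mset (a - k) (image_mset w (mset_set (I - S))))) =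
        (\<Sum>h\<le>g. genus_count h (add_mset k (image_mset w (mset_set S)))
        * genus_count (g - h) (add_mset (a - k) (image_mset w (mset_set (I - S)))))"
      if k: "k \<in> {1..<a}" and S: "S \<in> Pow I" for k S
    proof (rule genus_count_convolution)
      show "r + 4 = 2 * g + size (add_mset k (image_mset w (mset_set S))) + sum_mset (add_mset k (image_mset w (mset_set S))) +
         (size (add_mset (a - k) (image_mset w (mset_set (I - S)))) + sum_mset (add_mset (a - k) (image_mset w (mset_set (I - S)))))"
        using Suc k split[of S] S by (simp add: sw)
    qed (use assms k S finite_subset[of S I] in auto)
    have "genus_count g (add_mset a (image_mset w (mset_set I))) = join_cut hurwitz_count r a I w"
      unfolding G Suc by (rule hurwitz_count_Suc[OF assms])
    also have "\<dots> = (\<Sum>j\<in>I. w j * genus_count g (add_mset (a + w j) (image_mset w (mset_set (I - {j})))))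
      + (\<Sum>k = 1..<a. (if g = 0 then 0 else genus_count (g - 1) (add_mset k (add_mset (a - k) (image_mset w (mset_set I)))))
        + (\<Sum>S\<in>Pow I. \<Sum>h\<le>g. genus_count h (add_mset k (image_mset w (mset_set S)))
        * genus_count (g - h) (add_mset (a - k) (image_mset w (mset_set (I - S))))))"
      by (simp only: join_cut_def join cut split_cut cong: sum.cong)
    finally show ?thesis using triv by (simp add: sum.distrib)
  qed
qed

section \<open>Monotone Hurwitz numbers as counts of words\<close>

text \<open>\<open>monotone_factorizations\<close> has \<open>\<sigma>\<close> on the left of the
  product, \<open>factorizations\<close> has it on the right.\<close>

lemma comp_eq_id_commute:
  assumes "bij \<sigma>"
  shows "\<sigma> \<circ> f = id \<longleftrightarrow> f \<circ> \<sigma> = id"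
proof
  assume "\<sigma> \<circ> f = id"
  then have "inv' \<sigma> \<circ> (\<sigma> \<circ> f) = inv' \<sigma>" by simp
  then have "f = inv' \<sigma>" using assms by (simp add: comp_assoc[symmetric] bij_is_inj)
  then show "f \<circ> \<sigma> = id" using assms by (simp add: bij_is_inj)
next
  assume "f \<circ> \<sigma> = id"
  then have "(f \<circ> \<sigma>) \<circ> inv' \<sigma> = inv' \<sigma>" by simp
  moreover have surj: "\<sigma> \<circ> inv' \<sigma> = id" using bij_is_surj[OF assms] by (simp only: surj_iff)
  ultimately have "f = inv' \<sigma>" by (simp add: comp_assoc)
  then show "\<sigma> \<circ> f = id" using surj by simp
qed

text \<open>The requirement s < t makes the pair recoverable from its transposition, so counting
  pairs and counting transpositions agree.\<close>

lemma transposition_list_inj: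
  assumes "\<forall>(s, t)\<in>set st. s < (t :: nat)" "\<forall>(s, t)\<in>set st'. s < t"
    and "map (\<lambda>(s, t). transpose s t) st = map (\<lambda>(s, t). transpose s t) st'"
  shows "st = st'"
proof -
  have "p = q" if "(\<lambda>(s, t). transpose s t) p = (\<lambda>(s, t). transpose s t) q"
    "case p of (s, t) \<Rightarrow> s < (t :: nat)" "case q of (s, t) \<Rightarrow> s < t" for p q
  proof -
    obtain a b c d where pq: "p = (a, b)" "q = (c, d)" by (cases p; cases q)
    have e: "transpose a b x = transpose c d x" for x using that(1) pq by simp
    have "a < b" "c < d" using that pq by auto
    then show ?thesis using e[of a] e[of b] e[of c] unfolding pq by (auto simp: transpose_def split: if_splits)
  qed
  then have "inj_on (\<lambda>(s, t). transpose s t) (set st \<union> set st')"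
    using assms(1,2) by (intro inj_onI) blast
  then show ?thesis using assms(3) by (rule map_inj_on[rotated])
qed

text \<open>As \<open>\<sigma>\<close> is inverse to the product of the word, it preserves every
  closed set and merges no components. Conversely, the group orbit of a point is closed.\<close>

lemma transitive_iff_connected:
  assumes \<sigma>: "\<sigma> permutes {1..d}" and st: "st \<in> mono_words {1..d} r" and prod: "word_prod st \<circ> \<sigma> = id"
  shows "(\<forall>x\<in>{1..d}. \<forall>y\<in>{1..d}. \<exists>\<pi>\<in>generate (sym_group d) (insert \<sigma> (set (map (\<lambda>(s, t). transpose s t) st))). \<pi> x = y)
    \<longleftrightarrow> (\<forall>B\<subseteq>{1..d}. closed_under B st \<longrightarrow> B = {} \<or> B = {1..d})"
    (is "(\<forall>x\<in>?A. \<forall>y\<in>?A. \<exists>\<pi>\<in>generate ?G ?H. \<pi> x = y) \<longleftrightarrow> ?conn")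
proof
  assume trans: "\<forall>x\<in>?A. \<forall>y\<in>?A. \<exists>\<pi>\<in>generate ?G ?H. \<pi> x = y"
  show ?conn
  proof (intro allI impI)
    fix B assume B: "B \<subseteq> ?A" "closed_under B st"
    have inv_H: "h y \<in> B \<longleftrightarrow> y \<in> B" if "h \<in> ?H" for h y
    proof -
      have "\<sigma> y \<in> B \<longleftrightarrow> y \<in> B"
        using word_prod_in_closed_iff[OF B(2), of "\<sigma> y"] fun_cong[OF prod, of y] by simp
      moreover have "transpose s t y \<in> B \<longleftrightarrow> y \<in> B" if "(s, t) \<in> set st" for s t
        using that B(2) by (cases "y = s"; cases "y = t") (auto simp: closed_under_def)
      ultimately show ?thesis using that by auto
    qed
    have H_perm: "h permutes ?A" if "h \<in> ?H" for h
      using that \<sigma> st by (fastforce simp: mono_words_def intro: permutes_swap_id)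
    have inv_gen: "\<pi> y \<in> B \<longleftrightarrow> y \<in> B" if "\<pi> \<in> generate ?G ?H" for \<pi> y
      using that
    proof (induction arbitrary: y rule: generate.induct)
      case one
      then show ?case by (simp add: sym_group_one)
    next
      case (incl h)
      then show ?case by (rule inv_H)
    next
      case (inv h)
      have h: "h permutes ?A" using H_perm[OF inv] .
      then have "inv\<^bsub>?G\<^esub> h = inv' h" by (simp add: sym_group_inv_equality sym_group_carrier)
      then show ?case using inv_H[OF inv, of "inv' h y"] permutes_inverses(1)[OF h] by simp
    next
      case (eng h1 h2)
      then show ?case by (simp add: sym_group_mult)
    qed
    show "B = {} \<or> B = ?A"
    proof (rule disjCI)
      assume "B \<noteq> ?A"
      then obtain y where y: "y \<in> ?A" "y \<notin> B" using B(1) by blast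
      show "B = {}"
      proof (rule equals0I)
        fix x assume "x \<in> B"
        then obtain \<pi> where "\<pi> \<in> generate ?G ?H" "\<pi> x = y" using trans B(1) y(1) by blast
        then show False using inv_gen[of \<pi> x] \<open>x \<in> B\<close> y(2) by simp
      qed
    qed
  qed
next
  assume conn: ?conn
  show "\<forall>x\<in>?A. \<forall>y\<in>?A. \<exists>\<pi>\<in>generate ?G ?H. \<pi> x = y"
  proof
    fix x assume x: "x \<in> ?A"
    define B where "B = {y \<in> ?A. \<exists>\<pi>\<in>generate ?G ?H. \<pi> x = y}"
    have "id \<in> generate ?G ?H" using generate.one[of ?G ?H] by (simp add: sym_group_one)
    moreover have "id x = x" by simp
    ultimately have "x \<in> B" using x unfolding B_def by blast
    have step: "t \<in> B" if "(s, t) \<in> set st \<or> (t, s) \<in> set st" "s \<in> B" for s t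
    proof -
      obtain \<pi> where \<pi>: "\<pi> \<in> generate ?G ?H" "\<pi> x = s" using \<open>s \<in> B\<close> by (auto simp: B_def)
      have "transpose s t \<in> ?H" using that(1) by (force simp: transpose_commute)
      then have "transpose s t \<circ> \<pi> \<in> generate ?G ?H"
        using generate.eng[OF generate.incl \<pi>(1)] by (simp add: sym_group_mult)
      moreover have "(transpose s t \<circ> \<pi>) x = t" using \<pi>(2) by simp
      moreover have "t \<in> ?A" using that(1) st by (fastforce simp: mono_words_def)
      ultimately show ?thesis unfolding B_def by blast
    qed
    have "closed_under B st" unfolding closed_under_def using step by blast
    moreover have "B \<subseteq> ?A" by (auto simp: B_def)
    ultimately have "B = ?A" using conn \<open>x \<in> B\<close> by blast
    then show "\<forall>y\<in>?A. \<exists>\<pi>\<in>generate ?G ?H. \<pi> x = y" by (auto simp: B_def)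
  qed
qed

lemma monotone_factorizations_eq:
  "monotone_factorizations g \<alpha> = (\<lambda>(\<sigma>, st). (\<sigma>, map (\<lambda>(s, t). transpose s t) st)) `
    (SIGMA \<sigma>:perms_of_type \<alpha>. factorizations {1..sum_list \<alpha>} UNIV (2 * g + length \<alpha> + sum_list \<alpha> - 2) \<sigma>)"
    (is "_ = ?T ` (SIGMA \<sigma>:_. factorizations ?A UNIV ?r \<sigma>)")
proof (intro equalityI subrelI)
  fix \<sigma> \<tau>s assume *: "(\<sigma>, \<tau>s) \<in> monotone_factorizations g \<alpha>"
  then obtain st where st: "\<forall>(s, t)\<in>set st. 1 \<le> s \<and> s < t \<and> t \<le> sum_list \<alpha>"
      "\<tau>s = map (\<lambda>(s, t). transpose s t) st" "sorted (map snd st)"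
    unfolding monotone_factorizations_def by (auto simp: Let_def)
  have len: "length \<tau>s = ?r" and \<sigma>: "\<sigma> \<in> perms_of_type \<alpha>" and id: "foldr (\<circ>) (\<sigma> # \<tau>s) id = id"
    and tr: "\<forall>x\<in>?A. \<forall>y\<in>?A. \<exists>\<pi>\<in>generate (sym_group (sum_list \<alpha>)) (insert \<sigma> (set \<tau>s)). \<pi> x = y"
    using * unfolding monotone_factorizations_def Let_def by blast+
  have p: "\<sigma> permutes ?A" using \<sigma> by (simp add: perms_of_type_def)
  have mw: "st \<in> mono_words ?A ?r" using st len by (fastforce simp: mono_words_def)
  have "\<sigma> \<circ> word_prod st = id" using id st(2) by (simp add: word_prod_def)
  then have prod: "word_prod st \<circ> \<sigma> = id" using comp_eq_id_commute[OF permutes_bij[OF p]] by blast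
  have "\<forall>B\<subseteq>?A. closed_under B st \<longrightarrow> B = {} \<or> B = ?A"
    using transitive_iff_connected[OF p mw prod] tr st(2) by blast
  then have "st \<in> factorizations ?A UNIV ?r \<sigma>" using mw prod by (simp add: factorizations_def)
  then show "(\<sigma>, \<tau>s) \<in> ?T ` (SIGMA \<sigma>:perms_of_type \<alpha>. factorizations ?A UNIV ?r \<sigma>)"
    using \<sigma> st(2) by (intro image_eqI[of _ _ "(\<sigma>, st)"]) auto
next
  fix \<sigma> \<tau>s assume "(\<sigma>, \<tau>s) \<in> ?T ` (SIGMA \<sigma>:perms_of_type \<alpha>. factorizations ?A UNIV ?r \<sigma>)"
  then obtain st where \<sigma>: "\<sigma> \<in> perms_of_type \<alpha>" and st: "st \<in> factorizations ?A UNIV ?r \<sigma>"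
    and \<tau>s: "\<tau>s = map (\<lambda>(s, t). transpose s t) st" by auto
  have p: "\<sigma> permutes ?A" using \<sigma> by (simp add: perms_of_type_def)
  have mw: "st \<in> mono_words ?A ?r" and prod: "word_prod st \<circ> \<sigma> = id"
    and conn: "\<forall>B\<subseteq>?A. closed_under B st \<longrightarrow> B = {} \<or> B = ?A"
    using st by (simp_all add: factorizations_def)
  have "\<sigma> \<circ> word_prod st = id" using comp_eq_id_commute[OF permutes_bij[OF p]] prod by blast
  then have "foldr (\<circ>) (\<sigma> # \<tau>s) id = id" by (simp add: word_prod_def \<tau>s)
  moreover have "\<forall>x\<in>?A. \<forall>y\<in>?A. \<exists>\<pi>\<in>generate (sym_group (sum_list \<alpha>)) (insert \<sigma> (set \<tau>s)). \<pi> x = y"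
    unfolding \<tau>s using transitive_iff_connected[OF p mw prod] conn by blast
  moreover have "length \<tau>s = ?r" using mw by (simp add: mono_words_def \<tau>s)
  moreover have "\<forall>(s, t)\<in>set st. 1 \<le> s \<and> s < t \<and> t \<le> sum_list \<alpha>" "sorted (map snd st)"
    using mw by (auto simp: mono_words_def)
  ultimately show "(\<sigma>, \<tau>s) \<in> monotone_factorizations g \<alpha>"
    unfolding monotone_factorizations_def Let_def using \<sigma> \<tau>s by blast
qed

text \<open>All \<open>\<sigma>\<close> of type \<open>\<alpha>\<close> admit equally many words, so
  the size of the class cancels; it is nonzero by \<open>ex_permutation_of_type\<close>.\<close>

lemma monotone_hurwitz_ratio:
  assumes "\<alpha> \<noteq> []" "\<forall>a\<in>set \<alpha>. a \<ge> 1"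
  shows "of_nat (monotone_hurwitz g \<alpha>) / of_nat (card (perms_of_type \<alpha>)) = (of_nat (genus_count g (mset \<alpha>)) :: rat)"
proof -
  let ?A = "{1..sum_list \<alpha>}" and ?r = "2 * g + length \<alpha> + sum_list \<alpha> - 2"
  have "\<exists>\<pi>. \<pi> permutes ?A \<and> cycle_lengths ?A \<pi> = mset \<alpha>"
    using assms by (intro ex_permutation_of_type) (auto simp: sum_mset_sum_list)
  then have ne: "perms_of_type \<alpha> \<noteq> {}" by (auto simp: perms_of_type_def)
  have fin: "finite (perms_of_type \<alpha>)"
    using finite_permutations[of ?A] by (auto simp: perms_of_type_def intro: finite_subset[rotated])
  have "inj_on (\<lambda>(\<sigma>, st). (\<sigma>, map (\<lambda>(s, t). transpose s t) st))
      (SIGMA \<sigma>:perms_of_type \<alpha>. factorizations ?A UNIV ?r \<sigma>)"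
    by (rule inj_onI) (auto simp: factorizations_def mono_words_def intro!: transposition_list_inj)
  then have "monotone_hurwitz g \<alpha> = card (SIGMA \<sigma>:perms_of_type \<alpha>. factorizations ?A UNIV ?r \<sigma>)"
    unfolding monotone_hurwitz_def monotone_factorizations_eq by (rule card_image)
  also have "\<dots> = (\<Sum>\<sigma>\<in>perms_of_type \<alpha>. card (factorizations ?A UNIV ?r \<sigma>))"
    using fin by (intro card_SigmaI) auto
  also have "\<dots> = (\<Sum>\<sigma>\<in>perms_of_type \<alpha>. genus_count g (mset \<alpha>))"
  proof (rule sum.cong)
    fix \<sigma> assume "\<sigma> \<in> perms_of_type \<alpha>"
    then have "\<sigma> permutes ?A" "cycle_lengths ?A \<sigma> = mset \<alpha>" by (auto simp: perms_of_type_def)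
    then show "card (factorizations ?A UNIV ?r \<sigma>) = genus_count g (mset \<alpha>)"
      using card_factorizations_eq_hurwitz_count[of ?A \<sigma> ?r] by (simp add: genus_count_def sum_mset_sum_list)
  qed simp
  finally show ?thesis using ne fin by simp
qed

section \<open>Coefficients of the generating functions\<close>

abbreviation exponent :: "(nat \<Rightarrow>\<^sub>0 nat) \<Rightarrow> nat \<Rightarrow> nat" where
  "exponent \<equiv> Poly_Mapping.lookup"

abbreviation X :: "nat \<Rightarrow> nat \<Rightarrow> nat \<Rightarrow>\<^sub>0 nat" where
  "X \<equiv> Poly_Mapping.single"

text \<open>The parts encoded by the monomial \<open>m\<close> at the variables in \<open>J\<close>;
  the successor undoes the shift in x^(\<alpha> - 1).\<close>

definition parts :: "(nat \<Rightarrow>\<^sub>0 nat) \<Rightarrow> nat set \<Rightarrow> nat multiset" where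
  "parts m J = image_mset (\<lambda>v. Suc (exponent m v)) (mset_set J)"

definition series_coeff :: "int \<Rightarrow> nat multiset \<Rightarrow> rat" where
  "series_coeff g \<mu> = (if g < 0 then 0 else of_nat (genus_count (nat g) \<mu>))"

lemma exponents_Cons: "exponents (v # vs) (a # \<alpha>) = X v (a - 1) + exponents vs \<alpha>"
  by (simp only: exponents_def list.size(4) sum.lessThan_Suc_shift nth_Cons_0 nth_Cons_Suc add_Suc_right add_0_right One_nat_def)

text \<open>The bound on \<open>k\<close> makes the truncated difference
  \<open>m - X v (k - 1)\<close> an exact quotient of monomials.\<close>

lemma contributing_Cons:
  "contributing (v # vs) m = (\<Union>k\<in>{1..exponent m v + 1}. (#) k ` contributing vs (m - X v (k - 1)))"
proof (intro equalityI subsetI)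
  fix \<alpha> assume \<alpha>: "\<alpha> \<in> contributing (v # vs) m"
  then obtain k \<beta> where k: "\<alpha> = k # \<beta>" by (cases \<alpha>) (auto simp: contributing_def)
  then have m: "X v (k - 1) + exponents vs \<beta> = m" and k1: "1 \<le> k"
    and \<beta>: "length \<beta> = length vs" "\<forall>a\<in>set \<beta>. 1 \<le> a"
    using \<alpha> by (auto simp: contributing_def exponents_Cons)
  have "exponent m v = (k - 1) + exponent (exponents vs \<beta>) v"
    unfolding m[symmetric] by (simp add: lookup_add)
  then have "k \<in> {1..exponent m v + 1}" using k1 by auto
  moreover have "\<beta> \<in> contributing vs (m - X v (k - 1))"
    using \<beta> unfolding m[symmetric] by (simp add: contributing_def)
  ultimately show "\<alpha> \<in> (\<Union>k\<in>{1..exponent m v + 1}. (#) k ` contributing vs (m - X v (k - 1)))"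
    unfolding k by blast
next
  fix \<alpha> assume "\<alpha> \<in> (\<Union>k\<in>{1..exponent m v + 1}. (#) k ` contributing vs (m - X v (k - 1)))"
  then obtain k \<beta> where k: "k \<in> {1..exponent m v + 1}" "\<alpha> = k # \<beta>" "\<beta> \<in> contributing vs (m - X v (k - 1))"
    by blast
  have "X v (k - 1) + (m - X v (k - 1)) = m"
    using k(1) by (intro poly_mapping_eqI) (auto simp: lookup_add lookup_minus lookup_single when_def)
  then show "\<alpha> \<in> contributing (v # vs) m"
    using k by (auto simp: contributing_def exponents_Cons)
qed

lemma contributing_Nil: "contributing [] m = (if m = 0 then {[]} else {})"
  by (auto simp: contributing_def exponents_def)

lemma contributing_distinct:
  assumes "distinct vs"
  shows "contributing vs m =
    (if Poly_Mapping.keys m \<subseteq> set vs then {map (\<lambda>v. Suc (exponent m v)) vs} else {})"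
  using assms
proof (induction vs arbitrary: m)
  case Nil
  then show ?case by (simp add: contributing_Nil)
next
  case (Cons v vs)
  let ?m = "\<lambda>k. m - X v (k - 1)"
  have look: "exponent (m - X v c) u = (if u = v then exponent m v - c else exponent m u)" for c u
    by (auto simp: lookup_minus lookup_single when_def)
  \<comment> \<open>Since \<open>v\<close> does not recur in \<open>vs\<close>, the first entry has
    to use up the whole power of this variable.\<close>
  have keys: "Poly_Mapping.keys (?m k) \<subseteq> set vs \<longleftrightarrow> k = exponent m v + 1 \<and> Poly_Mapping.keys m \<subseteq> set (v # vs)"
    if "k \<in> {1..exponent m v + 1}" for k
    using that Cons.prems by (auto simp: subset_iff in_keys_iff look split: if_splits)
  have "contributing vs (?m k) = (if k = exponent m v + 1 \<and> Poly_Mapping.keys m \<subseteq> set (v # vs)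
      then {map (\<lambda>v. Suc (exponent m v)) vs} else {})" if "k \<in> {1..exponent m v + 1}" for k
  proof -
    have "map (\<lambda>u. Suc (exponent (?m k) u)) vs = map (\<lambda>u. Suc (exponent m u)) vs"
      using Cons.prems by (auto simp: look)
    moreover have "distinct vs" using Cons.prems by simp
    ultimately show ?thesis by (simp only: Cons.IH keys[OF that])
  qed
  then show ?case unfolding contributing_Cons by (auto split: if_splits)
qed

lemma coeff_monotone_series:
  assumes "vs \<noteq> []"
  shows "mfps_coeff (monotone_series g vs) m = (\<Sum>\<alpha>\<in>contributing vs m. series_coeff g (mset \<alpha>))"
proof (cases "g < 0")
  case True
  then show ?thesis by (simp add: monotone_series_def series_coeff_def zero_mfps.rep_eq)
next
  case False
  have "mfps_coeff (monotone_series g vs) m = (\<Sum>\<alpha>\<in>contributing vs m.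
      of_nat (monotone_hurwitz (nat g) \<alpha>) / of_nat (card (perms_of_type \<alpha>)))"
    using False by (simp add: monotone_series_def Abs_mfps_inverse)
  also have "\<dots> = (\<Sum>\<alpha>\<in>contributing vs m. series_coeff g (mset \<alpha>))"
  proof (rule sum.cong)
    fix \<alpha> assume "\<alpha> \<in> contributing vs m"
    then have "\<alpha> \<noteq> []" "\<forall>a\<in>set \<alpha>. a \<ge> 1" using assms by (auto simp: contributing_def)
    then show "of_nat (monotone_hurwitz (nat g) \<alpha>) / of_nat (card (perms_of_type \<alpha>)) = series_coeff g (mset \<alpha>)"
      using False by (simp add: monotone_hurwitz_ratio series_coeff_def)
  qed simp
  finally show ?thesis .
qed

lemma mset_map_parts:
  assumes "distinct vs"
  shows "mset (map (\<lambda>v. Suc (exponent m v)) vs) = parts m (set vs)"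
  using assms by (simp add: parts_def mset_set_set)

lemma parts_insert: "finite J \<Longrightarrow> v \<notin> J \<Longrightarrow> parts m (insert v J) = add_mset (Suc (exponent m v)) (parts m J)"
  by (simp add: parts_def)

lemma parts_cong: "(\<And>v. v \<in> J \<Longrightarrow> exponent m v = exponent m' v) \<Longrightarrow> parts m J = parts m' J"
  by (cases "finite J") (auto simp: parts_def intro!: image_mset_cong)

lemma coeff_monotone_series_distinct:
  assumes "distinct vs" "vs \<noteq> []"
  shows "mfps_coeff (monotone_series g vs) m =
    (if Poly_Mapping.keys m \<subseteq> set vs then series_coeff g (parts m (set vs)) else 0)"
  unfolding coeff_monotone_series[OF assms(2)] contributing_distinct[OF assms(1)]
  by (simp add: mset_map_parts[OF assms(1)] del: mset_map)

lemma keys_minus_single_subset: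
  "Poly_Mapping.keys (m - X v k) \<subseteq> insert v J \<longleftrightarrow> Poly_Mapping.keys m \<subseteq> insert v J"
  by (auto simp: subset_iff in_keys_iff lookup_minus lookup_single when_def split: if_splits)

text \<open>The two parts on the repeated variable share its exponent e: (k - 1) + (k' - 1) = e,
  hence k' = e + 2 - k.\<close>

lemma coeff_monotone_series_repeated:
  assumes "distinct (v # vs)"
  shows "mfps_coeff (monotone_series g (v # v # vs)) m =
    (if Poly_Mapping.keys m \<subseteq> insert v (set vs)
     then \<Sum>k = 1..exponent m v + 1. series_coeff g (add_mset k (add_mset (exponent m v + 2 - k) (parts m (set vs))))
     else 0)"
proof -
  let ?m = "\<lambda>k. m - X v (k - 1)"
  let ?K = "{1..exponent m v + 1}"
  have parts: "parts (?m k) (insert v (set vs)) = add_mset (exponent m v + 2 - k) (parts m (set vs))"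
    if "k \<in> ?K" for k
  proof -
    have "parts (?m k) (set vs) = parts m (set vs)"
      using assms by (intro parts_cong) (auto simp: lookup_minus lookup_single when_def)
    moreover have "exponent (?m k) v + 1 = exponent m v + 2 - k"
      using that by (auto simp: lookup_minus)
    ultimately show ?thesis using assms by (simp add: parts_insert)
  qed
  have "mfps_coeff (monotone_series g (v # v # vs)) m =
      (\<Sum>\<alpha>\<in>(\<Union>k\<in>?K. (#) k ` contributing (v # vs) (?m k)). series_coeff g (mset \<alpha>))"
    by (simp only: coeff_monotone_series[OF list.distinct(2)] contributing_Cons[of v "v # vs"])
  also have "\<dots> = (\<Sum>k\<in>?K. \<Sum>\<alpha>\<in>(#) k ` contributing (v # vs) (?m k). series_coeff g (mset \<alpha>))"
    by (rule sum.UNION_disjoint) (auto simp: finite_contributing)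
  also have "\<dots> = (\<Sum>k\<in>?K. if Poly_Mapping.keys m \<subseteq> insert v (set vs)
      then series_coeff g (add_mset k (add_mset (exponent m v + 2 - k) (parts m (set vs)))) else 0)"
  proof (rule sum.cong[OF refl])
    fix k assume k: "k \<in> ?K"
    have "(\<Sum>\<alpha>\<in>(#) k ` contributing (v # vs) (?m k). series_coeff g (mset \<alpha>)) =
        (\<Sum>\<alpha>\<in>contributing (v # vs) (?m k). series_coeff g (add_mset k (mset \<alpha>)))"
      by (subst sum.reindex) auto
    also have "\<dots> = (if Poly_Mapping.keys m \<subseteq> insert v (set vs)
      then series_coeff g (add_mset k (parts (?m k) (set (v # vs)))) else 0)"
      unfolding contributing_distinct[OF assms]
      using keys_minus_single_subset[of m v "k - 1" "set vs"]
      by (simp add: mset_map_parts[OF assms] del: mset_map list.map)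
    finally show "(\<Sum>\<alpha>\<in>(#) k ` contributing (v # vs) (?m k). series_coeff g (mset \<alpha>)) =
      (if Poly_Mapping.keys m \<subseteq> insert v (set vs)
      then series_coeff g (add_mset k (add_mset (exponent m v + 2 - k) (parts m (set vs)))) else 0)"
      using parts[OF k] by simp
  qed
  finally show ?thesis by simp
qed

text \<open>Only the variable \<open>v\<close> is common to the factors. A factorization of the
  monomial \<open>m\<close> is thus fixed by the power k - 1 of \<open>v\<close> that goes to the
  first factor.\<close>

lemma coeff_monotone_series_mult:
  assumes d: "distinct (v # us)" "distinct (v # ws)" and disj: "set us \<inter> set ws = {}"
  shows "mfps_coeff (monotone_series g (v # us) * monotone_series h (v # ws)) m =
    (if Poly_Mapping.keys m \<subseteq> insert v (set us \<union> set ws)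
     then \<Sum>k = 1..exponent m v + 1. series_coeff g (add_mset k (parts m (set us)))
        * series_coeff h (add_mset (exponent m v + 2 - k) (parts m (set ws)))
     else 0)"
proof -
  let ?U = "set us" and ?W = "set ws"
  define D where "D = {(p, q) \<in> splits m. Poly_Mapping.keys p \<subseteq> insert v ?U \<and> Poly_Mapping.keys q \<subseteq> insert v ?W}"
  have "mfps_coeff (monotone_series g (v # us) * monotone_series h (v # ws)) m =
      (\<Sum>(p, q)\<in>splits m. (if Poly_Mapping.keys p \<subseteq> insert v ?U then series_coeff g (parts p (insert v ?U)) else 0)
        * (if Poly_Mapping.keys q \<subseteq> insert v ?W then series_coeff h (parts q (insert v ?W)) else 0))"
    unfolding times_mfps.rep_eq coeff_monotone_series_distinct[OF d(1) list.distinct(2), unfolded list.set(2)]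
      coeff_monotone_series_distinct[OF d(2) list.distinct(2), unfolded list.set(2)] ..
  also have "\<dots> = (\<Sum>(p, q)\<in>D. series_coeff g (parts p (insert v ?U)) * series_coeff h (parts q (insert v ?W)))"
    by (rule sum.mono_neutral_cong_right) (auto simp: D_def split: if_splits)
  finally have eq: "mfps_coeff (monotone_series g (v # us) * monotone_series h (v # ws)) m = \<dots>" .
  show ?thesis
  proof (cases "Poly_Mapping.keys m \<subseteq> insert v (?U \<union> ?W)")
    case False
    have "D = {}"
    proof (rule equals0I)
      fix pq assume "pq \<in> D"
      then obtain p q where "m = p + q" "Poly_Mapping.keys p \<subseteq> insert v ?U" "Poly_Mapping.keys q \<subseteq> insert v ?W"
        by (auto simp: D_def splits_def)
      then show False using False Poly_Mapping.keys_add[of p q] by blast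
    qed
    then show ?thesis using False eq by simp
  next
    case True
    define p where "p k = X v (k - 1) + (\<Sum>u\<in>?U. X u (exponent m u))" for k
    have look_p: "exponent (p k) u = (if u = v then k - 1 else if u \<in> ?U then exponent m u else 0)" for k u
    proof -
      have "exponent (\<Sum>u\<in>?U. X u (exponent m u)) u = (\<Sum>u'\<in>?U. if u' = u then exponent m u' else 0)"
        by (simp add: lookup_sum lookup_single when_def)
      also have "\<dots> = (if u \<in> ?U then exponent m u else 0)" by (simp add: sum.delta)
      finally show ?thesis using d(1) by (auto simp: p_def lookup_add lookup_single when_def)
    qed
    have look_q: "exponent (m - p k) u = (if u = v then exponent m v - (k - 1) else if u \<in> ?W then exponent m u else 0)" for k u
      using True disj d(2) by (auto simp: lookup_minus look_p subset_iff in_keys_iff)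
    let ?K = "{1..exponent m v + 1}"
    have "(\<Sum>(p, q)\<in>D. series_coeff g (parts p (insert v ?U)) * series_coeff h (parts q (insert v ?W))) =
      (\<Sum>k\<in>?K. series_coeff g (add_mset k (parts m ?U)) * series_coeff h (add_mset (exponent m v + 2 - k) (parts m ?W)))"
    proof (rule sum.reindex_bij_witness[where i = "\<lambda>k. (p k, m - p k)" and j = "\<lambda>(p', q). exponent p' v + 1"])
      fix pq assume "pq \<in> D"
      then obtain p' q where pq: "pq = (p', q)" "m = p' + q" "Poly_Mapping.keys p' \<subseteq> insert v ?U" "Poly_Mapping.keys q \<subseteq> insert v ?W"
        by (auto simp: D_def splits_def)
      have zero: "u \<noteq> v \<Longrightarrow> u \<notin> ?U \<Longrightarrow> exponent p' u = 0" "u \<noteq> v \<Longrightarrow> u \<notin> ?W \<Longrightarrow> exponent q u = 0" for u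
        using pq by (auto simp: subset_iff in_keys_iff)
      have m: "exponent m u = exponent p' u + exponent q u" for u unfolding pq(2) by (simp add: lookup_add)
      have p': "p (exponent p' v + 1) = p'"
        using disj zero by (intro poly_mapping_eqI) (auto simp: look_p m)
      show "(\<lambda>k. (p k, m - p k)) (case pq of (p', q) \<Rightarrow> exponent p' v + 1) = pq"
        using p' pq(1,2) by simp
      show "(case pq of (p', q) \<Rightarrow> exponent p' v + 1) \<in> ?K"
        using pq(1) m[of v] by simp
      have "exponent q u = 0" if "u \<in> ?U" for u
        using that disj d(1) by (intro zero(2)) auto
      moreover have "exponent p' u = 0" if "u \<in> ?W" for u
        using that disj d(2) by (intro zero(1)) auto
      ultimately have "parts p' ?U = parts m ?U" "parts q ?W = parts m ?W"
        by (auto intro!: parts_cong simp: m)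
      then show "series_coeff g (add_mset (case pq of (p', q) \<Rightarrow> exponent p' v + 1) (parts m ?U)) *
          series_coeff h (add_mset (exponent m v + 2 - (case pq of (p', q) \<Rightarrow> exponent p' v + 1)) (parts m ?W)) =
        (case pq of (p', q) \<Rightarrow> series_coeff g (parts p' (insert v ?U)) * series_coeff h (parts q (insert v ?W)))"
        using d m[of v] pq(1) by (simp add: parts_insert)
    next
      fix k assume k: "k \<in> ?K"
      show "(case (p k, m - p k) of (p', q) \<Rightarrow> exponent p' v + 1) = k"
        using k by (simp add: look_p)
      have "p k + (m - p k) = m"
        using True k disj d by (intro poly_mapping_eqI) (auto simp: lookup_add look_p look_q subset_iff in_keys_iff)
      moreover have "Poly_Mapping.keys (p k) \<subseteq> insert v ?U" "Poly_Mapping.keys (m - p k) \<subseteq> insert v ?W"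
        by (auto simp: in_keys_iff look_p look_q split: if_splits)
      ultimately show "(p k, m - p k) \<in> D" by (simp add: D_def splits_def)
    qed
    then show ?thesis using True eq by simp
  qed
qed

section \<open>Coefficients of the single terms of the recursion\<close>

lemma exponent_minus_single: "exponent (m - X v k) u = (if u = v then exponent m v - k else exponent m u)"
  by (auto simp: lookup_minus lookup_single when_def)

lemma exponent_plus_single: "exponent (m + X v k) u = (if u = v then exponent m v + k else exponent m u)"
  by (auto simp: lookup_add lookup_single when_def)

lemma mfps_coeff_var_mult:
  "mfps_coeff (mfps_var i * f) m = (if exponent m i = 0 then 0 else mfps_coeff f (m - X i 1))"
  by (simp only: mult.commute[of "mfps_var i"] mfps_coeff_mult_var)

lemma mfps_coeff_sum: "mfps_coeff (sum f A) m = (\<Sum>i\<in>A. mfps_coeff (f i) m)"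
  by (induction A rule: infinite_finite_induct) (simp_all add: zero_mfps.rep_eq plus_mfps.rep_eq)

text \<open>The factor x_v lowers the available exponent by one, so the two parts sum to a =
  \<open>Suc (exponent m v)\<close>: these are the cuts of a cycle of length a. The same shift
  occurs in \<open>coeff_var_mult_product\<close>.\<close>

lemma coeff_var_mult_repeated:
  assumes "distinct (v # vs)"
  shows "mfps_coeff (mfps_var v * monotone_series g (v # v # vs)) m =
    (if Poly_Mapping.keys m \<subseteq> insert v (set vs)
     then \<Sum>k = 1..<Suc (exponent m v). series_coeff g (add_mset k (add_mset (Suc (exponent m v) - k) (parts m (set vs))))
     else 0)"
proof (cases "exponent m v")
  case 0
  then show ?thesis by (simp add: mfps_coeff_var_mult)
next
  case (Suc e)
  have "parts (m - X v 1) (set vs) = parts m (set vs)"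
    using assms by (intro parts_cong) (auto simp: exponent_minus_single)
  moreover have "{1..e + 1} = {1..<Suc (Suc e)}" by auto
  ultimately show ?thesis
    using Suc by (simp only: mfps_coeff_var_mult coeff_monotone_series_repeated[OF assms] keys_minus_single_subset
        exponent_minus_single) simp
qed

lemma coeff_var_mult_product:
  assumes "distinct (v # us)" "distinct (v # ws)" "set us \<inter> set ws = {}"
  shows "mfps_coeff (mfps_var v * monotone_series g (v # us) * monotone_series h (v # ws)) m =
    (if Poly_Mapping.keys m \<subseteq> insert v (set us \<union> set ws)
     then \<Sum>k = 1..<Suc (exponent m v). series_coeff g (add_mset k (parts m (set us)))
        * series_coeff h (add_mset (Suc (exponent m v) - k) (parts m (set ws)))
     else 0)"
proof (cases "exponent m v")
  case 0
  then show ?thesis by (simp add: mfps_coeff_var_mult mult.assoc)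
next
  case (Suc e)
  have "parts (m - X v 1) (set us) = parts m (set us)" "parts (m - X v 1) (set ws) = parts m (set ws)"
    using assms by (auto simp: exponent_minus_single intro!: parts_cong)
  moreover have "{1..e + 1} = {1..<Suc (Suc e)}" by auto
  ultimately show ?thesis
    using Suc by (simp only: mult.assoc mfps_coeff_var_mult coeff_monotone_series_mult[OF assms] keys_minus_single_subset
        exponent_minus_single) simp
qed

text \<open>The quotient of \<open>x\<^sub>v\<^sup>a - x\<^sub>j\<^sup>a\<close> by \<open>x\<^sub>v - x\<^sub>j\<close> is the sum of all monomials of degree \<open>a - 1\<close> in
  these two variables.\<close>

lemma coeff_deriv_quotient:
  assumes "v \<noteq> j" and U: "finite U" "v \<notin> U" "j \<notin> U"
    and A: "distinct as" "set as = insert v U" and B: "distinct bs" "set bs = insert j U"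
  shows "mfps_coeff (mfps_deriv j (mfps_quotient (mfps_var v * monotone_series g as - mfps_var j * monotone_series g bs)
      (mfps_var v - mfps_var j))) m =
    (if Poly_Mapping.keys m \<subseteq> insert v (insert j U)
     then of_nat (Suc (exponent m j)) * series_coeff g (add_mset (Suc (exponent m v) + Suc (exponent m j)) (parts m U))
     else 0)"
proof -
  \<comment> \<open>A monomial of degree a - 1 in the two variables carries the coefficient of the
    part a, so a is the sum of the two exponents plus one.\<close>
  define H :: "rat mfps" where "H = Abs_mfps (\<lambda>m. if Poly_Mapping.keys m \<subseteq> insert v (insert j U)
    then series_coeff g (add_mset (Suc (exponent m v + exponent m j)) (parts m U)) else 0)"
  have H: "mfps_coeff H m = (if Poly_Mapping.keys m \<subseteq> insert v (insert j U)
    then series_coeff g (add_mset (Suc (exponent m v + exponent m j)) (parts m U)) else 0)" for m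
    by (simp add: H_def Abs_mfps_inverse)
  have ne: "as \<noteq> []" "bs \<noteq> []" using A B by auto
  have parts: "parts (m - X u k) U = parts m U" if "u \<notin> U" for m u k
    using that by (intro parts_cong) (auto simp: exponent_minus_single)
  have "H * (mfps_var v - mfps_var j) = mfps_var v * monotone_series g as - mfps_var j * monotone_series g bs"
  proof (rule mfps_eqI)
    fix m
    let ?K = "Poly_Mapping.keys m \<subseteq> insert v (insert j U)" and ?F = "\<lambda>a. series_coeff g (add_mset a (parts m U))"
    have Hv: "mfps_coeff H (m - X v 1) = (if ?K then ?F (exponent m v + exponent m j) else 0)" if "exponent m v \<noteq> 0"
      using that assms(1) U by (simp add: H keys_minus_single_subset exponent_minus_single parts)
    have Hj: "mfps_coeff H (m - X j 1) = (if ?K then ?F (exponent m v + exponent m j) else 0)" if "exponent m j \<noteq> 0"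
      using that assms(1) U keys_minus_single_subset[of m j 1 "insert v U"]
      by (simp add: H exponent_minus_single parts insert_commute[of v j])
    have Kv: "Poly_Mapping.keys m \<subseteq> insert v U \<longleftrightarrow> ?K \<and> exponent m j = 0"
      using assms(1) U in_keys_iff[of j m] by blast
    have Kj: "Poly_Mapping.keys m \<subseteq> insert j U \<longleftrightarrow> ?K \<and> exponent m v = 0"
      using assms(1) U in_keys_iff[of v m] by blast
    have Av: "mfps_coeff (monotone_series g as) (m - X v 1) = (if ?K \<and> exponent m j = 0 then ?F (exponent m v) else 0)"
      if "exponent m v \<noteq> 0"
      using that U unfolding coeff_monotone_series_distinct[OF A(1) ne(1)] A(2) keys_minus_single_subset Kv
      by (simp add: parts_insert exponent_minus_single parts)
    have Bj: "mfps_coeff (monotone_series g bs) (m - X j 1) = (if ?K \<and> exponent m v = 0 then ?F (exponent m j) else 0)"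
      if "exponent m j \<noteq> 0"
      using that U unfolding coeff_monotone_series_distinct[OF B(1) ne(2)] B(2) keys_minus_single_subset Kj
      by (simp add: parts_insert exponent_minus_single parts)
    show "mfps_coeff (H * (mfps_var v - mfps_var j)) m =
        mfps_coeff (mfps_var v * monotone_series g as - mfps_var j * monotone_series g bs) m"
      \<comment> \<open>If both variables occur in \<open>m\<close>, the two shifts of
        \<open>H\<close> cancel; if only one occurs, a single shift remains and equals the term of
        the matching series.\<close>
      using Hv Hj Av Bj
      by (cases "exponent m v = 0"; cases "exponent m j = 0")
        (simp_all add: right_diff_distrib minus_mfps.rep_eq mfps_coeff_mult_var mfps_coeff_var_mult)
  qed
  then have "mfps_quotient (mfps_var v * monotone_series g as - mfps_var j * monotone_series g bs)
      (mfps_var v - mfps_var j) = H"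
    by (rule mfps_quotient_eqI[OF assms(1)])
  moreover have "parts (m + X j 1) U = parts m U"
    using U by (intro parts_cong) (auto simp: exponent_plus_single)
  moreover have "Poly_Mapping.keys (m + X j 1) \<subseteq> insert v (insert j U) \<longleftrightarrow> Poly_Mapping.keys m \<subseteq> insert v (insert j U)"
    by (auto simp: subset_iff in_keys_iff exponent_plus_single)
  \<comment> \<open>Differentiation raises the exponent of x_j by one, so the part becomes the sum
    of the parts at v and j, and its factor is the part at j, as in the join term.\<close>
  ultimately show ?thesis
    using assms(1) by (simp add: mfps_deriv.rep_eq H exponent_plus_single)
qed

theorem theorem1p8:
  fixes g :: int and l :: nat
  assumes "g \<ge> 0" and "l \<ge> 1"
  shows "monotone_series g [1..<l+1] =
      (if g = 0 \<and> l = 1 then 1 else 0)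
    + mfps_var 1 * monotone_series (g - 1) (1 # [1..<l+1])
    + (\<Sum>j\<in>{2..l}. mfps_deriv j
         (mfps_quotient
           (mfps_var 1 * monotone_series g (removeAll j [1..<l+1])
              - mfps_var j * monotone_series g [2..<l+1])
           (mfps_var 1 - mfps_var j)))
    + (\<Sum>g'\<in>{0..g}. \<Sum>S\<in>Pow {2..l}.
         mfps_var 1 * monotone_series g' (1 # sorted_list_of_set S)
           * monotone_series (g - g') (1 # sorted_list_of_set ({2..l} - S)))"
proof (rule mfps_eqI)
  fix m
  obtain n where g: "g = int n" using assms(1) nonneg_int_cases by blast
  \<comment> \<open>\<open>?a\<close> is the part \<alpha>_1 encoded by \<open>m\<close>. Condition
    \<open>?K\<close> says that \<open>m\<close> involves only x_1, ..., x_l; otherwise every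
    coefficient below vanishes.\<close>
  let ?J = "{2..l}" and ?a = "Suc (exponent m 1)" and ?K = "Poly_Mapping.keys m \<subseteq> insert 1 {2..l}"
  let ?P = "parts m"
  have list: "[1..<l+1] = 1 # [2..<l+1]"
    using upt_conv_Cons[of 1 "l + 1"] assms(2) by (simp add: numeral_2_eq_2)
  have J: "set [2..<l+1] = ?J" "distinct (1 # [2..<l+1])" by auto
  have lhs: "mfps_coeff (monotone_series g [1..<l+1]) m = (if ?K then series_coeff g (add_mset ?a (?P ?J)) else 0)"
    unfolding list coeff_monotone_series_distinct[OF J(2) list.distinct(2)] list.set(2) J(1)
    by (simp add: parts_insert)
  have delta: "mfps_coeff (if g = 0 \<and> l = 1 then 1 else 0 :: rat mfps) m =
      (if ?K then of_bool (n = 0 \<and> ?J = {} \<and> ?a = 1) else 0)"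
  proof -
    have "?J = {} \<longleftrightarrow> l = 1" using assms(2) by auto
    moreover have "m = 0 \<longleftrightarrow> ?K \<and> exponent m 1 = 0" if "l = 1"
      using that by (auto simp: subset_iff in_keys_iff intro!: poly_mapping_eqI)
    ultimately show ?thesis by (auto simp: g one_mfps.rep_eq zero_mfps.rep_eq)
  qed
  have cut: "mfps_coeff (mfps_var 1 * monotone_series (g - 1) (1 # [1..<l+1])) m =
      (if ?K then \<Sum>k = 1..<?a. series_coeff (g - 1) (add_mset k (add_mset (?a - k) (?P ?J))) else 0)"
    unfolding list coeff_var_mult_repeated[OF J(2)] J(1) ..
  have join: "mfps_coeff (mfps_deriv j (mfps_quotient
      (mfps_var 1 * monotone_series g (removeAll j [1..<l+1]) - mfps_var j * monotone_series g [2..<l+1])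
      (mfps_var 1 - mfps_var j))) m =
    (if ?K then of_nat (Suc (exponent m j)) * series_coeff g (add_mset (?a + Suc (exponent m j)) (?P (?J - {j}))) else 0)"
    if j: "j \<in> ?J" for j
  proof -
    have "insert 1 (insert j (?J - {j})) = insert 1 ?J" using j by blast
    moreover have "set (removeAll j [1..<l+1]) = insert 1 (?J - {j})"
      unfolding list using j by auto
    moreover have "set [2..<l+1] = insert j (?J - {j})" using j by auto
    ultimately show ?thesis
      using coeff_deriv_quotient[of 1 j "?J - {j}" "removeAll j [1..<l+1]" "[2..<l+1]" g m] j
      by (simp add: distinct_removeAll)
  qed
  have split: "mfps_coeff (mfps_var 1 * monotone_series g' (1 # sorted_list_of_set S)
           * monotone_series (g - g') (1 # sorted_list_of_set (?J - S))) m =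
    (if ?K then \<Sum>k = 1..<?a. series_coeff g' (add_mset k (?P S)) * series_coeff (g - g') (add_mset (?a - k) (?P (?J - S))) else 0)"
    if S: "S \<in> Pow ?J" for g' S
  proof -
    have fin: "finite S" using S finite_subset by auto
    have "S \<union> (?J - S) = ?J" using S by blast
    moreover have "distinct (1 # sorted_list_of_set S)" "distinct (1 # sorted_list_of_set (?J - S))"
      using S fin by auto
    ultimately show ?thesis
      using coeff_var_mult_product[of 1 "sorted_list_of_set S" "sorted_list_of_set (?J - S)" g' "g - g'" m] fin by simp
  qed
  have rec: "series_coeff g (add_mset ?a (?P ?J)) =
      of_bool (n = 0 \<and> ?J = {} \<and> ?a = 1)
    + (\<Sum>k = 1..<?a. series_coeff (g - 1) (add_mset k (add_mset (?a - k) (?P ?J))))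
    + (\<Sum>j\<in>?J. of_nat (Suc (exponent m j)) * series_coeff g (add_mset (?a + Suc (exponent m j)) (?P (?J - {j}))))
    + (\<Sum>g'\<in>{0..g}. \<Sum>S\<in>Pow ?J. \<Sum>k = 1..<?a.
        series_coeff g' (add_mset k (?P S)) * series_coeff (g - g') (add_mset (?a - k) (?P (?J - S))))"
  proof -
    have cut_coeff: "series_coeff (g - 1) \<mu> = of_nat (if n = 0 then 0 else genus_count (n - 1) \<mu>)" for \<mu>
      by (simp add: series_coeff_def g nat_diff_distrib')
    have coeff: "series_coeff (int h) \<mu> = of_nat (genus_count h \<mu>)" for h \<mu>
      by (simp add: series_coeff_def)
    \<comment> \<open>The genus is turned into a natural number and the sum over \<open>k\<close>
      moved outward, to match the order of summation in \<open>genus_count_rec\<close>.\<close>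
    have "(\<Sum>g'\<in>{0..g}. \<Sum>S\<in>Pow ?J. \<Sum>k = 1..<?a.
        series_coeff g' (add_mset k (?P S)) * series_coeff (g - g') (add_mset (?a - k) (?P (?J - S)))) =
      (\<Sum>h\<le>n. \<Sum>S\<in>Pow ?J. \<Sum>k = 1..<?a.
        series_coeff (int h) (add_mset k (?P S)) * series_coeff (int (n - h)) (add_mset (?a - k) (?P (?J - S))))"
    proof (rule sum.reindex_bij_witness[where i = int and j = nat])
      fix g' assume "g' \<in> {0..g}"
      then have "int (nat g') = g'" "int (n - nat g') = g - g'" by (simp_all add: g of_nat_diff nat_le_iff)
      then show "(\<Sum>S\<in>Pow ?J. \<Sum>k = 1..<?a. series_coeff (int (nat g')) (add_mset k (?P S))
            * series_coeff (int (n - nat g')) (add_mset (?a - k) (?P (?J - S)))) =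
          (\<Sum>S\<in>Pow ?J. \<Sum>k = 1..<?a. series_coeff g' (add_mset k (?P S))
            * series_coeff (g - g') (add_mset (?a - k) (?P (?J - S))))"
        by (simp only:)
    qed (auto simp: g)
    also have "\<dots> = (\<Sum>h\<le>n. \<Sum>k = 1..<?a. \<Sum>S\<in>Pow ?J.
        series_coeff (int h) (add_mset k (?P S)) * series_coeff (int (n - h)) (add_mset (?a - k) (?P (?J - S))))"
      by (intro sum.cong refl sum.swap)
    also have "\<dots> = (\<Sum>k = 1..<?a. \<Sum>h\<le>n. \<Sum>S\<in>Pow ?J.
        series_coeff (int h) (add_mset k (?P S)) * series_coeff (int (n - h)) (add_mset (?a - k) (?P (?J - S))))"
      by (rule sum.swap)
    also have "\<dots> = (\<Sum>k = 1..<?a. \<Sum>S\<in>Pow ?J. \<Sum>h\<le>n.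
        series_coeff (int h) (add_mset k (?P S)) * series_coeff (int (n - h)) (add_mset (?a - k) (?P (?J - S))))"
      by (intro sum.cong refl sum.swap)
    finally show ?thesis
      using arg_cong[OF genus_count_rec[of ?J ?a "\<lambda>v. Suc (exponent m v)" n, folded parts_def], of "of_nat :: nat \<Rightarrow> rat"]
      by (simp only: g coeff cut_coeff[unfolded g] of_nat_add of_nat_sum of_nat_mult of_nat_of_bool) simp
  qed
  show "mfps_coeff (monotone_series g [1..<l+1]) m = mfps_coeff ((if g = 0 \<and> l = 1 then 1 else 0)
    + mfps_var 1 * monotone_series (g - 1) (1 # [1..<l+1])
    + (\<Sum>j\<in>{2..l}. mfps_deriv j
         (mfps_quotient
           (mfps_var 1 * monotone_series g (removeAll j [1..<l+1])
              - mfps_var j * monotone_series g [2..<l+1])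
           (mfps_var 1 - mfps_var j)))
    + (\<Sum>g'\<in>{0..g}. \<Sum>S\<in>Pow {2..l}.
         mfps_var 1 * monotone_series g' (1 # sorted_list_of_set S)
           * monotone_series (g - g') (1 # sorted_list_of_set ({2..l} - S)))) m"
    unfolding plus_mfps.rep_eq mfps_coeff_sum lhs delta cut
    using rec by (simp only: join split cong: sum.cong) (cases ?K; simp only: if_True if_False sum.neutral_const add_0_left)
qed

end
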